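(* Let $m,n$ be positive integers with $\gcd(m,n)=1$, let $\eta\ge 0$, and put $M=\frac{2m+2n}{m+n-1}$ and $L=\max\left(\frac{2m+2n}{m+n+1+mn\eta},\,1\right)$. Let $T_\eta=T_\phi$ be the Toeplitz operator on $\mathbb{H}_{m/n}$ with symbol $$\phi(z)=(|z_2|^n-|z_1|^m)^\eta(1-|z_2|^2)^\eta.$$ Let $p\in(L,M)$. Then: (a) If $\eta\ge 2\left(\frac1p-\frac1M\right)$, then $T_\eta:L^p(\mathbb{H}_{m/n})\to L^r(\mathbb{H}_{m/n})$ is a bounded operator for any $1\le r<M$. (b) If $\eta<2\left(\frac1p-\frac1M\right)$, then $T_\eta:L^p(\mathbb{H}_{m/n})\to L^{p+G}(\mathbb{H}_{m/n})$ is a bounded operator, where $$G=\frac{p^2}{\frac{2}{\eta}-p}$$ (with $G=0$ when $\eta=0$), and in this case $p+G<M$. Furthermore, if $p\in(1,L]\cup[M,\infty)$, then $T_\eta$ does not map $L^p(\mathbb{H}_{m/n})$ to $L^r(\mathbb{H}_{m/n})$ boundedly for any $r\ge p$.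
   Context: For $\gamma>0$ the generalized Hartogs triangle is $\mathbb{H}_\gamma=\{(z_1,z_2)\in\mathbb{C}^2: |z_1|^\gamma<|z_2|<1\}$; here $\gamma=m/n$. $dV$ is Lebesgue measure, $L^p(\mathbb{H}_\gamma)$ is taken with respect to $dV$, and $A^2(\mathbb{H}_\gamma)$ is the space of holomorphic functions in $L^2(\mathbb{H}_\gamma)$. The Bergman projection $\mathbf{B}_\gamma$ is the orthogonal projection of $L^2(\mathbb{H}_\gamma)$ onto its closed subspace $A^2(\mathbb{H}_\gamma)$; it is the integral operator $\mathbf{B}_\gamma f(z)=\int_{\mathbb{H}_\gamma}B_\gamma(z,w)f(w)\,dV(w)$, where $B_\gamma(z,w)$ is the Bergman kernel. For a bounded symbol $\phi$, the Toeplitz operator is $T_\phi f(z)=\mathbf{B}_\gamma(\phi f)(z)=\int_{\mathbb{H}_\gamma}B_\gamma(z,w)f(w)\phi(w)\,dV(w)$. "$T_\phi$ maps $L^p$ to $L^r$ boundedly" (equivalently, $T_\phi:L^p\to L^r$ is a bounded operator) means that for every $f\in L^p$ this integral converges absolutely for almost every $z$ and $\|T_\phi f\|_r\le C\|f\|_p$ with $C$ independent of $f$. *)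

theory Defs
  imports "HOL-Analysis.Analysis"
begin

definition hartogs_triangle :: "real \<Rightarrow> (complex \<times> complex) set" where
  "hartogs_triangle \<gamma> = {(z1, z2). cmod z1 powr \<gamma> < cmod z2 \<and> cmod z2 < 1}"

definition Lp_space :: "real \<Rightarrow> 'a measure \<Rightarrow> ('a \<Rightarrow> complex) set" where
  "Lp_space p N = {f \<in> borel_measurable N. integrable N (\<lambda>x. cmod (f x) powr p)}"

definition Lp_norm :: "real \<Rightarrow> 'a measure \<Rightarrow> ('a \<Rightarrow> complex) \<Rightarrow> real" where
  "Lp_norm p N f = (\<integral>x. cmod (f x) powr p \<partial>N) powr (1 / p)"

text \<open>Holomorphy in two variables, meant for open \<open>\<Omega>\<close>: the real Frechet derivative exists at
  every point and is complex linear.\<close>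

definition holomorphic2_on :: "(complex \<times> complex \<Rightarrow> complex) \<Rightarrow> (complex \<times> complex) set \<Rightarrow> bool"
    (infixl "(holomorphic2'_on)" 50) where
  "f holomorphic2_on \<Omega> \<longleftrightarrow>
     (\<forall>z\<in>\<Omega>. \<exists>D. (f has_derivative D) (at z) \<and> (\<forall>c u v. D (c * u, c * v) = c * D (u, v)))"

definition bergman_space :: "(complex \<times> complex) set \<Rightarrow> (complex \<times> complex \<Rightarrow> complex) set" where
  "bergman_space \<Omega> = {f. f holomorphic2_on \<Omega> \<and> f \<in> Lp_space 2 (lebesgue_on \<Omega>)}"

text \<open>\<open>bergman_representer \<Omega> z\<close> is the element of the Bergman space that represents evaluation
  at \<open>z \<in> \<Omega>\<close> with respect to the \<open>L\<^sup>2\<close> inner product. Elements of the Bergman space are total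
  functions with arbitrary values off \<open>\<Omega>\<close>; requiring the representer to vanish there makes it
  unique.\<close>

definition bergman_representer ::
    "(complex \<times> complex) set \<Rightarrow> complex \<times> complex \<Rightarrow> complex \<times> complex \<Rightarrow> complex" where
  "bergman_representer \<Omega> z =
     (THE k. k \<in> bergman_space \<Omega> \<and> (\<forall>w. w \<notin> \<Omega> \<longrightarrow> k w = 0) \<and>
        (\<forall>f\<in>bergman_space \<Omega>. f z = (\<integral>w. f w * cnj (k w) \<partial>lebesgue_on \<Omega>)))"

definition bergman_kernel ::
    "(complex \<times> complex) set \<Rightarrow> complex \<times> complex \<Rightarrow> complex \<times> complex \<Rightarrow> complex" where
  "bergman_kernel \<Omega> z w = cnj (bergman_representer \<Omega> z w)"

text \<open>The integral operator with the Bergman kernel. On \<open>L\<^sup>2\<close> it is the orthogonal projection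
  onto the Bergman space; the integral formula is what extends it to other \<open>L\<^sup>p\<close>. Where the integral
  does not converge absolutely, the Bochner integral has value 0, so convergence is demanded
  separately in \<open>toeplitz_bounded\<close>.\<close>

definition bergman_projection ::
    "(complex \<times> complex) set \<Rightarrow> (complex \<times> complex \<Rightarrow> complex) \<Rightarrow> complex \<times> complex \<Rightarrow> complex" where
  "bergman_projection \<Omega> f z = (\<integral>w. bergman_kernel \<Omega> z w * f w \<partial>lebesgue_on \<Omega>)"

definition toeplitz ::
    "(complex \<times> complex) set \<Rightarrow> (complex \<times> complex \<Rightarrow> complex) \<Rightarrow>
     (complex \<times> complex \<Rightarrow> complex) \<Rightarrow> complex \<times> complex \<Rightarrow> complex" where
  "toeplitz \<Omega> \<phi> f = bergman_projection \<Omega> (\<lambda>w. \<phi> w * f w)"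

definition toeplitz_bounded ::
    "(complex \<times> complex) set \<Rightarrow> (complex \<times> complex \<Rightarrow> complex) \<Rightarrow> real \<Rightarrow> real \<Rightarrow> bool" where
  "toeplitz_bounded \<Omega> \<phi> p r \<longleftrightarrow>
     (\<exists>C. \<forall>f\<in>Lp_space p (lebesgue_on \<Omega>).
        (AE z in lebesgue_on \<Omega>.
           integrable (lebesgue_on \<Omega>) (\<lambda>w. bergman_kernel \<Omega> z w * (\<phi> w * f w))) \<and>
        toeplitz \<Omega> \<phi> f \<in> Lp_space r (lebesgue_on \<Omega>) \<and>
        Lp_norm r (lebesgue_on \<Omega>) (toeplitz \<Omega> \<phi> f) \<le> C * Lp_norm p (lebesgue_on \<Omega>) f)"

definition hartogs_symbol :: "nat \<Rightarrow> nat \<Rightarrow> real \<Rightarrow> complex \<times> complex \<Rightarrow> complex" where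
  "hartogs_symbol m n \<eta> = (\<lambda>(z1, z2).
     of_real ((cmod z2 ^ n - cmod z1 ^ m) powr \<eta> * (1 - (cmod z2)\<^sup>2) powr \<eta>))"

end

theory Submission
  imports Defs "HOL-Complex_Analysis.Complex_Analysis"
begin

text \<open>The functions \<open>u = z\<^sub>1\<^sup>m / z\<^sub>2\<^sup>n\<close> and \<open>t = z\<^sub>2\<close> map the Hartogs triangle onto the product of a disc and a
  punctured disc. Summing over the square integrable monomials gives the Bergman kernel in closed form;
  it is dominated by the product of the two disc kernels \<open>|1 - u\<^sub>z u\<^sub>w|\<^bsup>-2\<^esup>\<close>, \<open>|1 - t\<^sub>z t\<^sub>w|\<^bsup>-2\<^esup>\<close> (second arguments
  conjugated) times \<open>|z\<^sub>2 w\<^sub>2|\<^bsup>-\<kappa>\<^esup>\<close> with \<open>\<kappa> = (m + n - 1) / m\<close>. The symbol contributes \<open>|w\<^sub>2|\<^bsup>n\<eta>\<^esup>\<close> and the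
  weights \<open>(1 - |u|)\<^sup>\<eta> (1 - |t|)\<^sup>\<eta>\<close>, which act as a fractional integration of order \<open>\<eta>\<close> on each disc. A Schur
  test from \<open>L\<^sup>p\<close> to \<open>L\<^sup>q\<close> with \<open>1/q = 1/p - \<eta>/2\<close> works as soon as \<open>|z\<^sub>2|\<^bsup>-\<kappa>\<^esup>\<close> lies in \<open>L\<^sup>q\<close> and
  \<open>|w\<^sub>2|\<^bsup>n\<eta>-\<kappa>\<^esup>\<close> lies in the dual of \<open>L\<^sup>p\<close>, that is, \<open>q < M\<close> and \<open>p > L\<close>. Conversely, since \<open>m\<close> and \<open>n\<close> are
  coprime, some square integrable monomial has exactly the growth \<open>|z\<^sub>2|\<^bsup>-\<kappa>\<^esup>\<close> where \<open>|u|\<close> is bounded below; it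
  lies in the range of the operator, so \<open>r < M\<close>, and pairing with it against the symbol forces \<open>p > L\<close>.\<close>

subsection \<open>Rotation invariance and radial integrals in the plane\<close>

text \<open>The kernel is defined through a unique representer, so its closed form must be shown to
  reproduce every function of the Bergman space. Each function is expanded in z1 on the slices of
  fixed z2; the coefficients are holomorphic only on a punctured disc, and square integrability
  decides which negative powers of z2 survive there. The constants have one origin: integration over
  a slice contributes |z2|^(2n/m), so |z2|^c is integrable iff c + 2n/m > -2. For c = -\<kappa> q
  this is q < M; for c = (n \<eta> - \<kappa>) p/(p-1) with p > 1 it is p > L. The Schur test may
  use any part \<eta>' of \<eta>, with 1/q = 1/p - \<eta>'/2. In (b) all of \<eta> is used and q
  stays below M. In (a) the full gain would make 1/q at most 1/M, so \<eta>' is chosen smaller, and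
  the finite measure lowers q to r. For necessity, rotations in both variables show that a monomial
  times a rotation invariant weight is mapped to a multiple of the same monomial; boundedness then
  becomes integrability of explicit powers.\<close>

lemma lborel_complex:
  "lborel = distr (lborel \<Otimes>\<^sub>M lborel) borel (\<lambda>(x, y). Complex x y)"
proof (rule lborel_eqI)
  have [measurable]: "(\<lambda>(x, y). Complex x y) \<in> borel_measurable (lborel \<Otimes>\<^sub>M lborel)"
    unfolding Complex_eq by measurable
  fix l u :: complex
  assume le: "\<And>b. b \<in> Basis \<Longrightarrow> l \<bullet> b \<le> u \<bullet> b"
  from le[of 1] le[of \<i>] have "Re l \<le> Re u" "Im l \<le> Im u"
    by (auto simp: Basis_complex_def)
  moreover have "(\<lambda>(x, y). Complex x y) -` box l u = {Re l<..<Re u} \<times> {Im l<..<Im u}"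
    by (auto simp: box_def Basis_complex_def)
  ultimately show "emeasure (distr (lborel \<Otimes>\<^sub>M lborel) borel (\<lambda>(x, y). Complex x y)) (box l u)
      = (\<Prod>b\<in>Basis. (u - l) \<bullet> b)"
    by (simp add: emeasure_distr space_pair_measure lborel.emeasure_pair_measure_Times
        Basis_complex_def ennreal_mult)
qed simp

lemma nn_integral_complex:
  assumes [measurable]: "f \<in> borel_measurable borel"
  shows "(\<integral>\<^sup>+z. f z \<partial>lborel) = (\<integral>\<^sup>+y. \<integral>\<^sup>+x. f (Complex x y) \<partial>lborel \<partial>lborel)"
proof -
  have [measurable]: "(\<lambda>(x, y). Complex x y) \<in> borel_measurable (lborel \<Otimes>\<^sub>M lborel)"
    unfolding Complex_eq by measurable
  have "(\<integral>\<^sup>+z. f z \<partial>lborel) = (\<integral>\<^sup>+p. f (case p of (x, y) \<Rightarrow> Complex x y) \<partial>(lborel \<Otimes>\<^sub>M lborel))"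
    by (subst lborel_complex) (simp add: nn_integral_distr)
  also have "\<dots> = (\<integral>\<^sup>+y. \<integral>\<^sup>+x. f (Complex x y) \<partial>lborel \<partial>lborel)"
    by (subst lborel_pair.nn_integral_snd[symmetric]) auto
  finally show ?thesis .
qed

lemma measurable_Complex [measurable (raw)]:
  assumes "f \<in> borel_measurable M" "g \<in> borel_measurable M"
  shows "(\<lambda>x. Complex (f x) (g x)) \<in> borel_measurable M"
  unfolding Complex_eq using assms by measurable

text \<open>The real matrix of multiplication by \<open>c = a + b \<i>\<close> is a composition of
  two substitutions, each in one real variable: a x - b y for x, then (b/a) x + (D/a) y for y. Their
  Jacobians a and D/a multiply to D = |c|^2, and a must be nonzero.\<close>

lemma nn_integral_complex_mult_aux:
  assumes [measurable]: "f \<in> borel_measurable borel" and a: "Re c \<noteq> 0"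
  shows "(\<integral>\<^sup>+z. f z \<partial>lborel) = ennreal ((cmod c)\<^sup>2) * (\<integral>\<^sup>+z. f (c * z) \<partial>lborel)"
proof -
  define a b where "a = Re c" and "b = Im c"
  define D where "D = a\<^sup>2 + b\<^sup>2"
  have a0: "a \<noteq> 0" and D0: "D > 0"
    using a by (auto simp: a_def D_def add_pos_nonneg)
  have c: "c = Complex a b" and D: "(cmod c)\<^sup>2 = D"
    by (auto simp: a_def b_def D_def cmod_power2)
  have x: "(\<integral>\<^sup>+x. f (Complex (a*x - b*y) (b*x + a*y)) \<partial>lborel)
       = ennreal (1 / \<bar>a\<bar>) * (\<integral>\<^sup>+x. f (Complex x (b/a*x + D/a*y)) \<partial>lborel)" for y
    by (subst nn_integral_real_affine[where c="1/a" and t="b*y/a"])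
      (use a0 in \<open>auto simp: field_simps D_def power2_eq_square\<close>)
  have y: "(\<integral>\<^sup>+y. f (Complex x y) \<partial>lborel)
       = ennreal \<bar>D/a\<bar> * (\<integral>\<^sup>+y. f (Complex x (b/a*x + D/a*y)) \<partial>lborel)" for x
    by (rule nn_integral_real_affine) (use a0 D0 in auto)
  have "(\<integral>\<^sup>+z. f (c * z) \<partial>lborel)
      = (\<integral>\<^sup>+y. \<integral>\<^sup>+x. f (Complex (a*x - b*y) (b*x + a*y)) \<partial>lborel \<partial>lborel)"
    by (subst nn_integral_complex) (simp_all add: c complex_mult add.commute)
  also have "\<dots> = ennreal (1 / \<bar>a\<bar>) * (\<integral>\<^sup>+y. \<integral>\<^sup>+x. f (Complex x (b/a*x + D/a*y)) \<partial>lborel \<partial>lborel)"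
    unfolding x by (subst nn_integral_cmult) auto
  also have "(\<integral>\<^sup>+y. \<integral>\<^sup>+x. f (Complex x (b/a*x + D/a*y)) \<partial>lborel \<partial>lborel)
      = (\<integral>\<^sup>+x. \<integral>\<^sup>+y. f (Complex x (b/a*x + D/a*y)) \<partial>lborel \<partial>lborel)"
    by (rule lborel_pair.Fubini') measurable
  finally have eq: "(\<integral>\<^sup>+z. f (c * z) \<partial>lborel) = ennreal (1 / \<bar>a\<bar>)
      * (\<integral>\<^sup>+x. \<integral>\<^sup>+y. f (Complex x (b/a*x + D/a*y)) \<partial>lborel \<partial>lborel)" .
  have "(\<integral>\<^sup>+z. f z \<partial>lborel) = (\<integral>\<^sup>+x. \<integral>\<^sup>+y. f (Complex x y) \<partial>lborel \<partial>lborel)"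
    by (subst nn_integral_complex, simp) (rule lborel_pair.Fubini', measurable)
  also have "\<dots> = ennreal \<bar>D/a\<bar> * (\<integral>\<^sup>+x. \<integral>\<^sup>+y. f (Complex x (b/a*x + D/a*y)) \<partial>lborel \<partial>lborel)"
    by (subst y, subst nn_integral_cmult) auto
  also have "ennreal \<bar>D/a\<bar> = ennreal D * ennreal (1 / \<bar>a\<bar>)"
    using D0 by (simp add: ennreal_mult[symmetric])
  finally show ?thesis
    unfolding eq D by (simp add: mult.assoc)
qed

lemma nn_integral_complex_mult:
  assumes [measurable]: "f \<in> borel_measurable borel" and c: "c \<noteq> 0"
  shows "(\<integral>\<^sup>+z. f z \<partial>lborel) = ennreal ((cmod c)\<^sup>2) * (\<integral>\<^sup>+z. f (c * z) \<partial>lborel)"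
proof (cases "Re c = 0")
  case False
  then show ?thesis
    by (rule nn_integral_complex_mult_aux[rotated]) simp
next
  case True
  \<comment> \<open>A nonzero purely imaginary number has a square root with nonzero real part, so
    the first case applies twice, once for each factor \<open>d\<close>.\<close>
  define d where "d = csqrt c"
  have dd: "d * d = c"
    by (metis d_def power2_csqrt power2_eq_square)
  have "Re d \<noteq> 0"
  proof
    assume "Re d = 0"
    with dd have "Re c = - (Im d)\<^sup>2"
      by (auto simp: complex_eq_iff power2_eq_square)
    with True \<open>Re d = 0\<close> dd c show False
      by (auto simp: complex_eq_iff)
  qed
  note * = nn_integral_complex_mult_aux[OF _ this]
  have "(\<integral>\<^sup>+z. f z \<partial>lborel) = ennreal ((cmod d)\<^sup>2) * (ennreal ((cmod d)\<^sup>2) * (\<integral>\<^sup>+z. f (d * (d * z)) \<partial>lborel))"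
    by (subst *[of f], simp, subst *[of "\<lambda>z. f (d * z)"]) auto
  also have "ennreal ((cmod d)\<^sup>2) * (ennreal ((cmod d)\<^sup>2) * I) = ennreal ((cmod c)\<^sup>2) * I" for I
    by (simp add: dd[symmetric] norm_mult ennreal_mult[symmetric] mult.assoc[symmetric] power2_eq_square)
  finally show ?thesis
    by (simp add: dd mult.assoc[symmetric])
qed

lemma distr_lborel_rotation:
  assumes "cmod c = 1"
  shows "distr lborel borel ((*) c) = lborel"
proof (rule measure_eqI)
  fix A assume "A \<in> sets (distr lborel borel ((*) c))"
  then have [measurable]: "A \<in> sets borel" by simp
  have "emeasure (distr lborel borel ((*) c)) A = (\<integral>\<^sup>+z. indicator A (c * z) \<partial>lborel)"
    by (simp add: nn_integral_distr flip: nn_integral_indicator)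
  also have "\<dots> = (\<integral>\<^sup>+z. indicator A z \<partial>lborel)"
    using assms by (subst nn_integral_complex_mult[of "indicator A" c]) auto
  finally show "emeasure (distr lborel borel ((*) c)) A = emeasure lborel A" by simp
qed simp

text \<open>Both measures are determined by their values on the half lines \<open>{..x}\<close>,
  where the left side is the area of a disc. Radial integrals follow without polar
  coordinates.\<close>

lemma distr_lborel_cmod:
  "distr lborel borel cmod = density lborel (\<lambda>r. ennreal (2 * pi * r) * indicator {0..} r)"
proof (rule measure_eqI_generator_eq[where E="range atMost" and A="\<lambda>i. {..real i}" and \<Omega>=UNIV])
  show "Int_stable (range (atMost :: real \<Rightarrow> _))"
    by (auto simp: Int_stable_def)
  show "(\<Union>i. {..real i}) = UNIV"
    by (auto intro: real_arch_simple)
  have eq: "emeasure (distr lborel borel cmod) {..x} = ennreal (if x \<ge> 0 then pi * x\<^sup>2 else 0)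
    \<and> emeasure (density lborel (\<lambda>r. ennreal (2 * pi * r) * indicator {0..} r)) {..x} =
       ennreal (if x \<ge> 0 then pi * x\<^sup>2 else 0)" for x :: real
  proof (cases "x \<ge> 0")
    case True
    have "cmod -` {..x} = cball 0 x" by auto
    then have 1: "emeasure (distr lborel borel cmod) {..x} = ennreal (pi * x\<^sup>2)"
      using True by (simp add: emeasure_distr emeasure_cball unit_ball_vol_2)
    have "(\<integral>\<^sup>+r. ennreal (2 * pi * r) * indicator {0..x} r \<partial>lborel) = ennreal (pi * x\<^sup>2 - pi * 0\<^sup>2)"
      by (rule nn_integral_FTC_Icc)
        (use True in \<open>auto intro!: derivative_eq_intros continuous_intros\<close>)
    then have "emeasure (density lborel (\<lambda>r. ennreal (2 * pi * r) * indicator {0..} r)) {..x} = ennreal (pi * x\<^sup>2)"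
      by (subst emeasure_density) (auto simp: indicator_def intro!: arg_cong[of _ _ "nn_integral lborel"]
          elim!: trans[rotated] split: if_splits)
    with 1 True show ?thesis by simp
  next
    case False
    then have e: "cmod -` {..x} = {}"
      by (auto simp: not_le intro: order.strict_trans1[OF norm_ge_zero] dest: order_trans[OF norm_ge_zero])
    have "(\<integral>\<^sup>+r. ennreal (2 * pi * r) * indicator {0..} r * indicator {..x} r \<partial>lborel) = 0"
      using False by (subst nn_integral_cong[where v="\<lambda>_. 0"]) (auto simp: indicator_def)
    with False e show ?thesis
      by (auto simp: emeasure_distr emeasure_density)
  qed
  show "emeasure (distr lborel borel cmod) X =
      emeasure (density lborel (\<lambda>r. ennreal (2 * pi * r) * indicator {0..} r)) X" if "X \<in> range atMost" for X
    using that eq by auto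
  show "emeasure (distr lborel borel cmod) {..real i} \<noteq> \<infinity>" for i
    using eq by auto
  show "sets (distr lborel borel cmod) = sigma_sets UNIV (range atMost)"
    "sets (density lborel (\<lambda>r. ennreal (2 * pi * r) * indicator {0..} r)) = sigma_sets UNIV (range atMost)"
    by (simp_all add: borel_eq_atMost)
  show "range (\<lambda>i. {..real i}) \<subseteq> range atMost"
    by blast
qed simp

lemma nn_integral_radial:
  assumes [measurable]: "g \<in> borel_measurable borel"
  shows "(\<integral>\<^sup>+z. g (cmod z) \<partial>lborel) = (\<integral>\<^sup>+r. ennreal (2 * pi * r) * indicator {0..} r * g r \<partial>lborel)"
proof -
  have "(\<integral>\<^sup>+z. g (cmod z) \<partial>lborel) = (\<integral>\<^sup>+r. g r \<partial>distr lborel borel cmod)"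
    by (simp add: nn_integral_distr)
  also have "\<dots> = (\<integral>\<^sup>+r. ennreal (2 * pi * r) * indicator {0..} r * g r \<partial>lborel)"
    unfolding distr_lborel_cmod by (rule nn_integral_density) auto
  finally show ?thesis .
qed

lemma nn_integral_cmod_powr:
  assumes "c > -2" "R \<ge> 0"
  shows "(\<integral>\<^sup>+z. ennreal (cmod z powr c) * indicator (ball 0 R) z \<partial>lborel)
     = ennreal (2 * pi * R powr (c + 2) / (c + 2))"
proof -
  have "(\<integral>\<^sup>+z. ennreal (cmod z powr c) * indicator (ball 0 R) z \<partial>lborel)
      = (\<integral>\<^sup>+z. (\<lambda>r. ennreal (r powr c) * indicator {..<R} r) (cmod z) \<partial>lborel)"
    by (intro nn_integral_cong) (auto simp: indicator_def)
  also have "\<dots> = (\<integral>\<^sup>+r. ennreal (2 * pi * r) * indicator {0..} r * (ennreal (r powr c) * indicator {..<R} r) \<partial>lborel)"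
    by (rule nn_integral_radial) measurable
  also have "\<dots> = (\<integral>\<^sup>+r. ennreal (2 * pi * (r powr (c + 1))) * indicator {0..R} r \<partial>lborel)"
  proof (rule nn_integral_cong_AE)
    have "AE r in lborel. r \<noteq> R" by (rule AE_lborel_singleton)
    then show "AE r in lborel. ennreal (2 * pi * r) * indicator {0..} r * (ennreal (r powr c) * indicator {..<R} r)
       = ennreal (2 * pi * (r powr (c + 1))) * indicator {0..R} r"
      by eventually_elim (auto simp: indicator_def ennreal_mult[symmetric] powr_add mult_ac)
  qed
  also have "\<dots> = ennreal (2 * pi * (R powr (c + 1 + 1) / (c + 1 + 1)))"
  proof (rule nn_integral_has_integral_lebesgue')
    show "((\<lambda>r. 2 * pi * (r powr (c + 1))) has_integral 2 * pi * (R powr (c + 1 + 1) / (c + 1 + 1))) {0..R}"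
      using assms by (intro has_integral_mult_right has_integral_powr_from_0) auto
  qed simp
  finally show ?thesis by (simp add: add.assoc)
qed

text \<open>As R \<le> 1, the integrand dominates the one with exponent -2 + 1/n for every n, and
  those integrals, 2 \<pi> n R^(1/n), are at least 2 \<pi> R n.\<close>

lemma nn_integral_cmod_powr_infinite:
  assumes "c \<le> -2" "0 < R" "R \<le> 1"
  shows "(\<integral>\<^sup>+z. ennreal (cmod z powr c) * indicator (ball 0 R) z \<partial>lborel) = \<infinity>"
proof -
  let ?I = "\<integral>\<^sup>+z. ennreal (cmod z powr c) * indicator (ball 0 R) z \<partial>lborel"
  have "ennreal (2 * pi * R * real n) \<le> ?I" if "n > 0" for n :: nat
  proof -
    have "R powr 1 \<le> R powr (1 / real n)"
      using that assms by (intro powr_mono') auto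
    then have "2 * pi * R * real n \<le> 2 * pi * R powr (- 2 + 1 / real n + 2) / (- 2 + 1 / real n + 2)"
      using that assms by simp
    then have "ennreal (2 * pi * R * real n) \<le>
        (\<integral>\<^sup>+z. ennreal (cmod z powr (- 2 + 1 / real n)) * indicator (ball 0 R) z \<partial>lborel)"
      using that assms by (subst nn_integral_cmod_powr) (auto intro!: ennreal_leI)
    also have "\<dots> \<le> ?I"
      using assms that
      by (intro nn_integral_mono) (auto simp: indicator_def intro!: ennreal_leI powr_mono' order_trans[OF assms(1)])
    finally show ?thesis .
  qed
  moreover have "\<exists>n>0. x < 2 * pi * R * real n" for x
  proof -
    obtain n where "x / (2 * pi * R) < real n" using reals_Archimedean2 by blast
    then have "x < 2 * pi * R * real n" using assms by (simp add: field_simps)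
    moreover have "2 * pi * R * real n \<le> 2 * pi * R * real (Suc n)"
      using assms by (intro mult_left_mono) auto
    ultimately show ?thesis by (intro exI[of _ "Suc n"]) linarith
  qed
  ultimately have le: "ennreal x \<le> ?I" for x
    by (meson ennreal_leI less_imp_le order_trans)
  show ?thesis
  proof (cases ?I)
    case (real y)
    with le[of "y + 1"] show ?thesis by simp
  qed simp
qed

text \<open>Invariance under the rotation turns the integral I into d I, and d \<noteq> 1. The
  orthogonality relations on discs rest on this instead of an integration over the angle.\<close>

lemma integral_rotation_eq_0:
  fixes F :: "complex \<Rightarrow> complex"
  assumes [measurable]: "F \<in> borel_measurable borel"
    and c: "cmod c = 1" and F: "\<And>w. F (c * w) = d * F w" and "d \<noteq> 1"
  shows "(\<integral>w. F w \<partial>lborel) = 0"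
proof -
  have "(\<integral>w. F w \<partial>lborel) = (\<integral>w. F (c * w) \<partial>lborel)"
    by (subst distr_lborel_rotation[OF c, symmetric]) (simp add: integral_distr)
  also have "\<dots> = d * (\<integral>w. F w \<partial>lborel)"
    by (simp add: F)
  finally show ?thesis
    using \<open>d \<noteq> 1\<close> by (simp add: algebra_simps)
qed

subsection \<open>Holomorphic functions on discs\<close>

lemma borel_measurable_cnj [measurable]: "cnj \<in> borel_measurable borel"
  by (intro borel_measurable_continuous_onI continuous_on_cnj continuous_on_id)

lemma sets_borel_ball [measurable]: "ball (a :: 'a::metric_space) r \<in> sets borel"
  by (intro borel_open) simp

text \<open>The form of dominated convergence used for the kernel series: index and point separate
  in the majorant, one summable sequence times one integrable function.\<close>

lemma integral_sums_dominated:
  fixes f :: "nat \<Rightarrow> 'a \<Rightarrow> complex"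
  assumes f[measurable]: "\<And>k. f k \<in> borel_measurable M"
    and g: "integrable M g" and c: "summable c"
    and le: "\<And>k x. x \<in> space M \<Longrightarrow> norm (f k x) \<le> c k * g x"
  shows "(\<lambda>k. \<integral>x. f k x \<partial>M) sums (\<integral>x. (\<Sum>k. f k x) \<partial>M)"
    and "integrable M (\<lambda>x. \<Sum>k. f k x)"
proof -
  have int: "integrable M (f k)" for k
    by (rule Bochner_Integration.integrable_bound[OF integrable_mult_right[OF g, of "c k"]])
      (auto intro!: AE_I2 order_trans[OF le])
  have sum: "AE x in M. summable (\<lambda>k. norm (f k x))"
    using c le by (intro AE_I2 summable_comparison_test'[OF summable_mult2[OF c]]) auto
  have sum2: "summable (\<lambda>k. \<integral>x. norm (f k x) \<partial>M)"
  proof (rule summable_comparison_test'[OF summable_mult2[OF c, of "\<integral>x. g x \<partial>M"]])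
    fix k
    have "(\<integral>x. norm (f k x) \<partial>M) \<le> (\<integral>x. c k * g x \<partial>M)"
      by (intro integral_mono int integrable_norm integrable_mult_right g le)
    then show "norm (\<integral>x. norm (f k x) \<partial>M) \<le> c k * (\<integral>x. g x \<partial>M)"
      by simp
  qed
  from sums_integral[OF int sum sum2] show "(\<lambda>k. \<integral>x. f k x \<partial>M) sums (\<integral>x. (\<Sum>k. f k x) \<partial>M)" .
  from integrable_suminf[OF int sum sum2] show "integrable M (\<lambda>x. \<Sum>k. f k x)" .
qed

lemma mult_cnj_power: "w ^ a * cnj w ^ a = of_real (cmod w ^ (2 * a))"
  by (simp add: power_mult_distrib[symmetric] complex_norm_square[symmetric] power_mult)

text \<open>The angle is chosen so that rotating w by it changes the sign of w^j times the conjugate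
  of w^a: the net angle (j - a) \<pi> / (j - a) is \<pi>.\<close>

lemma cis_rotation:
  assumes "j \<noteq> a"
  shows "cis (pi / (real j - real a)) ^ j * cnj (cis (pi / (real j - real a))) ^ a = -1"
proof -
  let ?c = "cis (pi / (real j - real a))"
  have "?c ^ j * cnj ?c ^ a = cis (real j * (pi / (real j - real a)) + real a * - (pi / (real j - real a)))"
    by (simp only: Complex.DeMoivre cis_cnj cis_mult)
  also have "real j * (pi / (real j - real a)) + real a * - (pi / (real j - real a))
      = (real j - real a) * (pi / (real j - real a))"
    by (simp only: left_diff_distrib mult_minus_right flip: diff_conv_add_uminus)
  also have "\<dots> = pi"
    using assms by simp
  finally show ?thesis by simp
qed

lemma integral_radial_monomial_eq_0:
  fixes \<psi> :: "real \<Rightarrow> complex"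
  assumes [measurable]: "\<psi> \<in> borel_measurable borel" and ne: "j \<noteq> a"
  shows "(\<integral>w. \<psi> (cmod w) * (w ^ j * cnj w ^ a) \<partial>lborel) = 0"
proof (rule integral_rotation_eq_0[where c="cis (pi / (real j - real a))" and d="-1"])
  let ?c = "cis (pi / (real j - real a))"
  show "\<psi> (cmod (?c * w)) * ((?c * w) ^ j * cnj (?c * w) ^ a) = -1 * (\<psi> (cmod w) * (w ^ j * cnj w ^ a))" for w
    unfolding cis_rotation[OF ne, symmetric] by (simp add: norm_mult power_mult_distrib)
qed auto

text \<open>In the power series of g only the term of index a survives against a rotation invariant
  weight. Domination of the series is available on smaller discs, so the identity is proved for
  radii r < R, and r tends to R by dominated convergence.\<close>

lemma set_integral_disc_coeff:
  fixes g :: "complex \<Rightarrow> complex" and \<psi> :: "real \<Rightarrow> real"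
  assumes g: "g holomorphic_on ball 0 R"
    and \<psi>[measurable]: "\<psi> \<in> borel_measurable borel" and \<psi>0: "\<And>r. \<psi> r \<ge> 0"
    and int\<psi>: "set_integrable lborel (ball 0 R) (\<lambda>w. \<psi> (cmod w))"
    and int: "set_integrable lborel (ball 0 R) (\<lambda>w. g w * cnj w ^ a * \<psi> (cmod w))"
  shows "(LINT w:ball 0 R|lborel. g w * cnj w ^ a * \<psi> (cmod w))
      = (deriv ^^ a) g 0 / fact a * (LINT w:ball 0 R|lborel. cmod w ^ (2 * a) * \<psi> (cmod w))"
proof (cases "R > 0")
  case False
  then have "ball (0::complex) R = {}" by auto
  show ?thesis unfolding set_lebesgue_integral_def \<open>ball (0::complex) R = {}\<close> by simp
next
  case R: True
  define G where "G k = (deriv ^^ k) g 0 / fact k" for k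
  have G: "(\<lambda>k. G k * w ^ k) sums g w" if "w \<in> ball 0 R" for w
    using holomorphic_power_series[OF g that] by (simp add: G_def)
  have inner: "(LINT w:ball 0 r|lborel. g w * cnj w ^ a * \<psi> (cmod w))
      = G a * (LINT w:ball 0 r|lborel. cmod w ^ (2 * a) * \<psi> (cmod w))" if r: "0 < r" "r < R" for r
  proof -
    define f where "f k w = indicator (ball 0 r) w *\<^sub>R (G k * w ^ k * cnj w ^ a * \<psi> (cmod w))" for k w
    have int_r: "integrable lborel (\<lambda>w. indicator (ball 0 r) w * \<psi> (cmod w))"
      using set_integrable_subset[OF int\<psi>, of "ball 0 r"] r by (auto simp: set_integrable_def subset_ball)
    have "norm (of_real r :: complex) < norm (of_real ((r + R) / 2) :: complex)" "of_real ((r + R) / 2) \<in> ball (0::complex) R"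
      using r unfolding norm_of_real by (auto simp: norm_divide simp flip: of_real_add)
    then have sG: "summable (\<lambda>k. norm (G k * of_real r ^ k))"
      using powser_insidea[OF sums_summable[OF G]] by blast
    have sum: "(\<lambda>k. \<integral>w. f k w \<partial>lborel) sums (\<integral>w. (\<Sum>k. f k w) \<partial>lborel)"
    proof (rule integral_sums_dominated(1))
      show "f k \<in> borel_measurable lborel" for k
        unfolding f_def by measurable
      show "integrable lborel (\<lambda>w. r ^ a * (indicator (ball 0 r) w * \<psi> (cmod w)))"
        by (intro integrable_mult_right int_r)
      show "summable (\<lambda>k. norm (G k * of_real r ^ k))" by fact
      show "norm (f k w) \<le> norm (G k * of_real r ^ k) * (r ^ a * (indicator (ball 0 r) w * \<psi> (cmod w)))" for k w
      proof (cases "w \<in> ball 0 r")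
        case True
        then have "norm (f k w) = norm (G k) * cmod w ^ k * cmod w ^ a * \<psi> (cmod w)"
          by (simp add: f_def norm_mult norm_power \<psi>0)
        also have "\<dots> \<le> norm (G k) * r ^ k * r ^ a * \<psi> (cmod w)"
          using True r \<psi>0 by (intro mult_mono mult_nonneg_nonneg power_mono) auto
        finally show ?thesis using True r by (simp add: norm_mult norm_power)
      qed (simp add: f_def)
    qed
    have f_eq: "f a w = G a * of_real (indicator (ball 0 r) w *\<^sub>R (cmod w ^ (2 * a) * \<psi> (cmod w)))" for w
    proof -
      have "f a w = indicator (ball 0 r) w *\<^sub>R (G a * (w ^ a * cnj w ^ a) * \<psi> (cmod w))"
        by (simp add: f_def mult.assoc)
      also have "\<dots> = G a * of_real (indicator (ball 0 r) w *\<^sub>R (cmod w ^ (2 * a) * \<psi> (cmod w)))"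
        unfolding mult_cnj_power by (simp add: scaleR_conv_of_real mult_ac)
      finally show ?thesis .
    qed
    have "(\<Sum>k. f k w) = indicator (ball 0 r) w *\<^sub>R (g w * cnj w ^ a * \<psi> (cmod w))" for w
    proof (cases "w \<in> ball 0 r")
      case True
      with r have "(\<lambda>k. G k * w ^ k * (cnj w ^ a * \<psi> (cmod w))) sums (g w * (cnj w ^ a * \<psi> (cmod w)))"
        by (intro sums_mult2 G) auto
      with True show ?thesis by (simp add: f_def sums_iff mult.assoc)
    qed (simp add: f_def)
    then have "(LINT w:ball 0 r|lborel. g w * cnj w ^ a * \<psi> (cmod w)) = (\<integral>w. (\<Sum>k. f k w) \<partial>lborel)"
      by (simp add: set_lebesgue_integral_def)
    also have "\<dots> = (\<Sum>k. \<integral>w. f k w \<partial>lborel)"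
      using sum by (simp add: sums_iff)
    also have "\<dots> = (\<Sum>k\<in>{a}. \<integral>w. f k w \<partial>lborel)"
    proof (rule suminf_finite)
      fix k assume "k \<notin> {a}"
      then have "(\<integral>w. (of_real (indicator {..<r} (cmod w) * \<psi> (cmod w)) :: complex) * (w ^ k * cnj w ^ a) \<partial>lborel) = 0"
        by (intro integral_radial_monomial_eq_0) auto
      then have "G k * (\<integral>w. (of_real (indicator {..<r} (cmod w) * \<psi> (cmod w)) :: complex) * (w ^ k * cnj w ^ a) \<partial>lborel) = 0"
        by simp
      then have "(\<integral>w. G k * (of_real (indicator {..<r} (cmod w) * \<psi> (cmod w)) * (w ^ k * cnj w ^ a)) \<partial>lborel) = 0"
        by simp
      also have "(\<lambda>w. G k * (of_real (indicator {..<r} (cmod w) * \<psi> (cmod w)) * (w ^ k * cnj w ^ a))) = f k"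
        by (auto simp: f_def indicator_def fun_eq_iff)
      finally show "(\<integral>w. f k w \<partial>lborel) = 0" .
    qed simp
    also have "(\<Sum>k\<in>{a}. \<integral>w. f k w \<partial>lborel) = (\<integral>w. G a * of_real (indicator (ball 0 r) w *\<^sub>R (cmod w ^ (2 * a) * \<psi> (cmod w))) \<partial>lborel)"
      by (simp add: f_eq)
    also have "\<dots> = G a * (LINT w:ball 0 r|lborel. cmod w ^ (2 * a) * \<psi> (cmod w))"
      unfolding set_lebesgue_integral_def by (simp only: integral_mult_right_zero integral_complex_of_real)
    finally show ?thesis .
  qed
  define r where "r i = R * (1 - 1 / real (i + 2))" for i
  have r: "0 < r i" "r i < R" for i using R by (auto simp: r_def field_simps add_pos_nonneg)
  have r_lim: "r \<longlonglongrightarrow> R"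
  proof -
    have "(\<lambda>i. 1 / real (i + 2)) \<longlonglongrightarrow> 0"
      using LIMSEQ_ignore_initial_segment[OF lim_1_over_n, of 2] by simp
    from tendsto_mult[OF tendsto_const tendsto_diff[OF tendsto_const this], of R 1]
    show ?thesis by (simp add: r_def[abs_def])
  qed
  have lim: "(\<lambda>i. LINT w:ball 0 (r i)|lborel. F w) \<longlonglongrightarrow> (LINT w:ball 0 R|lborel. F w)"
    if F: "set_integrable lborel (ball 0 R) F" for F :: "complex \<Rightarrow> 'z::{banach, second_countable_topology}"
    unfolding set_lebesgue_integral_def
  proof (rule integral_dominated_convergence[where w="\<lambda>w. norm (indicator (ball 0 R) w *\<^sub>R F w)"])
    show "integrable lborel (\<lambda>w. norm (indicator (ball 0 R) w *\<^sub>R F w))"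
      using F unfolding set_integrable_def by (rule integrable_norm)
    show "(\<lambda>w. indicator (ball 0 R) w *\<^sub>R F w) \<in> borel_measurable lborel"
      using F by (auto simp: set_integrable_def)
    show "(\<lambda>w. indicator (ball 0 (r i)) w *\<^sub>R F w) \<in> borel_measurable lborel" for i
      using set_integrable_subset[OF F, of "ball 0 (r i)"] r(2)[of i] by (auto simp: set_integrable_def subset_ball)
    show "AE w in lborel. norm (indicator (ball 0 (r i)) w *\<^sub>R F w) \<le> norm (indicator (ball 0 R) w *\<^sub>R F w)" for i
      using r(2)[of i] by (auto simp: indicator_def)
    show "AE w in lborel. (\<lambda>i. indicator (ball 0 (r i)) w *\<^sub>R F w) \<longlonglongrightarrow> indicator (ball 0 R) w *\<^sub>R F w"
    proof (rule AE_I2, cases)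
      fix w :: complex assume w: "cmod w < R"
      then have "eventually (\<lambda>i. cmod w < r i) sequentially"
        using order_tendstoD(1)[OF r_lim] by blast
      then have "eventually (\<lambda>i. indicator (ball 0 (r i)) w *\<^sub>R F w = indicator (ball 0 R) w *\<^sub>R F w) sequentially"
        by (rule eventually_mono) (use w in auto)
      then show "(\<lambda>i. indicator (ball 0 (r i)) w *\<^sub>R F w) \<longlonglongrightarrow> indicator (ball 0 R) w *\<^sub>R F w"
        by (rule tendsto_eventually)
    next
      fix w :: complex assume w: "\<not> cmod w < R"
      then have "indicator (ball 0 (r i)) w = (0::real)" for i
        using r(2)[of i] by auto
      then show "(\<lambda>i. indicator (ball 0 (r i)) w *\<^sub>R F w) \<longlonglongrightarrow> indicator (ball 0 R) w *\<^sub>R F w"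
        using w by simp
    qed
  qed
  have int2: "set_integrable lborel (ball 0 R) (\<lambda>w. cmod w ^ (2 * a) * \<psi> (cmod w))"
    unfolding set_integrable_def
  proof (rule Bochner_Integration.integrable_bound)
    show "integrable lborel (\<lambda>w. R ^ (2 * a) * (indicator (ball 0 R) w *\<^sub>R \<psi> (cmod w)))"
      using int\<psi> by (intro integrable_mult_right) (simp add: set_integrable_def)
    show "AE w in lborel. norm (indicator (ball 0 R) w *\<^sub>R (cmod w ^ (2 * a) * \<psi> (cmod w)))
      \<le> norm (R ^ (2 * a) * (indicator (ball 0 R) w *\<^sub>R \<psi> (cmod w)))"
      using \<psi>0 by (auto simp: indicator_def abs_mult intro!: mult_right_mono power_mono)
  qed measurable
  have "(\<lambda>i. LINT w:ball 0 (r i)|lborel. g w * cnj w ^ a * \<psi> (cmod w))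
      \<longlonglongrightarrow> G a * (LINT w:ball 0 R|lborel. cmod w ^ (2 * a) * \<psi> (cmod w))"
    unfolding inner[OF r] by (intro tendsto_mult tendsto_const tendsto_of_real lim int2)
  with lim[OF int] show ?thesis
    unfolding G_def by (rule LIMSEQ_unique)
qed

text \<open>Along an arithmetic progression of exponents the reciprocal squared norms of monomials
  are affine in the index, so the series in the kernel have this shape.\<close>

lemma affine_geometric_sums:
  fixes t :: complex
  assumes "cmod t < 1"
  shows "(\<lambda>l. (c + d * of_nat l) * t ^ l) sums ((c + (d - c) * t) / (1 - t)\<^sup>2)"
proof -
  have t: "t \<noteq> 1" using assms by auto
  have "(\<lambda>l. d * (of_nat (Suc l) * t ^ l) + (c - d) * t ^ l) sums (d * (1 / (1 - t)\<^sup>2) + (c - d) * (1 / (1 - t)))"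
    using assms by (intro sums_add sums_mult geometric_deriv_sums geometric_sums)
  also have "d * (1 / (1 - t)\<^sup>2) + (c - d) * (1 / (1 - t)) = (c + (d - c) * t) / (1 - t)\<^sup>2"
  proof -
    have "d * (1 / (1 - t)\<^sup>2) + (c - d) * (1 / (1 - t)) = (d + (c - d) * (1 - t)) / (1 - t)\<^sup>2"
      using t by (simp add: add_divide_distrib power2_eq_square)
    then show ?thesis by (simp add: algebra_simps)
  qed
  finally show ?thesis
    by (simp add: algebra_simps)
qed

lemma set_integrable_ball_of_continuous:
  fixes F :: "complex \<Rightarrow> complex"
  assumes "continuous_on (cball w r) F"
  shows "set_integrable lborel (ball w r) F"
proof (rule set_integrable_subset)
  show "set_integrable lborel (cball w r) F"
    unfolding set_integrable_def by (intro borel_integrable_compact compact_cball assms)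
qed auto

text \<open>The case a = 0 with weight 1 of \<open>set_integral_disc_coeff\<close>, translated to
  the center w.\<close>

lemma disc_mean_value:
  assumes G: "G holomorphic_on S" and S: "cball w r \<subseteq> S" and r: "r > 0"
  shows "(LINT x:ball w r|lborel. G x) = of_real (pi * r\<^sup>2) * G w"
proof -
  have "(\<lambda>x. G (w + x)) holomorphic_on cball 0 r"
    by (rule holomorphic_on_compose_gen[of "\<lambda>x. w + x" _ G S, unfolded o_def])
      (use G S in \<open>auto intro!: holomorphic_intros simp: dist_norm subset_iff\<close>)
  note hol = holomorphic_on_subset[OF this ball_subset_cball] and cont = holomorphic_on_imp_continuous_on[OF this]
  have int: "set_integrable lborel (ball 0 r) (\<lambda>x. G (w + x))"
    by (rule set_integrable_ball_of_continuous[OF cont])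
  have vol: "measure lborel (ball (0::complex) r) = pi * r\<^sup>2"
    using r by (simp add: content_ball unit_ball_vol_2)
  have "(LINT x:ball w r|lborel. G x) = (\<integral>x. indicator (ball w r) x *\<^sub>R G x \<partial>distr lborel borel ((+) w))"
    by (simp add: set_lebesgue_integral_def lborel_distr_plus)
  also have "\<dots> = (\<integral>x. indicator (ball w r) (w + x) *\<^sub>R G (w + x) \<partial>lborel)"
  proof (rule integral_distr)
    have "continuous_on (ball w r) G"
      using holomorphic_on_imp_continuous_on[OF G] S ball_subset_cball by (meson continuous_on_subset)
    then show "(\<lambda>x. indicator (ball w r) x *\<^sub>R G x) \<in> borel_measurable borel"
      by (intro borel_measurable_continuous_on_indicator) auto
  qed simp
  also have "\<dots> = (LINT x:ball 0 r|lborel. G (w + x))"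
    by (auto simp: set_lebesgue_integral_def indicator_def dist_norm intro!: Bochner_Integration.integral_cong)
  also have "\<dots> = (LINT x:ball 0 r|lborel. G (w + x) * cnj x ^ 0 * of_real ((\<lambda>_. 1) (cmod x)))"
    by simp
  also have "\<dots> = (deriv ^^ 0) (\<lambda>x. G (w + x)) 0 / fact 0 * (LINT x:ball 0 r|lborel. cmod x ^ (2 * 0) * (\<lambda>_. 1) (cmod x))"
  proof (rule set_integral_disc_coeff[OF hol])
    have "integrable lborel (indicator (ball (0::complex) r) :: _ \<Rightarrow> real)"
      by (rule integrable_real_indicator) (use r in \<open>auto simp: emeasure_ball\<close>)
    then show "set_integrable lborel (ball (0::complex) r) (\<lambda>w. 1::real)"
      by (simp add: set_integrable_def)
  qed (use int in auto)
  also have "\<dots> = of_real (pi * r\<^sup>2) * G w"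
    using vol by (simp add: set_lebesgue_integral_def mult.commute)
  finally show ?thesis .
qed

lemma set_integrable_disc_powr:
  assumes "c > -2" "R \<ge> 0"
  shows "set_integrable lborel (ball (0::complex) R) (\<lambda>w. cmod w powr c)"
    and "(LINT w:ball (0::complex) R|lborel. cmod w powr c) = 2 * pi * R powr (c + 2) / (c + 2)"
proof -
  have *: "(\<integral>\<^sup>+w. ennreal (indicator (ball (0::complex) R) w *\<^sub>R cmod w powr c) \<partial>lborel)
      = ennreal (2 * pi * R powr (c + 2) / (c + 2))"
    unfolding nn_integral_cmod_powr[OF assms, symmetric]
    by (intro nn_integral_cong) (auto simp: indicator_def)
  then show "set_integrable lborel (ball (0::complex) R) (\<lambda>w. cmod w powr c)"
    unfolding set_integrable_def by (intro integrableI_nonneg) auto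
  show "(LINT w:ball (0::complex) R|lborel. cmod w powr c) = 2 * pi * R powr (c + 2) / (c + 2)"
    unfolding set_lebesgue_integral_def
    by (rule integral_eq_nn_integral[THEN trans]) (use * assms in \<open>auto\<close>)
qed

text \<open>For the weight |w|^(2\<beta>-2) the power w^l has squared norm \<pi> / (\<beta> + l).
  The rational function is the sum of (\<beta> + l) (z cnj w)^l, that is, \<pi> times the kernel of
  the weighted Bergman space on the disc. The exponent \<beta> may be fractional.\<close>

lemma weighted_disc_reproducing:
  fixes \<beta> :: real
  assumes G: "G holomorphic_on ball 0 1" and \<beta>: "\<beta> > 0" and z: "cmod z < 1"
    and int: "set_integrable lborel (ball 0 1) (\<lambda>w. G w * of_real (cmod w powr (2 * \<beta> - 2)))"
  shows "(LINT w:ball 0 1|lborel. G w * of_real (cmod w powr (2 * \<beta> - 2)) *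
       ((of_real \<beta> + (1 - of_real \<beta>) * (z * cnj w)) / (1 - z * cnj w)\<^sup>2)) = of_real pi * G z"
proof -
  define H where "H w = G w * of_real (cmod w powr (2 * \<beta> - 2))" for w
  define f where "f l w = indicator (ball 0 1) w *\<^sub>R (H w * ((of_real \<beta> + 1 * of_nat l) * (z * cnj w) ^ l))" for l w
  have H: "integrable lborel (\<lambda>w. indicator (ball 0 1) w *\<^sub>R H w)"
    using int by (simp add: H_def set_integrable_def)
  have [measurable]: "(\<lambda>w. indicator (ball 0 1) w *\<^sub>R H w) \<in> borel_measurable borel"
    using H by auto
  have f_alt: "f l w = (indicator (ball 0 1) w *\<^sub>R H w) * ((of_real \<beta> + of_nat l) * (z * cnj w) ^ l)" for l w
    by (simp add: f_def indicator_def)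
  have sum_z: "summable (\<lambda>l. (\<beta> + real l) * cmod z ^ l)"
  proof -
    have "(\<lambda>l. (of_real \<beta> + 1 * of_nat l) * (of_real (cmod z) :: complex) ^ l) sums
      ((of_real \<beta> + (1 - of_real \<beta>) * of_real (cmod z)) / (1 - of_real (cmod z))\<^sup>2)"
      by (rule affine_geometric_sums) (use z in auto)
    then have "summable (\<lambda>l. of_real ((\<beta> + real l) * cmod z ^ l) :: complex)"
      by (simp add: sums_iff)
    then show ?thesis by (subst (asm) summable_complex_of_real)
  qed
  have sums: "(\<lambda>l. \<integral>w. f l w \<partial>lborel) sums (\<integral>w. (\<Sum>l. f l w) \<partial>lborel)"
  proof (rule integral_sums_dominated(1))
    show "f k \<in> borel_measurable lborel" for k
      unfolding f_alt[abs_def] by measurable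
    show "integrable lborel (\<lambda>w. norm (indicator (ball 0 1) w *\<^sub>R H w))"
      using H by (rule integrable_norm)
    show "norm (f l w) \<le> (\<beta> + real l) * cmod z ^ l * norm (indicator (ball 0 1) w *\<^sub>R H w)" for l w
    proof (cases "w \<in> ball 0 1")
      case True
      have "norm (complex_of_real \<beta> + of_nat l) = \<beta> + real l"
        using \<beta> by (metis add_nonneg_nonneg less_imp_le norm_of_real abs_of_nonneg of_nat_0_le_iff of_real_add of_real_of_nat_eq)
      with True have "norm (f l w) = norm (H w) * ((\<beta> + real l) * (cmod z ^ l * cmod w ^ l))"
        by (simp add: f_def norm_mult norm_power power_mult_distrib)
      also have "\<dots> \<le> norm (H w) * ((\<beta> + real l) * (cmod z ^ l * 1))"
        using True \<beta> by (intro mult_left_mono power_le_one) auto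
      finally show ?thesis using True by (simp add: mult_ac)
    qed (simp add: f_def)
  qed (fact sum_z)
  have fl: "(\<integral>w. f l w \<partial>lborel) = of_real pi * ((deriv ^^ l) G 0 / fact l * z ^ l)" for l
  proof -
    have [simp]: "complex_of_real \<beta> + of_nat l \<noteq> 0"
      using \<beta> by (metis add_pos_nonneg less_irrefl of_nat_0_le_iff of_real_add of_real_eq_0_iff of_real_of_nat_eq)
    have "(\<integral>w. f l w \<partial>lborel) = (LINT w:ball 0 1|lborel.
       (of_real \<beta> + of_nat l) * z ^ l * (G w * cnj w ^ l * of_real (cmod w powr (2 * \<beta> - 2))))"
      unfolding set_lebesgue_integral_def f_def H_def
      by (intro Bochner_Integration.integral_cong) (auto simp: power_mult_distrib mult_ac)
    also have "\<dots> = (of_real \<beta> + of_nat l) * z ^ l * (LINT w:ball 0 1|lborel. G w * cnj w ^ l * of_real (cmod w powr (2 * \<beta> - 2)))"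
      by simp
    also have "(LINT w:ball 0 1|lborel. G w * cnj w ^ l * of_real (cmod w powr (2 * \<beta> - 2)))
      = (deriv ^^ l) G 0 / fact l * (LINT w:ball (0::complex) 1|lborel. cmod w ^ (2 * l) * cmod w powr (2 * \<beta> - 2))"
    proof (rule set_integral_disc_coeff[OF G, where \<psi>="\<lambda>r. r powr (2 * \<beta> - 2)"])
      show "set_integrable lborel (ball (0::complex) 1) (\<lambda>w. cmod w powr (2 * \<beta> - 2))"
        using \<beta> by (intro set_integrable_disc_powr) auto
      have "integrable lborel (\<lambda>w. (indicator (ball 0 1) w *\<^sub>R H w) * cnj w ^ l)"
      proof (rule Bochner_Integration.integrable_bound[OF H])
        show "AE w in lborel. norm (indicator (ball 0 1) w *\<^sub>R H w * cnj w ^ l) \<le> norm (indicator (ball 0 1) w *\<^sub>R H w)"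
          by (auto simp: indicator_def norm_mult norm_power intro!: mult_left_le power_le_one)
      qed measurable
      then show "set_integrable lborel (ball 0 1) (\<lambda>w. G w * cnj w ^ l * of_real (cmod w powr (2 * \<beta> - 2)))"
        by (simp add: set_integrable_def H_def mult_ac scaleR_conv_of_real)
    qed auto
    also have "(LINT w:ball (0::complex) 1|lborel. cmod w ^ (2 * l) * cmod w powr (2 * \<beta> - 2))
       = (LINT w:ball (0::complex) 1|lborel. cmod w powr (2 * \<beta> + 2 * real l - 2))"
    proof (rule set_lebesgue_integral_cong_AE)
      have "AE w in lborel. w \<noteq> (0::complex)" by (rule AE_lborel_singleton)
      then show "AE w\<in>ball (0::complex) 1 in lborel. cmod w ^ (2 * l) * cmod w powr (2 * \<beta> - 2) = cmod w powr (2 * \<beta> + 2 * real l - 2)"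
        by eventually_elim (auto simp: powr_add[symmetric] powr_realpow[symmetric] algebra_simps)
    qed auto
    also have "\<dots> = pi / (\<beta> + real l)"
    proof -
      have "2 * pi * 1 powr (2 * \<beta> + 2 * real l - 2 + 2) / (2 * \<beta> + 2 * real l - 2 + 2) = pi / (\<beta> + real l)"
        using \<beta> by (simp add: field_simps)
      then show ?thesis
        using \<beta> by (subst set_integrable_disc_powr) auto
    qed
    finally show ?thesis by simp
  qed
  have "(\<lambda>l. of_real pi * ((deriv ^^ l) G 0 / fact l * (z - 0) ^ l)) sums (of_real pi * G z)"
    using z by (intro sums_mult holomorphic_power_series[OF G]) auto
  then have "(\<integral>w. (\<Sum>l. f l w) \<partial>lborel) = of_real pi * G z"
    using sums fl by (simp add: sums_iff)
  moreover have "(\<Sum>l. f l w) = indicator (ball 0 1) w *\<^sub>R (H w * ((of_real \<beta> + (1 - of_real \<beta>) * (z * cnj w)) / (1 - z * cnj w)\<^sup>2))" for w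
  proof (cases "w \<in> ball 0 1")
    case True
    have "cmod z * cmod w < 1 * 1"
      using z True by (intro mult_strict_mono') auto
    then have "cmod (z * cnj w) < 1"
      by (simp add: norm_mult)
    from sums_mult[OF affine_geometric_sums[OF this], of "H w" "of_real \<beta>" 1] True
    show ?thesis by (simp add: f_def sums_iff)
  qed (simp add: f_def)
  ultimately show ?thesis
    by (simp add: set_lebesgue_integral_def H_def)
qed

text \<open>The area mean value over the disc of radius |w|/2 shows that w G(w) is bounded near 0
  and hence extends. The extension must vanish at 0, since otherwise |G|^2 would dominate a multiple
  of |w|^(-2) there, which is not integrable.\<close>

lemma removable_singularity_L2:
  assumes G: "G holomorphic_on ball 0 1 - {0}"
    and int: "(\<integral>\<^sup>+w. indicator (ball 0 1) w * ennreal ((cmod (G w))\<^sup>2) \<partial>lborel) < \<infinity>"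
  shows "\<exists>E. E holomorphic_on ball 0 1 \<and> (\<forall>w\<in>ball 0 1 - {0}. E w = G w)"
proof -
  define S where "S = enn2real (\<integral>\<^sup>+w. indicator (ball 0 1) w * ennreal ((cmod (G w))\<^sup>2) \<partial>lborel)"
  have S: "(\<integral>\<^sup>+w. indicator (ball 0 1) w * ennreal ((cmod (G w))\<^sup>2) \<partial>lborel) = ennreal S" "S \<ge> 0"
    using int by (auto simp: S_def)
  have bound: "cmod (w * G w) \<le> 1 + S / pi" if w: "w \<noteq> 0" "cmod w < 1/2" for w
  proof -
    define r where "r = cmod w / 2"
    have r: "r > 0" "r < 1/2" using w by (auto simp: r_def)
    have x0: "x \<noteq> 0 \<and> cmod x < 1" if "x \<in> cball w r" for x
    proof -
      have "cmod x \<ge> cmod w - r" "cmod x \<le> cmod w + r"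
        using that norm_triangle_ineq2[of w "w - x"] norm_triangle_ineq2[of x w]
        by (auto simp: dist_norm norm_minus_commute)
      then show ?thesis using w r by (auto simp: r_def)
    qed
    have sub: "cball w r \<subseteq> ball 0 1 - {0}"
      by (rule subsetI) (use x0 in simp)
    from r have "ennreal (norm (of_real (pi * r\<^sup>2) * G w)) = ennreal (norm (LINT x:ball w r|lborel. G x))"
      using disc_mean_value[OF G sub] by simp
    also have "\<dots> \<le> (\<integral>\<^sup>+x. ennreal (norm (indicator (ball w r) x *\<^sub>R G x)) \<partial>lborel)"
      unfolding set_lebesgue_integral_def
    proof (rule integral_norm_bound_ennreal)
      have "continuous_on (cball w r) G"
        using holomorphic_on_imp_continuous_on[OF G] sub by (meson continuous_on_subset)
      from set_integrable_ball_of_continuous[OF this]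
      show "integrable lborel (\<lambda>x. indicator (ball w r) x *\<^sub>R G x)"
        by (simp add: set_integrable_def)
    qed
    \<comment> \<open>The weights in |G| \<le> 1/(2r) + (r/2) |G|^2 make both integrals of order r:
      the disc has area \<pi> r^2, and the integral of |G|^2 is at most S.\<close>
    also have "\<dots> \<le> (\<integral>\<^sup>+x. ennreal (1 / (2 * r)) * indicator (ball w r) x + ennreal (r / 2) * (indicator (ball 0 1) x * ennreal ((cmod (G x))\<^sup>2)) \<partial>lborel)"
    proof (intro nn_integral_mono)
      fix x
      show "ennreal (norm (indicator (ball w r) x *\<^sub>R G x)) \<le>
        ennreal (1 / (2 * r)) * indicator (ball w r) x + ennreal (r / 2) * (indicator (ball 0 1) x * ennreal ((cmod (G x))\<^sup>2))"
      proof (cases "x \<in> ball w r")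
        case True
        then have "x \<in> ball 0 1" using sub ball_subset_cball by blast
        moreover have "cmod (G x) \<le> 1 / (2 * r) + r / 2 * (cmod (G x))\<^sup>2"
        proof -
          have "0 \<le> (1 - r * cmod (G x))\<^sup>2" by simp
          then show ?thesis using r by (simp add: field_simps power2_eq_square)
        qed
        ultimately show ?thesis using True r
          by (simp add: ennreal_mult[symmetric] flip: ennreal_plus)
      qed simp
    qed
    also have "\<dots> = ennreal (1 / (2 * r)) * ennreal (pi * r\<^sup>2) + ennreal (r / 2) * ennreal S"
    proof -
      have "(\<lambda>x. indicator (ball 0 1) x *\<^sub>R G x) \<in> borel_measurable borel"
      proof -
        have "(\<lambda>x. indicator (ball 0 1 - {0}) x *\<^sub>R G x) \<in> borel_measurable borel"
          by (intro borel_measurable_continuous_on_indicator holomorphic_on_imp_continuous_on[OF G]) auto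
        then have "(\<lambda>x. if x = 0 then G 0 else indicator (ball 0 1 - {0}) x *\<^sub>R G x) \<in> borel_measurable borel"
          by measurable
        also have "(\<lambda>x. if x = 0 then G 0 else indicator (ball 0 1 - {0}) x *\<^sub>R G x) = (\<lambda>x. indicator (ball 0 1) x *\<^sub>R G x)"
          by (auto simp: fun_eq_iff indicator_def)
        finally show ?thesis .
      qed
      then have "(\<lambda>x. ennreal ((cmod (indicator (ball 0 1) x *\<^sub>R G x))\<^sup>2)) \<in> borel_measurable borel"
        by measurable
      also have "(\<lambda>x. ennreal ((cmod (indicator (ball 0 1) x *\<^sub>R G x))\<^sup>2)) = (\<lambda>x. indicator (ball 0 1) x * ennreal ((cmod (G x))\<^sup>2))"
        by (auto simp: fun_eq_iff indicator_def)
      finally have [measurable]: "(\<lambda>x. indicator (ball 0 1) x * ennreal ((cmod (G x))\<^sup>2)) \<in> borel_measurable borel" .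
      show ?thesis
        using r S by (simp add: nn_integral_add nn_integral_cmult emeasure_ball unit_ball_vol_2)
    qed
    also have "\<dots> = ennreal (1 / (2 * r) * (pi * r\<^sup>2) + r / 2 * S)"
    proof -
      have "ennreal (1 / (2 * r)) * ennreal (pi * r\<^sup>2) = ennreal (1 / (2 * r) * (pi * r\<^sup>2))"
        "ennreal (r / 2) * ennreal S = ennreal (r / 2 * S)"
        by (rule ennreal_mult[symmetric]; use r S(2) in simp)+
      then show ?thesis
        using r S(2) by (simp only:) (rule ennreal_plus[symmetric], auto)
    qed
    finally have "norm (of_real (pi * r\<^sup>2) * G w) \<le> 1 / (2 * r) * (pi * r\<^sup>2) + r / 2 * S"
      by (subst (asm) ennreal_le_iff) (use r S(2) in auto)
    then have "pi * r\<^sup>2 * cmod (G w) \<le> 1 / (2 * r) * (pi * r\<^sup>2) + r / 2 * S"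
      by (simp add: norm_mult norm_power)
    then have "r * (pi * (2 * r * cmod (G w))) \<le> r * (pi + S)"
      using r by (simp add: field_simps power2_eq_square)
    then have "pi * (2 * r * cmod (G w)) \<le> pi + S"
      using r by simp
    then have "2 * r * cmod (G w) \<le> 1 + S / pi"
      by (simp add: field_simps)
    then show ?thesis by (simp add: r_def norm_mult)
  qed
  have "(\<lambda>w. w * G w) holomorphic_on ball 0 1 - {0}"
    by (intro holomorphic_intros G)
  moreover have "eventually (\<lambda>w. norm (w * G w) \<le> 1 + S / pi) (at 0)"
    unfolding eventually_at by (intro exI[of _ "1/2"]) (use bound in auto)
  ultimately obtain E where E: "E holomorphic_on ball 0 1" "\<And>w. w \<in> ball 0 1 - {0} \<Longrightarrow> E w = w * G w"
    using holomorphic_on_extend_bounded[of "\<lambda>w. w * G w" "ball 0 1" 0] by auto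
  have "isCont E 0"
    using E(1) by (metis at_within_open centre_in_ball continuous_on_eq_continuous_within
        holomorphic_on_imp_continuous_on open_ball zero_less_one)
  then have E_lim: "(E \<longlongrightarrow> E 0) (at 0)" by (simp add: isCont_def)
  have "E 0 = 0"
  proof (rule ccontr)
    assume "E 0 \<noteq> 0"
    define \<epsilon> where "\<epsilon> = cmod (E 0) / 2"
    have \<epsilon>: "\<epsilon> > 0" using \<open>E 0 \<noteq> 0\<close> by (simp add: \<epsilon>_def)
    have "((\<lambda>w. cmod (E w)) \<longlongrightarrow> cmod (E 0)) (at 0)"
      by (intro tendsto_norm E_lim)
    then have "eventually (\<lambda>w. \<epsilon> < cmod (E w)) (at 0)"
      by (rule order_tendstoD) (use \<epsilon> in \<open>auto simp: \<epsilon>_def\<close>)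
    then obtain d where d: "d > 0" "\<And>w. w \<noteq> 0 \<Longrightarrow> cmod w < d \<Longrightarrow> \<epsilon> < cmod (E w)"
      by (auto simp: eventually_at dist_norm)
    define \<rho> where "\<rho> = min d (1/2)"
    have \<rho>: "\<rho> > 0" "\<rho> \<le> d" "\<rho> \<le> 1/2" using d by (auto simp: \<rho>_def)
    have "\<infinity> = ennreal (\<epsilon>\<^sup>2) * (\<integral>\<^sup>+z. ennreal (cmod z powr (-2)) * indicator (ball 0 \<rho>) z \<partial>lborel)"
      using \<rho> \<epsilon> by (subst nn_integral_cmod_powr_infinite) (auto simp: ennreal_mult_top)
    also have "\<dots> = (\<integral>\<^sup>+z. ennreal (\<epsilon>\<^sup>2) * (ennreal (cmod z powr (-2)) * indicator (ball 0 \<rho>) z) \<partial>lborel)"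
      by (rule nn_integral_cmult[symmetric]) measurable
    also have "\<dots> \<le> (\<integral>\<^sup>+w. indicator (ball 0 1) w * ennreal ((cmod (G w))\<^sup>2) \<partial>lborel)"
    proof (rule nn_integral_mono)
      fix w :: complex
      show "ennreal (\<epsilon>\<^sup>2) * (ennreal (cmod w powr (-2)) * indicator (ball 0 \<rho>) w) \<le> indicator (ball 0 1) w * ennreal ((cmod (G w))\<^sup>2)"
      proof (cases "w \<in> ball 0 \<rho> \<and> w \<noteq> 0")
        case True
        then have "\<epsilon> \<le> cmod w * cmod (G w)"
          using d(2)[of w] E(2)[of w] \<rho> by (auto simp: norm_mult)
        then have "\<epsilon>\<^sup>2 \<le> (cmod w * cmod (G w))\<^sup>2"
          using \<epsilon> by (intro power_mono) auto
        then have "\<epsilon>\<^sup>2 * cmod w powr (-2) \<le> (cmod (G w))\<^sup>2"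
          using True by (simp add: powr_minus powr_numeral field_simps)
        then show ?thesis using True \<rho> by (simp add: ennreal_mult[symmetric])
      qed auto
    qed
    finally show False using int by simp
  qed
  with E_lim have "(E \<longlongrightarrow> 0) (at 0)" by simp
  moreover have "eventually (\<lambda>w. E w = (w - 0) * G w) (at 0)"
    using E(2) by (auto simp: eventually_at intro!: exI[of _ 1])
  ultimately have "((\<lambda>w. (w - 0) * G w) \<longlongrightarrow> 0) (at 0)"
    by (rule Lim_transform_eventually)
  then show ?thesis
    using holomorphic_on_extend_lim[OF G, of] by (auto simp: interior_open)
qed

subsection \<open>Forelli--Rudin estimates\<close>

lemma powr_le_of_bounds:
  assumes "1 \<le> q" "q \<le> (k::real)"
  shows "q powr e \<le> k powr \<bar>e\<bar>"
proof (cases "e \<ge> 0")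
  case True
  then show ?thesis using assms by (simp add: powr_mono2)
next
  case False
  then have "q powr e \<le> q powr 0" using assms by (intro powr_mono) auto
  then have "q powr e \<le> 1" using assms by simp
  also have "1 \<le> k powr \<bar>e\<bar>" using assms by (intro ge_one_powr_ge_zero) auto
  finally show ?thesis .
qed

lemma powr_le_of_half:
  assumes "1/2 \<le> x" "x \<le> (1::real)"
  shows "x powr e \<le> 2 powr \<bar>e\<bar>"
  using powr_le_of_bounds[of "1/x" 2 "-e"] assms by (simp add: powr_minus powr_divide field_simps)

text \<open>The lower bound is r^m \<le> r, the upper one Bernoulli's inequality. Together they make
  1 - r^m comparable with the distance 1 - r to the circle.\<close>

lemma one_minus_power_bounds:
  fixes r :: real
  assumes "0 \<le> r" "r \<le> 1" "m > 0"
  shows "1 - r \<le> 1 - r ^ m" and "1 - r ^ m \<le> real m * (1 - r)"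
proof -
  have "r ^ m \<le> r ^ 1" using assms by (intro power_decreasing) auto
  then show "1 - r \<le> 1 - r ^ m" by simp
  have "1 + real m * (r - 1) \<le> r ^ m"
    using Bernoulli_inequality[of "r - 1" m] assms by simp
  then show "1 - r ^ m \<le> real m * (1 - r)" by (simp add: algebra_simps)
qed

lemma ennreal_mult_add_mult:
  assumes "0 \<le> a" "0 \<le> x" "0 \<le> b" "0 \<le> y"
  shows "ennreal a * ennreal x + ennreal b * ennreal y = ennreal (a * x + b * y)"
  using assms by (simp add: ennreal_mult)

text \<open>With y = 1 - r and \<delta> = 1 - V, the last factor is controlled near the circle by
  max(y, \<delta>)^(1-b). The part y \<le> \<delta> is finite by e > -1; on y > \<delta> the lower
  end dominates by b > e + 2; both contribute a multiple of \<delta>^(e+2-b). Near the origin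
  integrability comes from c > -2.\<close>

lemma radial_weight_bound:
  fixes c e b :: real and m :: nat
  assumes c: "c > -2" and e: "e > -1" and b: "b \<ge> 2" "b > e + 2" and m: "m > 0"
  shows "\<exists>C\<ge>0. \<forall>V. 0 \<le> V \<longrightarrow> V < 1 \<longrightarrow>
    (\<integral>\<^sup>+w. ennreal (cmod w powr c * (1 - cmod w ^ m) powr e * (1 - cmod w ^ m * V) powr (1 - b))
        * indicator (ball 0 1) w \<partial>lborel) \<le> ennreal (C * (1 - V) powr (e + 2 - b))"
proof -
  define A1 where "A1 = 2 * pi * 2 powr \<bar>e\<bar> * 2 powr \<bar>1 - b\<bar>"
  define A2 where "A2 = 2 * pi * 2 powr \<bar>c\<bar> * real m powr \<bar>e\<bar>"
  have A: "A1 \<ge> 0" "A2 \<ge> 0" by (auto simp: A1_def A2_def)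
  define C where "C = A1 / (c + 2) + A2 * (1 / (e + 1) + 1 / (b - e - 2))"
  have "C \<ge> 0" using A c e b by (auto simp: C_def intro!: add_nonneg_nonneg mult_nonneg_nonneg)
  moreover have "(\<integral>\<^sup>+w. ennreal (cmod w powr c * (1 - cmod w ^ m) powr e * (1 - cmod w ^ m * V) powr (1 - b))
        * indicator (ball 0 1) w \<partial>lborel) \<le> ennreal (C * (1 - V) powr (e + 2 - b))"
    if V: "0 \<le> V" "V < 1" for V
  proof -
    define \<delta> where "\<delta> = 1 - V"
    define D where "D = \<delta> powr (e + 2 - b)"
    define F where "F r = r powr c * (1 - r ^ m) powr e * (1 - r ^ m * V) powr (1 - b)" for r
    have [measurable]: "F \<in> borel_measurable borel" unfolding F_def[abs_def] by measurable
    have F0: "F r \<ge> 0" for r by (auto simp: F_def)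
    have \<delta>: "0 < \<delta>" "\<delta> \<le> 1" using V by (auto simp: \<delta>_def)
    \<comment> \<open>The contribution of r \<le> 1/2 is bounded independently of V; D \<ge> 1
      absorbs it.\<close>
    have D: "D \<ge> 1" using \<delta> b unfolding D_def
      by (metis add.commute diff_le_0_iff_le less_imp_le powr_mono' powr_zero_eq_one less_irrefl)
    define h where "h y = (if y \<le> \<delta> then \<delta> powr (1 - b) * y powr e else y powr (e + 1 - b)) * indicator {0..1} y" for y
    have [measurable]: "h \<in> borel_measurable borel" unfolding h_def[abs_def] by measurable
    have h0: "h y \<ge> 0" for y by (auto simp: h_def)
    have pw: "2 * pi * r * F r \<le> A1 * D * r powr (c + 1) + A2 * h (1 - r)" if r: "0 \<le> r" "r < 1" for r
    proof (cases "r \<le> 1/2")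
      case True
      have "r ^ m \<le> r ^ 1" using r m by (intro power_decreasing) auto
      then have rm: "r ^ m \<le> 1/2" "0 \<le> r ^ m" using True r by auto
      then have "r ^ m * V \<le> 1/2 * 1" using V by (intro mult_mono) auto
      then have 1: "(1 - r ^ m * V) powr (1 - b) \<le> 2 powr \<bar>1 - b\<bar>"
        using rm V by (intro powr_le_of_half) auto
      have 2: "(1 - r ^ m) powr e \<le> 2 powr \<bar>e\<bar>"
        using rm by (intro powr_le_of_half) auto
      have "2 * pi * r * F r = 2 * pi * (r powr (c + 1) * ((1 - r ^ m) powr e * (1 - r ^ m * V) powr (1 - b)))"
        using r by (cases "r = 0") (auto simp: F_def powr_add mult_ac)
      also have "\<dots> \<le> 2 * pi * (r powr (c + 1) * (2 powr \<bar>e\<bar> * 2 powr \<bar>1 - b\<bar>))"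
        using 1 2 by (intro mult_left_mono mult_mono) auto
      also have "\<dots> = A1 * 1 * r powr (c + 1)" by (simp add: A1_def)
      also have "\<dots> \<le> A1 * D * r powr (c + 1)"
        using A D by (intro mult_right_mono mult_left_mono) auto
      finally show ?thesis using A h0[of "1 - r"] by (simp add: add_increasing2)
    next
      case False
      define y where "y = 1 - r"
      have y: "0 < y" "y < 1/2" using r False by (auto simp: y_def)
      have "r * r powr c \<le> 1 * 2 powr \<bar>c\<bar>"
        using r False by (intro mult_mono powr_le_of_half) auto
      then have 1: "r * r powr c \<le> 2 powr \<bar>c\<bar>" by simp
      have "((1 - r ^ m) / y) powr e \<le> real m powr \<bar>e\<bar>"
        using one_minus_power_bounds[of r m] r m y
        by (intro powr_le_of_bounds) (auto simp: field_simps y_def)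
      then have 2: "(1 - r ^ m) powr e \<le> real m powr \<bar>e\<bar> * y powr e"
        using y one_minus_power_bounds(1)[of r m] r m by (simp add: powr_divide field_simps y_def)
      have "r ^ m \<le> r ^ 1" using r m by (intro power_decreasing) auto
      then have "r ^ m * V \<le> r * V" using V by (intro mult_right_mono) auto
      moreover have "r * V \<le> r * 1" "r * V \<le> 1 * V" using r V by (intro mult_mono; simp)+
      ultimately have 3: "1 - r ^ m * V \<ge> y" "1 - r ^ m * V \<ge> \<delta>" by (auto simp: y_def \<delta>_def)
      have 4: "y powr e * (1 - r ^ m * V) powr (1 - b) \<le> h y"
      proof (cases "y \<le> \<delta>")
        case True
        have "(1 - r ^ m * V) powr (1 - b) \<le> \<delta> powr (1 - b)"
          using 3 \<delta> b by (intro powr_mono2') auto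
        then have "y powr e * (1 - r ^ m * V) powr (1 - b) \<le> y powr e * \<delta> powr (1 - b)"
          by (intro mult_left_mono) auto
        with True y show ?thesis by (simp add: h_def mult_ac)
      next
        case False
        have "(1 - r ^ m * V) powr (1 - b) \<le> y powr (1 - b)"
          using 3 y b by (intro powr_mono2') auto
        then have "y powr e * (1 - r ^ m * V) powr (1 - b) \<le> y powr e * y powr (1 - b)"
          by (intro mult_left_mono) auto
        with False y show ?thesis by (simp add: h_def powr_add[symmetric] algebra_simps)
      qed
      have "2 * pi * r * F r = 2 * pi * ((r * r powr c) * ((1 - r ^ m) powr e * (1 - r ^ m * V) powr (1 - b)))"
        by (simp add: F_def)
      also have "\<dots> \<le> 2 * pi * (2 powr \<bar>c\<bar> * ((real m powr \<bar>e\<bar> * y powr e) * (1 - r ^ m * V) powr (1 - b)))"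
        using 1 2 r by (intro mult_left_mono mult_mono) auto
      also have "\<dots> = A2 * (y powr e * (1 - r ^ m * V) powr (1 - b))"
        by (simp add: A2_def)
      also have "\<dots> \<le> A2 * h y"
        using 4 A by (intro mult_left_mono) auto
      finally show ?thesis using A D by (simp add: y_def add_increasing)
    qed
    have i1: "(\<integral>\<^sup>+r. ennreal (r powr (c + 1)) * indicator {0..1} r \<partial>lborel) = ennreal (1 / (c + 2))"
      using nn_integral_has_integral_lebesgue'[OF _ has_integral_powr_from_0[of "c + 1" 1]] c
      by (simp add: add.assoc)
    have i2: "(\<integral>\<^sup>+y. ennreal (y powr e) * indicator {0..\<delta>} y \<partial>lborel) = ennreal (\<delta> powr (e + 1) / (e + 1))"
      using nn_integral_has_integral_lebesgue'[OF _ has_integral_powr_from_0[of e \<delta>]] e \<delta> by simp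
    have i3: "(\<integral>\<^sup>+y. ennreal (y powr (e + 1 - b)) * indicator {\<delta>..1} y \<partial>lborel)
        = ennreal (1 powr (e + 2 - b) / (e + 2 - b) - \<delta> powr (e + 2 - b) / (e + 2 - b))"
    proof (rule nn_integral_FTC_Icc[where F="\<lambda>y. y powr (e + 2 - b) / (e + 2 - b)"])
      fix y assume y: "y \<in> {\<delta>..1}"
      then have "((\<lambda>y. y powr (e + 2 - b) / (e + 2 - b)) has_real_derivative
          (e + 2 - b) * y powr (e + 2 - b - 1) / (e + 2 - b)) (at y)"
        using \<delta> by (intro DERIV_cdivide has_real_derivative_powr) auto
      then show "((\<lambda>y. y powr (e + 2 - b) / (e + 2 - b)) has_real_derivative y powr (e + 1 - b)) (at y)"
        using b by (simp add: add.commute diff_diff_eq add_diff_eq)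
    qed (use \<delta> in auto)
    have i3': "(\<integral>\<^sup>+y. ennreal (y powr (e + 1 - b)) * indicator {\<delta>..1} y \<partial>lborel) \<le> ennreal (D / (b - e - 2))"
      unfolding i3 using b by (intro ennreal_leI) (simp add: D_def field_simps)
    have ih: "(\<integral>\<^sup>+y. ennreal (h y) \<partial>lborel) \<le> ennreal (D * (1 / (e + 1) + 1 / (b - e - 2)))"
    proof -
      have "(\<integral>\<^sup>+y. ennreal (h y) \<partial>lborel) \<le>
         (\<integral>\<^sup>+y. ennreal (\<delta> powr (1 - b)) * (ennreal (y powr e) * indicator {0..\<delta>} y)
            + ennreal (y powr (e + 1 - b)) * indicator {\<delta>..1} y \<partial>lborel)"
        by (intro nn_integral_mono) (auto simp: h_def indicator_def ennreal_mult[symmetric])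
      also have "\<dots> = ennreal (\<delta> powr (1 - b)) * ennreal (\<delta> powr (e + 1) / (e + 1))
         + (\<integral>\<^sup>+y. ennreal (y powr (e + 1 - b)) * indicator {\<delta>..1} y \<partial>lborel)"
        by (simp add: nn_integral_add nn_integral_cmult i2)
      also have "ennreal (\<delta> powr (1 - b)) * ennreal (\<delta> powr (e + 1) / (e + 1)) = ennreal (D / (e + 1))"
      proof -
        have "\<delta> powr (1 - b) * \<delta> powr (e + 1) = D"
          by (simp add: D_def powr_add[symmetric] algebra_simps)
        then show ?thesis
          using e by (simp add: ennreal_mult[symmetric] times_divide_eq_right)
      qed
      also have "ennreal (D / (e + 1)) + (\<integral>\<^sup>+y. ennreal (y powr (e + 1 - b)) * indicator {\<delta>..1} y \<partial>lborel)
         \<le> ennreal (D / (e + 1)) + ennreal (D / (b - e - 2))"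
        using i3' by (intro add_left_mono)
      also have "\<dots> = ennreal (D * (1 / (e + 1) + 1 / (b - e - 2)))"
        using D e b by (subst ennreal_plus[symmetric]) (auto simp: distrib_left)
      finally show ?thesis .
    qed
    have "(\<integral>\<^sup>+w. ennreal (F (cmod w)) * indicator (ball 0 1) w \<partial>lborel)
        = (\<integral>\<^sup>+w. (\<lambda>r. ennreal (F r) * indicator {..<1} r) (cmod w) \<partial>lborel)"
      by (intro nn_integral_cong) (auto simp: indicator_def)
    also have "\<dots> = (\<integral>\<^sup>+r. ennreal (2 * pi * r) * indicator {0..} r * (ennreal (F r) * indicator {..<1} r) \<partial>lborel)"
      by (rule nn_integral_radial) measurable
    also have "\<dots> \<le> (\<integral>\<^sup>+r. ennreal (A1 * D) * (ennreal (r powr (c + 1)) * indicator {0..1} r) + ennreal A2 * ennreal (h (1 - r)) \<partial>lborel)"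
    proof (intro nn_integral_mono)
      fix r :: real
      show "ennreal (2 * pi * r) * indicator {0..} r * (ennreal (F r) * indicator {..<1} r)
        \<le> ennreal (A1 * D) * (ennreal (r powr (c + 1)) * indicator {0..1} r) + ennreal A2 * ennreal (h (1 - r))"
      proof (cases "0 \<le> r \<and> r < 1")
        case True
        then have "ennreal (2 * pi * r * F r) \<le> ennreal (A1 * D * r powr (c + 1) + A2 * h (1 - r))"
          using pw[of r] by (intro ennreal_leI) auto
        also have "\<dots> = ennreal (A1 * D * r powr (c + 1)) + ennreal (A2 * h (1 - r))"
          using A D h0 by (intro ennreal_plus) auto
        finally show ?thesis
          using True A D F0[of r] h0[of "1 - r"] by (simp add: ennreal_mult)
      qed (auto simp: indicator_def)
    qed
    also have "\<dots> = ennreal (A1 * D) * ennreal (1 / (c + 2)) + ennreal A2 * (\<integral>\<^sup>+r. ennreal (h (1 - r)) \<partial>lborel)"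
      by (simp add: nn_integral_add nn_integral_cmult i1)
    also have "(\<integral>\<^sup>+r. ennreal (h (1 - r)) \<partial>lborel) = (\<integral>\<^sup>+y. ennreal (h y) \<partial>lborel)"
      by (subst nn_integral_real_affine[where c="-1" and t=1 and f="\<lambda>y. ennreal (h y)"]) auto
    also have "ennreal (A1 * D) * ennreal (1 / (c + 2)) + ennreal A2 * (\<integral>\<^sup>+y. ennreal (h y) \<partial>lborel)
       \<le> ennreal (A1 * D) * ennreal (1 / (c + 2)) + ennreal A2 * ennreal (D * (1 / (e + 1) + 1 / (b - e - 2)))"
      using ih by (intro add_left_mono mult_left_mono) auto
    also have "\<dots> = ennreal (C * D)"
    proof -
      have "0 \<le> D * (1 / (e + 1) + 1 / (b - e - 2))" "0 \<le> A1 * D"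
        using D e b A by (auto intro!: mult_nonneg_nonneg add_nonneg_nonneg)
      then have "ennreal (A1 * D) * ennreal (1 / (c + 2)) + ennreal A2 * ennreal (D * (1 / (e + 1) + 1 / (b - e - 2)))
        = ennreal (A1 * D * (1 / (c + 2)) + A2 * (D * (1 / (e + 1) + 1 / (b - e - 2))))"
        using A c by (intro ennreal_mult_add_mult) auto
      also have "A1 * D * (1 / (c + 2)) + A2 * (D * (1 / (e + 1) + 1 / (b - e - 2))) = C * D"
        by (simp add: C_def algebra_simps)
      finally show ?thesis .
    qed
    finally show ?thesis by (simp add: F_def D_def \<delta>_def)
  qed
  ultimately show ?thesis by blast
qed

text \<open>The right side is the Poisson kernel, here the real part of a holomorphic function with
  value 1 at 0.\<close>

lemma Re_cayley: "Re ((1 + \<xi>) / (1 - \<xi>)) = (1 - (cmod \<xi>)\<^sup>2) / (cmod (1 - \<xi>))\<^sup>2"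
proof -
  have "(1 + \<xi>) / (1 - \<xi>) = (1 + \<xi>) * cnj (1 - \<xi>) / of_real ((cmod (1 - \<xi>))\<^sup>2)"
    by (subst complex_div_cnj) (simp add: of_real_power)
  then have "Re ((1 + \<xi>) / (1 - \<xi>)) = Re ((1 + \<xi>) * cnj (1 - \<xi>)) / (cmod (1 - \<xi>))\<^sup>2"
    by (simp only: Re_divide_of_real)
  also have "Re ((1 + \<xi>) * cnj (1 - \<xi>)) = 1 - (cmod \<xi>)\<^sup>2"
    unfolding cmod_power2 by (simp add: power2_eq_square algebra_simps)
  finally show ?thesis .
qed

text \<open>Dominates by a Poisson kernel, whose circular means are given by the mean value
  property; no integration over the angle is needed.\<close>

lemma powr_le_poisson:
  assumes "cmod \<xi> < 1" "b \<ge> 2"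
  shows "cmod (1 - \<xi>) powr (-b) \<le> (1 - cmod \<xi>) powr (1 - b) * Re ((1 + \<xi>) / (1 - \<xi>))"
proof -
  define k d where "k = 1 - cmod \<xi>" and "d = cmod (1 - \<xi>)"
  have k: "0 < k" "k \<le> d"
    using assms norm_triangle_ineq2[of 1 \<xi>] by (auto simp: k_def d_def)
  have "d powr (-b) = d powr (2 - b) * (1 / d\<^sup>2)"
    using k by (simp add: powr_diff powr_minus powr_numeral field_simps)
  also have "\<dots> \<le> k powr (2 - b) * (1 / d\<^sup>2)"
    using k assms by (intro mult_right_mono powr_mono2') auto
  also have "k powr (2 - b) = k powr (1 - b) * k"
    using k powr_add[of k "1 - b" 1] by simp
  also have "k powr (1 - b) * k * (1 / d\<^sup>2) \<le> k powr (1 - b) * (1 - (cmod \<xi>)\<^sup>2) * (1 / d\<^sup>2)"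
  proof (intro mult_right_mono mult_left_mono)
    have "(cmod \<xi>)\<^sup>2 \<le> cmod \<xi> ^ 1" using assms by (intro power_decreasing) auto
    then show "k \<le> 1 - (cmod \<xi>)\<^sup>2" by (simp add: k_def)
  qed auto
  finally show ?thesis
    by (simp add: Re_cayley k_def d_def)
qed

text \<open>Bounding by the Poisson kernel leaves Re g times a radial weight, with g holomorphic and
  g(0) = 1. By \<open>set_integral_disc_coeff\<close> with a = 0 the factor g integrates away, and
  \<open>radial_weight_bound\<close> with V = |v| remains.\<close>

lemma forelli_rudin_disc:
  fixes c e b :: real and m :: nat
  assumes c: "c > -2" and e: "e > -1" and b: "b \<ge> 2" "b > e + 2" and m: "m > 0"
  shows "\<exists>C\<ge>0. \<forall>v::complex. cmod v < 1 \<longrightarrow>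
    (\<integral>\<^sup>+w. ennreal (cmod w powr c * (1 - cmod w ^ m) powr e * cmod (1 - w ^ m * v) powr (-b))
        * indicator (ball 0 1) w \<partial>lborel) \<le> ennreal (C * (1 - cmod v) powr (e + 2 - b))"
proof -
  obtain C where C: "C \<ge> 0" "\<And>V. 0 \<le> V \<Longrightarrow> V < 1 \<Longrightarrow>
    (\<integral>\<^sup>+w. ennreal (cmod w powr c * (1 - cmod w ^ m) powr e * (1 - cmod w ^ m * V) powr (1 - b))
        * indicator (ball 0 1) w \<partial>lborel) \<le> ennreal (C * (1 - V) powr (e + 2 - b))"
    using radial_weight_bound[OF assms] by blast
  have "(\<integral>\<^sup>+w. ennreal (cmod w powr c * (1 - cmod w ^ m) powr e * cmod (1 - w ^ m * v) powr (-b))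
        * indicator (ball 0 1) w \<partial>lborel) \<le> ennreal (C * (1 - cmod v) powr (e + 2 - b))"
    if v: "cmod v < 1" for v
  proof -
    define \<psi> where "\<psi> r = r powr c * (1 - r ^ m) powr e * (1 - r ^ m * cmod v) powr (1 - b)" for r
    define g where "g w = (1 + w ^ m * v) / (1 - w ^ m * v)" for w
    have [measurable]: "\<psi> \<in> borel_measurable borel" "g \<in> borel_measurable borel"
      unfolding \<psi>_def[abs_def] g_def[abs_def] by measurable
    have \<psi>0: "\<psi> r \<ge> 0" for r by (auto simp: \<psi>_def)
    have small: "cmod (w ^ m * v) \<le> cmod v" if "cmod w < 1" for w
      using that by (simp add: norm_mult norm_power mult_left_le_one_le power_le_one)
    have fin: "(\<integral>\<^sup>+w. ennreal (indicator (ball 0 1) w *\<^sub>R \<psi> (cmod w)) \<partial>lborel) \<le> ennreal (C * (1 - cmod v) powr (e + 2 - b))"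
    proof (rule order_trans[OF _ C(2)])
      show "(\<integral>\<^sup>+w. ennreal (indicator (ball 0 1) w *\<^sub>R \<psi> (cmod w)) \<partial>lborel) \<le>
        (\<integral>\<^sup>+w. ennreal (cmod w powr c * (1 - cmod w ^ m) powr e * (1 - cmod w ^ m * cmod v) powr (1 - b))
        * indicator (ball 0 1) w \<partial>lborel)"
        by (intro nn_integral_mono) (auto simp: indicator_def \<psi>_def)
    qed (use v in auto)
    then have int\<psi>: "set_integrable lborel (ball (0::complex) 1) (\<lambda>w. \<psi> (cmod w))"
      unfolding set_integrable_def
      by (intro integrableI_nonneg) (auto simp: \<psi>0 intro: le_less_trans)
    \<comment> \<open>The majorant depends on v and serves integrability alone; the final constant
      comes from the radial weight.\<close>
    have intg: "integrable lborel (\<lambda>w. indicator (ball 0 1) w *\<^sub>R (g w * \<psi> (cmod w)))"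
    proof (rule Bochner_Integration.integrable_bound)
      show "integrable lborel (\<lambda>w. 2 / (1 - cmod v) * (indicator (ball (0::complex) 1) w *\<^sub>R \<psi> (cmod w)))"
        using int\<psi> by (intro integrable_mult_right) (simp add: set_integrable_def)
      show "AE w in lborel. norm (indicator (ball 0 1) w *\<^sub>R (g w * \<psi> (cmod w)))
        \<le> norm (2 / (1 - cmod v) * (indicator (ball (0::complex) 1) w *\<^sub>R \<psi> (cmod w)))"
      proof (intro AE_I2)
        fix w :: complex
        have "cmod (g w) \<le> 2 / (1 - cmod v)" if "cmod w < 1"
        proof -
          have "cmod (1 + w ^ m * v) \<le> 2"
            using norm_triangle_ineq[of 1 "w ^ m * v"] small[OF that] v by simp
          moreover have "1 - cmod v \<le> cmod (1 - w ^ m * v)"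
            using norm_triangle_ineq2[of 1 "w ^ m * v"] small[OF that] by simp
          ultimately show ?thesis
            unfolding g_def norm_divide using v by (intro frac_le) auto
        qed
        then show "norm (indicator (ball 0 1) w *\<^sub>R (g w * \<psi> (cmod w)))
          \<le> norm (2 / (1 - cmod v) * (indicator (ball (0::complex) 1) w *\<^sub>R \<psi> (cmod w)))"
          using \<psi>0[of "cmod w"] v mult_right_mono[of "cmod (g w)" "2 / (1 - cmod v)" "\<psi> (cmod w)"]
          by (auto simp: indicator_def norm_mult abs_mult)
      qed
    qed measurable
    have g0: "g 0 = 1" using m by (simp add: g_def zero_power)
    have "(LINT w:ball 0 1|lborel. g w * cnj w ^ 0 * \<psi> (cmod w))
      = (deriv ^^ 0) g 0 / fact 0 * (LINT w:ball (0::complex) 1|lborel. cmod w ^ (2 * 0) * \<psi> (cmod w))"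
    proof (rule set_integral_disc_coeff)
      show "g holomorphic_on ball 0 1"
        unfolding g_def[abs_def]
      proof (intro holomorphic_intros)
        fix w :: complex assume "w \<in> ball 0 1"
        then have "cmod (w ^ m * v) < 1" using small[of w] v by auto
        then show "1 - w ^ m * v \<noteq> 0" by auto
      qed
    qed (use int\<psi> intg \<psi>0 in \<open>auto simp: set_integrable_def\<close>)
    then have eq: "(\<integral>w. indicator (ball 0 1) w *\<^sub>R (g w * \<psi> (cmod w)) \<partial>lborel)
      = of_real (\<integral>w. indicator (ball (0::complex) 1) w *\<^sub>R \<psi> (cmod w) \<partial>lborel)"
      using m g0 by (simp add: set_lebesgue_integral_def)
    have "(\<integral>w. Re (indicator (ball 0 1) w *\<^sub>R (g w * \<psi> (cmod w))) \<partial>lborel)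
      = (\<integral>w. indicator (ball (0::complex) 1) w *\<^sub>R \<psi> (cmod w) \<partial>lborel)"
      using arg_cong[OF eq, of Re] intg by (simp only: integral_Re Re_complex_of_real)
    then have eq': "(\<integral>\<^sup>+w. ennreal (Re (indicator (ball 0 1) w *\<^sub>R (g w * \<psi> (cmod w)))) \<partial>lborel)
        = (\<integral>\<^sup>+w. ennreal (indicator (ball (0::complex) 1) w *\<^sub>R \<psi> (cmod w)) \<partial>lborel)"
    proof (subst (1 2) nn_integral_eq_integral)
      show "AE w in lborel. 0 \<le> Re (indicator (ball 0 1) w *\<^sub>R (g w * \<psi> (cmod w)))"
      proof (intro AE_I2)
        fix w :: complex
        show "0 \<le> Re (indicator (ball 0 1) w *\<^sub>R (g w * \<psi> (cmod w)))"
        proof (cases "w \<in> ball 0 1")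
          case True
          then have "cmod (w ^ m * v) \<le> 1" using small[of w] v by auto
          then have "(cmod (w ^ m * v))\<^sup>2 \<le> 1" by (simp add: power_le_one)
          then have "0 \<le> Re (g w)" unfolding g_def Re_cayley by simp
          then show ?thesis using True \<psi>0 by simp
        qed simp
      qed
    qed (use int\<psi> integrable_Re[OF intg] \<psi>0 in \<open>auto simp: set_integrable_def\<close>)
    have "(\<integral>\<^sup>+w. ennreal (cmod w powr c * (1 - cmod w ^ m) powr e * cmod (1 - w ^ m * v) powr (-b))
        * indicator (ball 0 1) w \<partial>lborel)
      \<le> (\<integral>\<^sup>+w. ennreal (Re (indicator (ball 0 1) w *\<^sub>R (g w * \<psi> (cmod w)))) \<partial>lborel)"
    proof (intro nn_integral_mono)
      fix w :: complex
      show "ennreal (cmod w powr c * (1 - cmod w ^ m) powr e * cmod (1 - w ^ m * v) powr (-b)) * indicator (ball 0 1) w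
        \<le> ennreal (Re (indicator (ball 0 1) w *\<^sub>R (g w * \<psi> (cmod w))))"
      proof (cases "w \<in> ball 0 1")
        case True
        then have "cmod (w ^ m * v) < 1" using small[of w] v by auto
        from powr_le_poisson[OF this b(1)]
        have "cmod w powr c * (1 - cmod w ^ m) powr e * cmod (1 - w ^ m * v) powr (-b)
          \<le> cmod w powr c * (1 - cmod w ^ m) powr e * ((1 - cmod w ^ m * cmod v) powr (1 - b) * Re (g w))"
          by (intro mult_left_mono) (auto simp: g_def norm_mult norm_power)
        then show ?thesis
          using True by (auto simp: \<psi>_def mult_ac intro!: ennreal_leI)
      qed simp
    qed
    with eq' fin show ?thesis by simp
  qed
  with C(1) show ?thesis by blast
qed

subsection \<open>The Hartogs triangle\<close>

lemma borel_measurable_fst' [measurable]: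
  "(fst :: 'a::second_countable_topology \<times> 'b::second_countable_topology \<Rightarrow> 'a) \<in> borel_measurable borel"
  by (intro borel_measurable_continuous_onI continuous_on_fst continuous_on_id)

lemma borel_measurable_snd' [measurable]:
  "(snd :: 'a::second_countable_topology \<times> 'b::second_countable_topology \<Rightarrow> 'b) \<in> borel_measurable borel"
  by (intro borel_measurable_continuous_onI continuous_on_snd continuous_on_id)

lemma power_less_iff:
  fixes a b :: real
  assumes "0 \<le> a" "0 \<le> b" "k > 0"
  shows "a ^ k < b ^ k \<longleftrightarrow> a < b"
  using assms by (meson power_strict_mono power_less_imp_less_base)

locale hartogs =
  fixes m n :: nat
  assumes m_pos: "m > 0" and n_pos: "n > 0"
begin

abbreviation H :: "(complex \<times> complex) set" where
  "H \<equiv> hartogs_triangle (real m / real n)"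

text \<open>By \<open>mem_H_rad\<close>, the slice of \<open>H\<close> over a nonzero second
  coordinate w in the unit disc is the disc of this radius about 0.\<close>

definition rad :: "complex \<Rightarrow> real" where
  "rad w = cmod w powr (real n / real m)"

lemma rad_nonneg [simp]: "rad w \<ge> 0"
  by (simp add: rad_def)

lemma rad_pos [simp]: "w \<noteq> 0 \<Longrightarrow> rad w > 0"
  by (simp add: rad_def)

lemma rad_power: "w \<noteq> 0 \<Longrightarrow> rad w ^ m = cmod w ^ n"
  using m_pos by (simp add: rad_def powr_powr flip: powr_realpow)

lemma rad_powr: "rad w powr a = cmod w powr (real n * a / real m)"
  by (simp add: rad_def powr_powr)

lemma rad_measurable [measurable]: "rad \<in> borel_measurable borel"
  unfolding rad_def[abs_def] by measurable

lemma less_rad_iff: "w \<noteq> 0 \<Longrightarrow> cmod z < rad w \<longleftrightarrow> cmod z ^ m < cmod w ^ n"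
  using m_pos by (simp add: rad_power[symmetric] power_less_iff)

lemma mem_H: "(z1, z2) \<in> H \<longleftrightarrow> cmod z1 ^ m < cmod z2 ^ n \<and> cmod z2 < 1"
proof -
  have "cmod z1 powr (real m / real n) < cmod z2 \<longleftrightarrow> (cmod z1 powr (real m / real n)) ^ n < cmod z2 ^ n"
    using n_pos by (simp add: power_less_iff)
  also have "(cmod z1 powr (real m / real n)) ^ n = cmod z1 ^ m"
    using n_pos m_pos by (cases "z1 = 0") (simp_all add: powr_powr zero_power flip: powr_realpow)
  finally show ?thesis by (simp add: hartogs_triangle_def)
qed

lemma mem_H_rad: "(z1, z2) \<in> H \<longleftrightarrow> z2 \<in> ball 0 1 - {0} \<and> z1 \<in> ball 0 (rad z2)"
  using n_pos by (cases "z2 = 0") (auto simp: mem_H less_rad_iff zero_power)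

lemma snd_nonzero: "z \<in> H \<Longrightarrow> snd z \<noteq> 0"
  by (cases z) (simp add: mem_H_rad)

lemma snd_less_1: "z \<in> H \<Longrightarrow> cmod (snd z) < 1"
  by (cases z) (simp add: mem_H_rad)

lemma H_eq: "H = {z. cmod (fst z) ^ m < cmod (snd z) ^ n \<and> cmod (snd z) < 1}"
  by (auto simp: mem_H)

lemma open_H: "open H"
  unfolding H_eq by (intro open_Collect_conj open_Collect_less continuous_intros)

lemma H_borel [measurable]: "H \<in> sets borel"
  using open_H by simp

lemma H_subset: "H \<subseteq> ball 0 1 \<times> ball 0 1"
proof
  fix z assume "z \<in> H"
  then have z: "cmod (fst z) ^ m < cmod (snd z) ^ n" "cmod (snd z) < 1" by (auto simp: H_eq)
  then have "cmod (fst z) ^ m < 1 ^ m"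
    using power_le_one[of "cmod (snd z)" n] by simp
  then have "cmod (fst z) < 1" by (rule power_less_imp_less_base) simp
  with z show "z \<in> ball 0 1 \<times> ball 0 1" by (auto simp: mem_Times_iff)
qed

abbreviation MH :: "(complex \<times> complex) measure" where
  "MH \<equiv> lebesgue_on H"

lemma finite_measure_MH: "finite_measure MH"
proof (rule finite_measureI)
  have "bounded H"
    by (rule bounded_subset[OF _ H_subset]) (intro bounded_Times bounded_ball)
  then have "emeasure lborel H < \<infinity>" by (rule emeasure_bounded_finite)
  then show "emeasure MH (space MH) \<noteq> \<infinity>"
    by (simp add: emeasure_restrict_space)
qed

lemma space_MH [simp]: "space MH = H"
  by simp

lemma measurable_MH: "f \<in> borel_measurable borel \<Longrightarrow> f \<in> borel_measurable MH"
  by (intro measurable_restrict_space1 measurable_completion) simp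

lemma nn_integral_MH_lborel:
  "(\<integral>\<^sup>+w. g w \<partial>MH) = (\<integral>\<^sup>+w. g w * indicator H w \<partial>lborel)"
  by (subst nn_integral_restrict_space) (auto simp: nn_integral_completion)

text \<open>The Borel condition concerns the values on \<open>H\<close> only, because members of the
  Bergman space are arbitrary elsewhere. Iterated integrals are taken over \<open>lborel\<close>, so
  \<open>MH\<close>, which is built on the completion, is exchanged for it first.\<close>

lemma integrable_MH_iff:
  fixes F :: "complex \<times> complex \<Rightarrow> complex"
  assumes "(\<lambda>w. indicator H w *\<^sub>R F w) \<in> borel_measurable borel"
  shows "integrable MH F \<longleftrightarrow> integrable lborel (\<lambda>w. indicator H w *\<^sub>R F w)"
  using assms by (subst integrable_restrict_space) (auto simp: integrable_completion)

lemma integral_MH_lborel: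
  fixes F :: "complex \<times> complex \<Rightarrow> complex"
  assumes "(\<lambda>w. indicator H w *\<^sub>R F w) \<in> borel_measurable borel"
  shows "(\<integral>w. F w \<partial>MH) = (\<integral>w. indicator H w *\<^sub>R F w \<partial>lborel)"
  using assms by (subst integral_restrict_space) (auto simp: integral_completion)

lemma indicator_H: "indicator H (w1, w2) = indicator (ball 0 1 - {0}) w2 * (indicator (ball 0 (rad w2)) w1 :: 'a::{semiring_1})"
  by (auto simp: indicator_def mem_H_rad)

lemma nn_integral_MH:
  assumes [measurable]: "g \<in> borel_measurable borel"
  shows "(\<integral>\<^sup>+w. g w \<partial>MH) = (\<integral>\<^sup>+w2. (\<integral>\<^sup>+w1. g (w1, w2) * indicator (ball 0 (rad w2)) w1 \<partial>lborel)
     * indicator (ball 0 1 - {0}) w2 \<partial>lborel)"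
proof -
  have "(\<integral>\<^sup>+w. g w \<partial>MH) = (\<integral>\<^sup>+w. g w * indicator H w \<partial>(lborel \<Otimes>\<^sub>M lborel))"
    by (simp add: nn_integral_MH_lborel lborel_prod)
  also have "\<dots> = (\<integral>\<^sup>+w2. \<integral>\<^sup>+w1. g (w1, w2) * indicator H (w1, w2) \<partial>lborel \<partial>lborel)"
    by (rule lborel_pair.nn_integral_snd[symmetric]) (simp add: lborel_prod)
  also have "\<dots> = (\<integral>\<^sup>+w2. (\<integral>\<^sup>+w1. g (w1, w2) * indicator (ball 0 (rad w2)) w1 \<partial>lborel)
     * indicator (ball 0 1 - {0}) w2 \<partial>lborel)"
  proof (intro nn_integral_cong)
    fix w2 :: complex
    show "(\<integral>\<^sup>+w1. g (w1, w2) * indicator H (w1, w2) \<partial>lborel)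
        = (\<integral>\<^sup>+w1. g (w1, w2) * indicator (ball 0 (rad w2)) w1 \<partial>lborel) * indicator (ball 0 1 - {0}) w2"
      by (cases "w2 \<in> ball 0 1 - {0}") (simp_all add: indicator_H)
  qed
  finally show ?thesis .
qed

lemma integral_MH_iterated:
  fixes F :: "complex \<times> complex \<Rightarrow> complex"
  assumes F: "(\<lambda>w. indicator H w *\<^sub>R F w) \<in> borel_measurable borel" and int: "integrable MH F"
  shows "AE w2 in lborel. w2 \<in> ball 0 1 - {0} \<longrightarrow> set_integrable lborel (ball 0 (rad w2)) (\<lambda>w1. F (w1, w2))"
    and "set_integrable lborel (ball 0 1 - {0}) (\<lambda>w2. LINT w1:ball 0 (rad w2)|lborel. F (w1, w2))"
    and "(\<integral>w. F w \<partial>MH) = (LINT w2:ball 0 1 - {0}|lborel. (LINT w1:ball 0 (rad w2)|lborel. F (w1, w2)))"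
proof -
  have I: "integrable (lborel \<Otimes>\<^sub>M lborel) (\<lambda>w. indicator H w *\<^sub>R F w)"
    using int by (simp add: integrable_MH_iff[OF F] lborel_prod)
  then have I': "integrable (lborel \<Otimes>\<^sub>M lborel) (\<lambda>(w1, w2). indicator H (w1, w2) *\<^sub>R F (w1, w2))"
    by (simp add: case_prod_unfold)
  have *: "(\<lambda>w1. indicator H (w1, w2) *\<^sub>R F (w1, w2)) = (\<lambda>w1. indicator (ball 0 1 - {0}) w2 *\<^sub>R (indicator (ball 0 (rad w2)) w1 *\<^sub>R F (w1, w2)))" for w2
    by (auto simp: indicator_H fun_eq_iff)
  from lborel_pair.AE_integrable_snd[OF I']
  show "AE w2 in lborel. w2 \<in> ball 0 1 - {0} \<longrightarrow> set_integrable lborel (ball 0 (rad w2)) (\<lambda>w1. F (w1, w2))"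
    by eventually_elim (auto simp: * set_integrable_def)
  from lborel_pair.integrable_snd[OF I']
  show "set_integrable lborel (ball 0 1 - {0}) (\<lambda>w2. LINT w1:ball 0 (rad w2)|lborel. F (w1, w2))"
    by (simp add: * set_integrable_def set_lebesgue_integral_def del: scaleR_scaleR)
  have "(\<integral>w. F w \<partial>MH) = (\<integral>w. indicator H w *\<^sub>R F w \<partial>(lborel \<Otimes>\<^sub>M lborel))"
    by (simp add: integral_MH_lborel[OF F] lborel_prod)
  also have "\<dots> = (\<integral>w2. (\<integral>w1. indicator H (w1, w2) *\<^sub>R F (w1, w2) \<partial>lborel) \<partial>lborel)"
    using lborel_pair.integral_snd[OF I'] by (simp add: case_prod_unfold)
  finally show "(\<integral>w. F w \<partial>MH) = (LINT w2:ball 0 1 - {0}|lborel. (LINT w1:ball 0 (rad w2)|lborel. F (w1, w2)))"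
    by (simp add: * set_lebesgue_integral_def del: scaleR_scaleR)
qed

lemma continuous_on_H_measurable:
  fixes F :: "complex \<times> complex \<Rightarrow> complex"
  assumes "continuous_on H F"
  shows "(\<lambda>w. indicator H w *\<^sub>R F w) \<in> borel_measurable borel"
    and "F \<in> borel_measurable MH"
proof -
  show 1: "(\<lambda>w. indicator H w *\<^sub>R F w) \<in> borel_measurable borel"
    by (intro borel_measurable_continuous_on_indicator assms) auto
  from measurable_MH[OF 1] show "F \<in> borel_measurable MH"
    by (rule measurable_cong[THEN iffD1, rotated]) auto
qed

section \<open>Disc coordinates of the Hartogs triangle\<close>

definition uu :: "complex \<times> complex \<Rightarrow> complex \<times> complex \<Rightarrow> complex" where
  "uu z w = (fst z * cnj (fst w)) ^ m / (snd z * cnj (snd w)) ^ n"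

definition tt :: "complex \<times> complex \<Rightarrow> complex \<times> complex \<Rightarrow> complex" where
  "tt z w = snd z * cnj (snd w)"

text \<open>This is |u(z)| for u(z) = z1^m / z2^n, while \<open>uu z w\<close> is u(z) times the
  conjugate of u(w).\<close>

definition om :: "complex \<times> complex \<Rightarrow> real" where
  "om z = cmod (fst z) ^ m / cmod (snd z) ^ n"

lemma om_nonneg [simp]: "om z \<ge> 0"
  by (simp add: om_def)

lemma om_less_1: "z \<in> H \<Longrightarrow> om z < 1"
  using snd_nonzero[of z] by (simp add: om_def H_eq)

lemma cmod_uu: "cmod (uu z w) = om z * om w"
  by (simp add: uu_def om_def norm_mult norm_divide norm_power power_mult_distrib)

lemma cmod_uu_less: "z \<in> H \<Longrightarrow> w \<in> H \<Longrightarrow> cmod (uu z w) \<le> om z"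
  unfolding cmod_uu using om_less_1[of w] by (intro mult_left_le) auto

lemma cmod_tt_less: "w \<in> H \<Longrightarrow> cmod (tt z w) \<le> cmod (snd z)"
  unfolding tt_def norm_mult using snd_less_1[of w] by (intro mult_left_le) auto

lemma uu_cnj: "uu w z = cnj (uu z w)"
  by (simp add: uu_def mult.commute)

lemma tt_cnj: "tt w z = cnj (tt z w)"
  by (simp add: tt_def mult.commute)

lemma cmod_cnj_diff: "cmod (1 - cnj x) = cmod (1 - x)"
  by (metis complex_cnj_diff complex_cnj_one complex_mod_cnj)

lemma uu_measurable [measurable (raw)]:
  assumes "f \<in> borel_measurable N" "g \<in> borel_measurable N"
  shows "(\<lambda>x. uu (f x) (g x)) \<in> borel_measurable N"
  unfolding uu_def using assms by measurable

lemma tt_measurable [measurable (raw)]: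
  assumes "f \<in> borel_measurable N" "g \<in> borel_measurable N"
  shows "(\<lambda>x. tt (f x) (g x)) \<in> borel_measurable N"
  unfolding tt_def using assms by measurable

lemma om_measurable [measurable (raw)]:
  assumes "f \<in> borel_measurable N"
  shows "(\<lambda>x. om (f x)) \<in> borel_measurable N"
  unfolding om_def using assms by measurable

text \<open>The substitution w1 = \<open>rad w2\<close> x turns each slice into the unit disc and
  \<open>om\<close> into |x|^m. Its Jacobian |w2|^(2n/m) moves the exponent c to c + 2n/m, and the
  estimate becomes a product of two disc estimates, with m and 1 as the power of the
  variable.\<close>

lemma forelli_rudin_H:
  assumes c: "c + 2 * real n / real m > -2" and e: "e > -1" and b: "b \<ge> 2" "b > e + 2"
  shows "\<exists>C\<ge>0. \<forall>z\<in>H.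
    (\<integral>\<^sup>+w. ennreal (cmod (snd w) powr c * (1 - om w) powr e * (1 - cmod (snd w)) powr e
         * cmod (1 - uu z w) powr (-b) * cmod (1 - tt z w) powr (-b)) \<partial>MH)
     \<le> ennreal (C * (1 - om z) powr (e + 2 - b) * (1 - cmod (snd z)) powr (e + 2 - b))"
proof -
  have "(0::real) > -2" by simp
  from forelli_rudin_disc[OF this e b m_pos]
  obtain C1 where C1: "C1 \<ge> 0" "\<And>v. cmod v < 1 \<Longrightarrow>
    (\<integral>\<^sup>+w. ennreal (cmod w powr 0 * (1 - cmod w ^ m) powr e * cmod (1 - w ^ m * v) powr (-b))
        * indicator (ball 0 1) w \<partial>lborel) \<le> ennreal (C1 * (1 - cmod v) powr (e + 2 - b))"
    by blast
  from forelli_rudin_disc[OF c e b zero_less_one]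
  obtain C2 where C2: "C2 \<ge> 0" "\<And>v. cmod v < 1 \<Longrightarrow>
    (\<integral>\<^sup>+w. ennreal (cmod w powr (c + 2 * real n / real m) * (1 - cmod w ^ 1) powr e * cmod (1 - w ^ 1 * v) powr (-b))
        * indicator (ball 0 1) w \<partial>lborel) \<le> ennreal (C2 * (1 - cmod v) powr (e + 2 - b))"
    by blast
  have "(\<integral>\<^sup>+w. ennreal (cmod (snd w) powr c * (1 - om w) powr e * (1 - cmod (snd w)) powr e
         * cmod (1 - uu z w) powr (-b) * cmod (1 - tt z w) powr (-b)) \<partial>MH)
     \<le> ennreal (C1 * C2 * (1 - om z) powr (e + 2 - b) * (1 - cmod (snd z)) powr (e + 2 - b))"
    if z: "z \<in> H" for z
  proof -
    obtain z1 z2 where z12: "z = (z1, z2)" by (cases z)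
    have z2: "z2 \<noteq> 0" "cmod z2 < 1" using snd_nonzero[OF z] snd_less_1[OF z] by (auto simp: z12)
    define D1 where "D1 = C1 * (1 - om z) powr (e + 2 - b)"
    have D1: "D1 \<ge> 0" using C1 by (simp add: D1_def)
    have inner: "(\<integral>\<^sup>+w1. ennreal (cmod w2 powr c * (1 - om (w1, w2)) powr e * (1 - cmod w2) powr e
         * cmod (1 - uu z (w1, w2)) powr (-b) * cmod (1 - tt z (w1, w2)) powr (-b)) * indicator (ball 0 (rad w2)) w1 \<partial>lborel)
       \<le> ennreal D1 * ennreal (cmod w2 powr (c + 2 * real n / real m) * (1 - cmod w2 ^ 1) powr e * cmod (1 - w2 ^ 1 * cnj z2) powr (-b))"
      if w2: "w2 \<in> ball 0 1 - {0}" for w2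
    proof -
      define A where "A = cmod w2 powr c * (1 - cmod w2) powr e * cmod (1 - w2 ^ 1 * cnj z2) powr (-b)"
      have A: "A \<ge> 0" by (simp add: A_def)
      \<comment> \<open>What the scaled slice variable does not carry goes into v;
        \<open>rad w2 ^ m\<close> cancels |w2|^n, so |v| = \<open>om z\<close> does not depend on w2
        and the inner bound is uniform.\<close>
      define v where "v = (cnj z1 ^ m * of_real (rad w2) ^ m) / (cnj z2 * w2) ^ n"
      have "cmod v = om z"
        using w2 by (simp add: v_def om_def z12 norm_mult norm_divide norm_power power_mult_distrib rad_power)
      have "(\<integral>\<^sup>+w1. ennreal (cmod w2 powr c * (1 - om (w1, w2)) powr e * (1 - cmod w2) powr e
         * cmod (1 - uu z (w1, w2)) powr (-b) * cmod (1 - tt z (w1, w2)) powr (-b)) * indicator (ball 0 (rad w2)) w1 \<partial>lborel)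
         = ennreal ((cmod (of_real (rad w2)))\<^sup>2) * (\<integral>\<^sup>+x. ennreal (cmod w2 powr c * (1 - om (of_real (rad w2) * x, w2)) powr e * (1 - cmod w2) powr e
         * cmod (1 - uu z (of_real (rad w2) * x, w2)) powr (-b) * cmod (1 - tt z (of_real (rad w2) * x, w2)) powr (-b)) * indicator (ball 0 (rad w2)) (of_real (rad w2) * x) \<partial>lborel)"
        using w2 by (intro nn_integral_complex_mult) (auto simp: less_imp_neq[THEN not_sym])
      also have "\<dots> = ennreal ((rad w2)\<^sup>2) * (\<integral>\<^sup>+x. ennreal A *
          (ennreal (cmod x powr 0 * (1 - cmod x ^ m) powr e * cmod (1 - x ^ m * v) powr (-b)) * indicator (ball 0 1) x) \<partial>lborel)"
      proof -
        have ind: "indicator (ball 0 (rad w2)) (of_real (rad w2) * x) = (indicator (ball 0 1) x :: ennreal)" for x :: complex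
        proof -
          have "of_real (rad w2) * x \<in> ball 0 (rad w2) \<longleftrightarrow> x \<in> ball 0 1"
            using rad_pos[of w2] w2 by (simp add: norm_mult)
          then show ?thesis unfolding indicator_def by simp
        qed
        have om: "om (of_real (rad w2) * x, w2) = cmod x ^ m" for x
          using w2 by (simp add: om_def norm_mult power_mult_distrib rad_power)
        have uu: "cmod (1 - uu z (of_real (rad w2) * x, w2)) = cmod (1 - x ^ m * v)" for x
        proof -
          have "x ^ m * v = cnj (uu z (of_real (rad w2) * x, w2))"
            by (simp add: v_def uu_def z12 power_mult_distrib)
          then show ?thesis by (simp only: cmod_cnj_diff)
        qed
        have tt: "cmod (1 - tt z (x, w2)) = cmod (1 - w2 ^ 1 * cnj z2)" for x
        proof -
          have "w2 ^ 1 * cnj z2 = cnj (tt z (x, w2))" by (simp add: tt_def z12)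
          then show ?thesis by (simp only: cmod_cnj_diff)
        qed
        have "ennreal (cmod w2 powr c * (1 - cmod x ^ m) powr e * (1 - cmod w2) powr e
         * cmod (1 - x ^ m * v) powr (-b) * cmod (1 - w2 ^ 1 * cnj z2) powr (-b)) * indicator (ball 0 1) x
          = ennreal A * (ennreal (cmod x powr 0 * (1 - cmod x ^ m) powr e * cmod (1 - x ^ m * v) powr (-b)) * indicator (ball 0 1) x)" if "x \<noteq> 0" for x
          using that A by (auto simp: A_def indicator_def ennreal_mult[symmetric] mult_ac)
        moreover have "AE x in lborel. x \<noteq> (0::complex)" by (rule AE_lborel_singleton)
        ultimately show ?thesis
          unfolding ind om uu tt norm_of_real by (auto intro!: arg_cong2[where f="(*)"] nn_integral_cong_AE)
      qed
      also have "\<dots> = ennreal ((rad w2)\<^sup>2) * (ennreal A * (\<integral>\<^sup>+x.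
          ennreal (cmod x powr 0 * (1 - cmod x ^ m) powr e * cmod (1 - x ^ m * v) powr (-b)) * indicator (ball 0 1) x \<partial>lborel))"
        by (subst nn_integral_cmult) auto
      also have "\<dots> \<le> ennreal ((rad w2)\<^sup>2) * (ennreal A * ennreal D1)"
        using C1(2)[of v] om_less_1[OF z] by (intro mult_left_mono) (auto simp: \<open>cmod v = om z\<close> D1_def)
      also have "\<dots> = ennreal D1 * ennreal ((rad w2)\<^sup>2 * A)"
        using A D1 by (simp add: ennreal_mult mult_ac)
      also have "(rad w2)\<^sup>2 * A = cmod w2 powr (c + 2 * real n / real m) * (1 - cmod w2 ^ 1) powr e * cmod (1 - w2 ^ 1 * cnj z2) powr (-b)"
      proof -
        have "(rad w2)\<^sup>2 = rad w2 powr 2" using w2 by (simp add: powr_numeral)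
        also have "\<dots> = cmod w2 powr (2 * real n / real m)" by (simp add: rad_powr mult.commute)
        finally show ?thesis by (simp add: A_def powr_add mult_ac)
      qed
      finally show ?thesis .
    qed
    have "(\<integral>\<^sup>+w. ennreal (cmod (snd w) powr c * (1 - om w) powr e * (1 - cmod (snd w)) powr e
         * cmod (1 - uu z w) powr (-b) * cmod (1 - tt z w) powr (-b)) \<partial>MH)
       = (\<integral>\<^sup>+w2. (\<integral>\<^sup>+w1. ennreal (cmod w2 powr c * (1 - om (w1, w2)) powr e * (1 - cmod w2) powr e
         * cmod (1 - uu z (w1, w2)) powr (-b) * cmod (1 - tt z (w1, w2)) powr (-b)) * indicator (ball 0 (rad w2)) w1 \<partial>lborel)
          * indicator (ball 0 1 - {0}) w2 \<partial>lborel)"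
      by (subst nn_integral_MH) auto
    also have "\<dots> \<le> (\<integral>\<^sup>+w2. ennreal D1 * (ennreal (cmod w2 powr (c + 2 * real n / real m) * (1 - cmod w2 ^ 1) powr e * cmod (1 - w2 ^ 1 * cnj z2) powr (-b)) * indicator (ball 0 1) w2) \<partial>lborel)"
      by (intro nn_integral_mono) (use inner in \<open>auto simp: indicator_def\<close>)
    also have "\<dots> = ennreal D1 * (\<integral>\<^sup>+w2. ennreal (cmod w2 powr (c + 2 * real n / real m) * (1 - cmod w2 ^ 1) powr e * cmod (1 - w2 ^ 1 * cnj z2) powr (-b)) * indicator (ball 0 1) w2 \<partial>lborel)"
      by (rule nn_integral_cmult) measurable
    also have "\<dots> \<le> ennreal D1 * ennreal (C2 * (1 - cmod z2) powr (e + 2 - b))"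
      using C2(2)[of "cnj z2"] z2 by (intro mult_left_mono) auto
    also have "\<dots> = ennreal (C1 * C2 * (1 - om z) powr (e + 2 - b) * (1 - cmod (snd z)) powr (e + 2 - b))"
      using C1(1) C2(1) by (simp add: D1_def ennreal_mult[symmetric] z12 mult_ac)
    finally show ?thesis .
  qed
  with C1(1) C2(1) show ?thesis by (intro exI[of _ "C1 * C2"]) auto
qed

section \<open>Integrability of powers of the coordinates\<close>

lemma nn_integral_snd_powr_finite:
  assumes c: "c + 2 * real n / real m > -2"
  shows "(\<integral>\<^sup>+w. ennreal (cmod (snd w) powr c) \<partial>MH) < \<infinity>"
proof -
  have "(\<integral>\<^sup>+w. ennreal (cmod (snd w) powr c) \<partial>MH) =
    (\<integral>\<^sup>+w2. (\<integral>\<^sup>+(w1::complex). ennreal (cmod w2 powr c) * indicator (ball 0 (rad w2)) w1 \<partial>lborel)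
          * indicator (ball 0 1 - {0}) w2 \<partial>lborel)"
    by (subst nn_integral_MH) auto
  also have "\<dots> \<le> (\<integral>\<^sup>+w2. ennreal pi * (ennreal (cmod w2 powr (c + 2 * real n / real m)) * indicator (ball 0 1) w2) \<partial>lborel)"
  proof (intro nn_integral_mono)
    fix w2 :: complex
    show "(\<integral>\<^sup>+(w1::complex). ennreal (cmod w2 powr c) * indicator (ball 0 (rad w2)) w1 \<partial>lborel) * indicator (ball 0 1 - {0}) w2
      \<le> ennreal pi * (ennreal (cmod w2 powr (c + 2 * real n / real m)) * indicator (ball 0 1) w2)"
    proof (cases "w2 \<in> ball 0 1 - {0}")
      case True
      then have "(rad w2)\<^sup>2 = rad w2 powr 2" by (simp add: powr_numeral)
      also have "\<dots> = cmod w2 powr (2 * real n / real m)" by (simp add: rad_powr mult.commute)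
      finally have "emeasure lborel (ball (0::complex) (rad w2)) = ennreal (pi * cmod w2 powr (2 * real n / real m))"
        by (simp add: emeasure_ball unit_ball_vol_2)
      then have "(\<integral>\<^sup>+(w1::complex). ennreal (cmod w2 powr c) * indicator (ball 0 (rad w2)) w1 \<partial>lborel) = ennreal (cmod w2 powr c) * ennreal (pi * cmod w2 powr (2 * real n / real m))"
        by (subst nn_integral_cmult) auto
      also have "\<dots> = ennreal (pi * cmod w2 powr (c + 2 * real n / real m))"
        by (simp add: ennreal_mult[symmetric] powr_add mult_ac)
      finally show ?thesis using True by (simp add: ennreal_mult)
    qed auto
  qed
  also have "\<dots> = ennreal pi * ennreal (2 * pi * 1 powr (c + 2 * real n / real m + 2) / (c + 2 * real n / real m + 2))"
    using c by (subst nn_integral_cmult, simp, subst nn_integral_cmod_powr) auto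
  finally show ?thesis by (auto simp: ennreal_mult_less_top intro: le_less_trans)
qed

text \<open>The divergence comes from w2 \<rightarrow> 0 alone. Restricting to
  \<open>om w < 1/2\<close> and |w2| < 1/2 costs a constant factor in the slices and keeps the
  boundary weights of the symbol bounded below, as \<open>monomial_symbol_infinite\<close>
  requires.\<close>

lemma nn_integral_monomial_infinite:
  assumes a: "a \<ge> 0" and c: "c + real n * (a + 2) / real m \<le> -2"
  shows "(\<integral>\<^sup>+w. ennreal (cmod (fst w) powr a * cmod (snd w) powr c)
     * indicator {w. om w < 1/2 \<and> cmod (snd w) < 1/2} w \<partial>MH) = \<infinity>"
proof -
  \<comment> \<open>With \<rho>^m = 1/2, the condition |w1| < \<rho> \<open>rad w2\<close> is
    \<open>om (w1, w2) < 1/2\<close>.\<close>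
  define \<rho> where "\<rho> = (1/2) powr (1 / real m)"
  have \<rho>: "0 < \<rho>" "\<rho> \<le> 1"
    by (auto simp: \<rho>_def powr_le1)
  have \<rho>m: "\<rho> ^ m = 1/2"
    using m_pos by (simp add: \<rho>_def powr_power)
  define K where "K = 2 * pi * \<rho> powr (a + 2) / (a + 2)"
  have K: "K > 0" using a \<rho> by (simp add: K_def)
  have "\<infinity> = ennreal K * (\<integral>\<^sup>+w2. ennreal (cmod w2 powr (c + real n * (a + 2) / real m)) * indicator (ball 0 (1/2)) w2 \<partial>lborel)"
    using K by (subst nn_integral_cmod_powr_infinite[OF c]) (auto simp: ennreal_mult_top)
  also have "\<dots> = (\<integral>\<^sup>+w2. ennreal K * (ennreal (cmod w2 powr (c + real n * (a + 2) / real m)) * indicator (ball 0 (1/2)) w2) \<partial>lborel)"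
    by (rule nn_integral_cmult[symmetric]) measurable
  also have "\<dots> \<le> (\<integral>\<^sup>+w2. (\<integral>\<^sup>+w1. ennreal (cmod w1 powr a * cmod w2 powr c)
     * indicator {w. om w < 1/2 \<and> cmod (snd w) < 1/2} (w1, w2) * indicator (ball 0 (rad w2)) w1 \<partial>lborel)
     * indicator (ball 0 1 - {0}) w2 \<partial>lborel)"
  proof (intro nn_integral_mono_AE)
    have "AE x in lborel. x \<noteq> (0::complex)" by (rule AE_lborel_singleton)
    then show "AE w2 in lborel. ennreal K * (ennreal (cmod w2 powr (c + real n * (a + 2) / real m)) * indicator (ball 0 (1/2)) w2)
      \<le> (\<integral>\<^sup>+w1. ennreal (cmod w1 powr a * cmod w2 powr c)
     * indicator {w. om w < 1/2 \<and> cmod (snd w) < 1/2} (w1, w2) * indicator (ball 0 (rad w2)) w1 \<partial>lborel)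
     * indicator (ball 0 1 - {0}) w2"
    proof eventually_elim
      case (elim w2)
      show ?case
      proof (cases "w2 \<in> ball 0 (1/2)")
        case True
        have "ennreal K * ennreal (cmod w2 powr (c + real n * (a + 2) / real m))
          = ennreal (cmod w2 powr c) * ennreal (2 * pi * (\<rho> * rad w2) powr (a + 2) / (a + 2))"
          using \<rho> a by (simp add: K_def ennreal_mult[symmetric] powr_mult rad_powr powr_add[of _ c "real n * (a + 2) / real m"] mult_ac)
        also have "\<dots> = ennreal (cmod w2 powr c) * (\<integral>\<^sup>+w1. ennreal (cmod w1 powr a) * indicator (ball 0 (\<rho> * rad w2)) w1 \<partial>lborel)"
          using a \<rho> by (subst nn_integral_cmod_powr) auto
        also have "\<dots> = (\<integral>\<^sup>+(w1::complex). ennreal (cmod w2 powr c) * (ennreal (cmod w1 powr a) * indicator (ball 0 (\<rho> * rad w2)) w1) \<partial>lborel)"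
          by (rule nn_integral_cmult[symmetric]) measurable
        also have "\<dots> \<le> (\<integral>\<^sup>+w1. ennreal (cmod w1 powr a * cmod w2 powr c)
           * indicator {w. om w < 1/2 \<and> cmod (snd w) < 1/2} (w1, w2) * indicator (ball 0 (rad w2)) w1 \<partial>lborel)"
        proof (intro nn_integral_mono)
          fix w1 :: complex
          show "ennreal (cmod w2 powr c) * (ennreal (cmod w1 powr a) * indicator (ball 0 (\<rho> * rad w2)) w1)
            \<le> ennreal (cmod w1 powr a * cmod w2 powr c)
           * indicator {w. om w < 1/2 \<and> cmod (snd w) < 1/2} (w1, w2) * indicator (ball 0 (rad w2)) w1"
          proof (cases "cmod w1 < \<rho> * rad w2")
            case w1: True
            then have "cmod w1 ^ m < (\<rho> * rad w2) ^ m"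
              using m_pos by (intro power_strict_mono) auto
            then have "om (w1, w2) < 1/2"
              using elim by (simp add: om_def power_mult_distrib \<rho>m rad_power field_simps)
            moreover have "cmod w1 < rad w2"
              using w1 \<rho> by (meson mult_left_le_one_le less_le_trans rad_nonneg less_imp_le)
            ultimately show ?thesis using True w1 by (simp add: ennreal_mult mult_ac)
          qed simp
        qed
        finally show ?thesis using True elim by simp
      qed simp
    qed
  qed
  also have "\<dots> = (\<integral>\<^sup>+w. ennreal (cmod (fst w) powr a * cmod (snd w) powr c)
     * indicator {w. om w < 1/2 \<and> cmod (snd w) < 1/2} w \<partial>MH)"
    by (subst nn_integral_MH) auto
  finally show ?thesis by (simp add: top_unique)
qed

end

subsection \<open>The Bergman kernel\<close>

definition holomorphic2_at :: "(complex \<times> complex \<Rightarrow> complex) \<Rightarrow> complex \<times> complex \<Rightarrow> bool" where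
  "holomorphic2_at f z \<longleftrightarrow> (\<exists>D. (f has_derivative D) (at z) \<and> (\<forall>c u v. D (c * u, c * v) = c * D (u, v)))"

lemma holomorphic2_on_iff: "f holomorphic2_on S \<longleftrightarrow> (\<forall>z\<in>S. holomorphic2_at f z)"
  by (simp add: holomorphic2_on_def holomorphic2_at_def)

named_theorems holomorphic2_intros

lemma holomorphic2_at_const [holomorphic2_intros]: "holomorphic2_at (\<lambda>_. c) z"
  unfolding holomorphic2_at_def by (intro exI[of _ "\<lambda>_. 0"]) auto

lemma holomorphic2_at_fst [holomorphic2_intros]: "holomorphic2_at fst z"
  unfolding holomorphic2_at_def by (intro exI[of _ fst]) (auto intro: bounded_linear_imp_has_derivative bounded_linear_fst)

lemma holomorphic2_at_snd [holomorphic2_intros]: "holomorphic2_at snd z"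
  unfolding holomorphic2_at_def by (intro exI[of _ snd]) (auto intro: bounded_linear_imp_has_derivative bounded_linear_snd)

lemma holomorphic2_at_add [holomorphic2_intros]:
  assumes "holomorphic2_at f z" "holomorphic2_at g z"
  shows "holomorphic2_at (\<lambda>w. f w + g w) z"
proof -
  obtain D E where D: "(f has_derivative D) (at z)" "\<And>c u v. D (c * u, c * v) = c * D (u, v)"
    and E: "(g has_derivative E) (at z)" "\<And>c u v. E (c * u, c * v) = c * E (u, v)"
    using assms by (auto simp: holomorphic2_at_def)
  show ?thesis
    unfolding holomorphic2_at_def
    by (rule exI, rule conjI, rule has_derivative_add[OF D(1) E(1)]) (simp add: D(2) E(2) distrib_left)
qed

lemma holomorphic2_at_mult [holomorphic2_intros]:
  assumes "holomorphic2_at f z" "holomorphic2_at g z"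
  shows "holomorphic2_at (\<lambda>w. f w * g w) z"
proof -
  obtain D E where D: "(f has_derivative D) (at z)" "\<And>c u v. D (c * u, c * v) = c * D (u, v)"
    and E: "(g has_derivative E) (at z)" "\<And>c u v. E (c * u, c * v) = c * E (u, v)"
    using assms by (auto simp: holomorphic2_at_def)
  show ?thesis
    unfolding holomorphic2_at_def
    by (rule exI, rule conjI, rule has_derivative_mult[OF D(1) E(1)]) (simp add: D(2) E(2) algebra_simps)
qed

lemma holomorphic2_at_compose:
  assumes "holomorphic2_at f z" and "(g has_field_derivative g') (at (f z))"
  shows "holomorphic2_at (\<lambda>w. g (f w)) z"
proof -
  obtain D where D: "(f has_derivative D) (at z)" "\<And>c u v. D (c * u, c * v) = c * D (u, v)"
    using assms by (auto simp: holomorphic2_at_def)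
  have "((\<lambda>w. g (f w)) has_derivative (\<lambda>h. g' * D h)) (at z)"
    using has_derivative_compose[OF D(1)] assms(2) by (simp add: has_field_derivative_def)
  then show ?thesis
    unfolding holomorphic2_at_def by (intro exI conjI, assumption) (simp add: D(2) algebra_simps)
qed

lemma holomorphic2_at_diff [holomorphic2_intros]:
  assumes "holomorphic2_at f z" "holomorphic2_at g z"
  shows "holomorphic2_at (\<lambda>w. f w - g w) z"
  using holomorphic2_at_add[OF assms(1) holomorphic2_at_mult[OF holomorphic2_at_const[of "-1"] assms(2)]] by simp

lemma holomorphic2_at_power [holomorphic2_intros]:
  "holomorphic2_at f z \<Longrightarrow> holomorphic2_at (\<lambda>w. f w ^ k) z"
  by (induction k) (auto intro!: holomorphic2_intros)

lemma holomorphic2_at_power_int [holomorphic2_intros]: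
  assumes "holomorphic2_at f z" "f z \<noteq> 0"
  shows "holomorphic2_at (\<lambda>w. f w powi k) z"
  by (rule holomorphic2_at_compose[OF assms(1)])
    (rule derivative_eq_intros refl | use assms in simp)+

lemma holomorphic2_at_divide [holomorphic2_intros]:
  assumes "holomorphic2_at f z" "holomorphic2_at g z" "g z \<noteq> 0"
  shows "holomorphic2_at (\<lambda>w. f w / g w) z"
  using holomorphic2_at_mult[OF assms(1) holomorphic2_at_power_int[OF assms(2,3), of "-1"]]
  by (simp add: divide_inverse)

lemma holomorphic2_at_sum [holomorphic2_intros]:
  "(\<And>i. i \<in> I \<Longrightarrow> holomorphic2_at (f i) z) \<Longrightarrow> holomorphic2_at (\<lambda>w. \<Sum>i\<in>I. f i w) z"
  by (induction I rule: infinite_finite_induct) (auto intro!: holomorphic2_intros)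

lemma holomorphic2_on_imp_continuous_on: "f holomorphic2_on S \<Longrightarrow> continuous_on S f"
  unfolding holomorphic2_on_iff holomorphic2_at_def
  by (meson continuous_at_imp_continuous_on has_derivative_continuous)

lemma holomorphic2_on_diff: "f holomorphic2_on S \<Longrightarrow> g holomorphic2_on S \<Longrightarrow> (\<lambda>w. f w - g w) holomorphic2_on S"
  unfolding holomorphic2_on_iff by (auto intro: holomorphic2_intros)

section \<open>Square integrable monomials and the closed form of the kernel\<close>

context hartogs
begin

text \<open>A monomial \<open>z\<^sub>1\<^sup>a z\<^sub>2\<^sup>b\<close> is square integrable iff \<open>m (b + 1) + n (a + 1) \<ge> 1\<close>. The smallest such
  exponent \<open>b\<close> is \<open>ee a\<close>, and \<open>jj a\<close> is the corresponding value of \<open>m (b + 1) + n (a + 1)\<close>. Both are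
  periodic in \<open>a\<close> up to a shift, which makes the kernel a rational function.\<close>

definition ee :: "nat \<Rightarrow> int" where
  "ee a = - 1 - int ((n * (a + 1) - 1) div m)"

definition jj :: "nat \<Rightarrow> nat" where
  "jj a = (n * (a + 1) - 1) mod m + 1"

text \<open>Subtracting 1 before the division and adding 1 to the remainder moves the range from
  0..m-1 to 1..m, so the condition for square integrability is built in.\<close>

lemma jj_bounds: "1 \<le> jj a" "jj a \<le> m"
  using m_pos mod_less_divisor[of m "n * (a + 1) - 1"] by (auto simp: jj_def Suc_le_eq)

text \<open>Division with remainder of n (a + 1) - 1 by m, with the quotient hidden in
  \<open>ee\<close>.\<close>

lemma int_jj: "int (jj a) = int m * (ee a + 1) + int n * (int a + 1)"
proof -
  define N where "N = n * (a + 1) - 1"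
  have "n * (a + 1) = N + 1"
    using n_pos by (simp add: N_def)
  then have 1: "int n * (int a + 1) = int N + 1"
    by (metis of_nat_1 of_nat_add of_nat_mult)
  have "int N = int (m * (N div m) + N mod m)" by simp
  then have "int N = int m * int (N div m) + int (N mod m)"
    by (simp only: of_nat_add of_nat_mult)
  with 1 show ?thesis
    unfolding jj_def ee_def N_def[symmetric] by (simp add: algebra_simps)
qed

lemma real_jj: "real (jj a) = real m * (of_int (ee a) + 1) + real n * (real a + 1)"
proof -
  have "real_of_int (int (jj a)) = real_of_int (int m * (ee a + 1) + int n * (int a + 1))"
    by (simp only: int_jj)
  then show ?thesis by simp
qed

lemma shift_exponent: "n * (a + m * k + 1) - 1 = m * (n * k) + (n * (a + 1) - 1)"
  using n_pos by (cases n) (simp_all add: algebra_simps)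

lemma jj_shift: "jj (a + m * k) = jj a"
  unfolding jj_def shift_exponent by simp

lemma ee_shift: "ee (a + m * k) = ee a - int (n * k)"
  unfolding ee_def shift_exponent using m_pos by simp

text \<open>For |z1| comparable to \<open>rad z2\<close> the monomial with index a has size
  |z2|^((\<open>jj a\<close> - m - n)/m) up to constants; the worst case \<open>jj a = 1\<close>
  gives the exponent -\<open>kap\<close>.\<close>

definition kap :: real where
  "kap = (real m + real n - 1) / real m"

lemma kap_nonneg: "kap \<ge> 0"
  using m_pos n_pos by (simp add: kap_def)

lemma monomial_bound:
  assumes z: "z \<in> H"
  shows "cmod (fst z) ^ a * cmod (snd z) powi (ee a) \<le> cmod (snd z) powr (- kap)"
proof -
  obtain z1 z2 where z12: "z = (z1, z2)" by (cases z)
  have z2: "z2 \<noteq> 0" "cmod z2 < 1" "cmod z1 < rad z2"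
    using z by (auto simp: z12 mem_H_rad)
  have "cmod z1 ^ a * cmod z2 powi (ee a) \<le> rad z2 ^ a * cmod z2 powi (ee a)"
    using z2 by (intro mult_right_mono power_mono) auto
  also have "\<dots> = cmod z2 powr (real n * real a / real m + of_int (ee a))"
    using z2 rad_powr[of z2 "real a"] by (simp add: powr_add powr_realpow flip: powr_real_of_int')
  also have "\<dots> \<le> cmod z2 powr (- kap)"
  proof (rule powr_mono')
    have "real (jj a) \<ge> 1" using jj_bounds by simp
    then have "real m * (of_int (ee a) + 1) + real n * (real a + 1) \<ge> 1"
      by (simp only: real_jj)
    moreover have "real m * (real n * real a / real m + of_int (ee a)) = real n * real a + real m * of_int (ee a)"
      using m_pos by (simp add: distrib_left)
    moreover have "real m * (- kap) = 1 - real m - real n"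
      using m_pos by (simp add: kap_def)
    ultimately have "real m * (- kap) \<le> real m * (real n * real a / real m + of_int (ee a))"
      by (simp add: algebra_simps)
    then show "- kap \<le> real n * real a / real m + of_int (ee a)"
      using m_pos by (simp only: mult_le_cancel_left_pos of_nat_0_less_iff)
  qed (use z2 in auto)
  finally show ?thesis by (simp add: z12)
qed

definition ss :: "complex \<times> complex \<Rightarrow> complex \<times> complex \<Rightarrow> complex" where
  "ss z w = fst z * cnj (fst w)"

text \<open>The sum of (\<open>jj a\<close> + m l) t^l over l \<ge> 0, that is, over all admissible
  exponents \<open>ee a\<close> + l of z2 for a fixed power a of z1.\<close>

definition hh :: "nat \<Rightarrow> complex \<Rightarrow> complex" where
  "hh a t = (of_nat (jj a) + (of_nat m - of_nat (jj a)) * t) / (1 - t)\<^sup>2"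

text \<open>The sum of \<open>z\<^sub>1\<^sup>a z\<^sub>2\<^sup>b\<close> times the conjugate of \<open>w\<^sub>1\<^sup>a w\<^sub>2\<^sup>b\<close>, divided by
  \<open>m \<pi>\<^sup>2 / ((a + 1) (m (b + 1) + n (a + 1)))\<close>, over all square integrable monomials: \<open>a\<close> is split into its
  residue and quotient modulo \<open>m\<close>, and the two geometric-type series are summed. \<open>bterm a\<close> is the part
  with fixed \<open>a\<close>, up to the factor \<open>m \<pi>\<^sup>2\<close>.\<close>

definition B :: "complex \<times> complex \<Rightarrow> complex \<times> complex \<Rightarrow> complex" where
  "B z w = (\<Sum>a<m. ss z w ^ a * tt z w powi ee a *
      ((of_nat (a + 1) + (of_nat m - of_nat (a + 1)) * uu z w) / (1 - uu z w)\<^sup>2) * hh a (tt z w))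
     / of_real (real m * pi\<^sup>2)"

definition bterm :: "nat \<Rightarrow> complex \<times> complex \<Rightarrow> complex \<times> complex \<Rightarrow> complex" where
  "bterm a z w = of_nat (a + 1) * ss z w ^ a * tt z w powi ee a * hh a (tt z w)"

lemma ss_cnj: "ss w z = cnj (ss z w)"
  by (simp add: ss_def mult.commute)

lemma cnj_powi: "cnj (x powi k) = cnj x powi k"
  by (simp add: power_int_def)

lemma hh_cnj: "hh a (cnj t) = cnj (hh a t)"
  by (simp add: hh_def)

lemma B_cnj: "B w z = cnj (B z w)"
  unfolding B_def uu_cnj[of w z] tt_cnj[of w z] ss_cnj[of w z] hh_cnj
  by (simp add: cnj_powi)

lemma ss_measurable [measurable (raw)]:
  assumes "f \<in> borel_measurable N" "g \<in> borel_measurable N"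
  shows "(\<lambda>x. ss (f x) (g x)) \<in> borel_measurable N"
  unfolding ss_def using assms by measurable

lemma powi_measurable [measurable (raw)]:
  fixes f :: "'a \<Rightarrow> complex"
  assumes "f \<in> borel_measurable N"
  shows "(\<lambda>x. f x powi k) \<in> borel_measurable N"
  unfolding power_int_def using assms by measurable

lemma hh_measurable [measurable (raw)]:
  assumes "f \<in> borel_measurable N"
  shows "(\<lambda>x. hh a (f x)) \<in> borel_measurable N"
  unfolding hh_def using assms by measurable

lemma B_measurable [measurable (raw)]:
  assumes "f \<in> borel_measurable N" "g \<in> borel_measurable N"
  shows "(\<lambda>x. B (f x) (g x)) \<in> borel_measurable N"
  unfolding B_def using assms by measurable

lemma bterm_measurable [measurable (raw)]:
  assumes "f \<in> borel_measurable N" "g \<in> borel_measurable N"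
  shows "(\<lambda>x. bterm a (f x) (g x)) \<in> borel_measurable N"
  unfolding bterm_def using assms by measurable

text \<open>For j \<le> m both coefficients are nonnegative and add up to m. It applies to the
  kernel because \<open>jj a\<close>, and a + 1 with a < m, stay within 1..m.\<close>

lemma cmod_affine_le:
  assumes "cmod x \<le> 1" "j \<le> m"
  shows "cmod (of_nat j + (of_nat m - of_nat j) * x) \<le> real m"
proof -
  have "cmod (of_nat j + (of_nat m - of_nat j) * x) \<le> cmod (of_nat j) + cmod (of_nat (m - j)) * cmod x"
    using assms by (metis norm_mult norm_triangle_ineq of_nat_diff)
  also have "\<dots> = real j + real (m - j) * cmod x"
    by (simp only: norm_of_nat)
  also have "\<dots> \<le> real j + real (m - j) * 1"
    using assms by (intro add_mono mult_left_mono) auto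
  finally show ?thesis using assms by simp
qed

lemma cmod_tt_lt_1: "z \<in> H \<Longrightarrow> w \<in> H \<Longrightarrow> cmod (tt z w) < 1"
  using cmod_tt_less[of w z] snd_less_1[of z] by simp

lemma cmod_uu_lt_1: "z \<in> H \<Longrightarrow> w \<in> H \<Longrightarrow> cmod (uu z w) < 1"
  using cmod_uu_less[of z w] om_less_1[of z] by simp

lemma tt_nonzero: "z \<in> H \<Longrightarrow> w \<in> H \<Longrightarrow> tt z w \<noteq> 0"
  using snd_nonzero[of z] snd_nonzero[of w] by (simp add: tt_def)

lemma one_minus_tt: "z \<in> H \<Longrightarrow> w \<in> H \<Longrightarrow> 1 - cmod (snd z) \<le> cmod (1 - tt z w)"
  using cmod_tt_less[of w z] norm_triangle_ineq2[of 1 "tt z w"] by simp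

lemma one_minus_uu: "z \<in> H \<Longrightarrow> w \<in> H \<Longrightarrow> 1 - om z \<le> cmod (1 - uu z w)"
  using cmod_uu_less[of z w] norm_triangle_ineq2[of 1 "uu z w"] by simp

lemma cmod_ss_tt_le:
  assumes "z \<in> H" "w \<in> H"
  shows "cmod (ss z w ^ a * tt z w powi ee a) \<le> cmod (snd z) powr (- kap) * cmod (snd w) powr (- kap)"
proof -
  have "cmod (ss z w ^ a * tt z w powi ee a)
      = (cmod (fst z) ^ a * cmod (snd z) powi ee a) * (cmod (fst w) ^ a * cmod (snd w) powi ee a)"
    by (simp add: ss_def tt_def norm_mult norm_power norm_power_int power_mult_distrib power_int_mult_distrib)
  also have "\<dots> \<le> cmod (snd z) powr (- kap) * cmod (snd w) powr (- kap)"
    using assms by (intro mult_mono monomial_bound) auto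
  finally show ?thesis .
qed

lemma cmod_hh_le:
  assumes "z \<in> H" "w \<in> H"
  shows "cmod (hh a (tt z w)) \<le> real m / (cmod (1 - tt z w))\<^sup>2"
  unfolding hh_def norm_divide norm_power
  using cmod_affine_le[of "tt z w" "jj a"] jj_bounds[of a] cmod_tt_lt_1[OF assms]
  by (intro divide_right_mono) auto

text \<open>Each of the m residues a contributes a product of two disc kernels with numerators at
  most m; the number of residues cancels the m of the normalization, and 1/\<pi>^2 \<le> 1 is
  dropped.\<close>

lemma cmod_B_le:
  assumes z: "z \<in> H" and w: "w \<in> H"
  shows "cmod (B z w) \<le> real m ^ 2 * (cmod (snd z) powr (- kap) * cmod (snd w) powr (- kap))
    * cmod (1 - uu z w) powr (-2) * cmod (1 - tt z w) powr (-2)"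
proof -
  define Q where "Q = cmod (snd z) powr (- kap) * cmod (snd w) powr (- kap)"
  define U V where "U = (cmod (1 - uu z w))\<^sup>2" and "V = (cmod (1 - tt z w))\<^sup>2"
  have Q: "Q \<ge> 0" by (simp add: Q_def)
  have neq: "1 - uu z w \<noteq> 0" "1 - tt z w \<noteq> 0"
    using cmod_uu_lt_1[OF z w] cmod_tt_lt_1[OF z w] by auto
  then have UV: "U > 0" "V > 0" by (auto simp: U_def V_def)
  have le: "cmod (ss z w ^ a * tt z w powi ee a *
      ((of_nat (a + 1) + (of_nat m - of_nat (a + 1)) * uu z w) / (1 - uu z w)\<^sup>2) * hh a (tt z w))
      \<le> Q * (real m / U) * (real m / V)" if "a < m" for a
  proof -
    have "cmod ((of_nat (a + 1) + (of_nat m - of_nat (a + 1)) * uu z w) / (1 - uu z w)\<^sup>2) \<le> real m / U"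
      unfolding norm_divide norm_power U_def
      using cmod_affine_le[of "uu z w" "a + 1"] cmod_uu_lt_1[OF z w] that
      by (intro divide_right_mono) auto
    then have "cmod (ss z w ^ a * tt z w powi ee a) *
        cmod ((of_nat (a + 1) + (of_nat m - of_nat (a + 1)) * uu z w) / (1 - uu z w)\<^sup>2) * cmod (hh a (tt z w))
        \<le> Q * (real m / U) * (real m / V)"
      unfolding Q_def V_def using UV
      by (intro mult_mono cmod_ss_tt_le[OF z w] cmod_hh_le[OF z w]) auto
    then show ?thesis by (simp only: norm_mult)
  qed
  have "cmod (B z w) \<le> (\<Sum>a<m. Q * (real m / U) * (real m / V)) / (real m * pi\<^sup>2)"
  proof -
    have abs: "\<bar>real m * pi\<^sup>2\<bar> = real m * pi\<^sup>2" by simp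
    show ?thesis
      unfolding B_def norm_divide norm_of_real abs
      by (intro divide_right_mono sum_norm_le le) auto
  qed
  also have "\<dots> = Q * (real m / U) * (real m / V) / pi\<^sup>2"
    using m_pos by simp
  also have "\<dots> \<le> Q * (real m / U) * (real m / V) / 1"
  proof (rule divide_left_mono)
    show "1 \<le> pi\<^sup>2" using pi_ge_two by (intro one_le_power) linarith
  qed (use Q UV in auto)
  also have "\<dots> = real m ^ 2 * Q * cmod (1 - uu z w) powr (-2) * cmod (1 - tt z w) powr (-2)"
    using neq by (simp add: U_def V_def powr_minus powr_numeral power2_eq_square field_simps)
  finally show ?thesis by (simp add: Q_def)
qed

text \<open>Raising a by m k lowers \<open>ee\<close> by n k, which amounts to multiplication by
  \<open>uu z w ^ k\<close>; \<open>hh\<close> is unchanged by the periodicity of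
  \<open>jj\<close>.\<close>

lemma bterm_shift:
  assumes z: "z \<in> H" and w: "w \<in> H"
  shows "bterm (a + m * k) z w
    = of_nat (a + m * k + 1) * (ss z w ^ a * tt z w powi ee a * uu z w ^ k * hh a (tt z w))"
proof -
  define N where "N = a + m * k + 1"
  have uu: "uu z w ^ k = ss z w ^ (m * k) / tt z w ^ (n * k)"
    by (simp add: uu_def ss_def tt_def power_divide flip: power_mult)
  have hh: "hh (a + m * k) = hh a"
    by (simp add: hh_def fun_eq_iff jj_shift)
  have tt: "tt z w powi ee (a + m * k) = tt z w powi ee a / tt z w ^ (n * k)"
    unfolding ee_shift using tt_nonzero[OF z w] by (simp add: power_int_diff del: of_nat_mult)
  have "bterm (a + m * k) z w = of_nat N * (ss z w ^ a * ss z w ^ (m * k)) * (tt z w powi ee a / tt z w ^ (n * k)) * hh a (tt z w)"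
    by (simp only: bterm_def hh tt power_add N_def)
  also have "\<dots> = of_nat N * (ss z w ^ a * tt z w powi ee a * uu z w ^ k * hh a (tt z w))"
    by (simp add: uu mult_ac)
  finally show ?thesis unfolding N_def .
qed

lemma B_expansion:
  assumes z: "z \<in> H" and w: "w \<in> H"
  shows "(\<lambda>k. \<Sum>a<m. bterm (a + m * k) z w) sums (of_real (real m * pi\<^sup>2) * B z w)"
proof -
  have bt: "bterm (a + m * k) z w = ss z w ^ a * tt z w powi ee a * ((of_nat (a + 1) + of_nat m * of_nat k) * uu z w ^ k) * hh a (tt z w)" for a k
    unfolding bterm_shift[OF z w] by (simp add: mult_ac)
  have "(\<lambda>k. \<Sum>a<m. bterm (a + m * k) z w) sums (\<Sum>a<m. ss z w ^ a * tt z w powi ee a *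
      ((of_nat (a + 1) + (of_nat m - of_nat (a + 1)) * uu z w) / (1 - uu z w)\<^sup>2) * hh a (tt z w))"
    unfolding bt
    by (intro sums_sum sums_mult sums_mult2 affine_geometric_sums cmod_uu_lt_1 z w)
  then show ?thesis using m_pos by (simp add: B_def)
qed

lemma integrable_snd_powr:
  assumes "c + 2 * real n / real m > -2"
  shows "integrable MH (\<lambda>w. cmod (snd w) powr c)"
  using nn_integral_snd_powr_finite[OF assms]
  by (intro integrableI_nonneg measurable_MH) auto

text \<open>After the slices are integrated the exponent is -2 + 2/m; the margin 2/m is the effect
  of \<open>jj\<close> \<ge> 1.\<close>

lemma integrable_kap_square: "integrable MH (\<lambda>w. cmod (snd w) powr (- 2 * kap))"
proof -
  have "- 2 * kap + 2 * real n / real m = - 2 + 2 / real m"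
    using m_pos by (simp add: kap_def field_simps)
  then show ?thesis
    using m_pos by (intro integrable_snd_powr) auto
qed

text \<open>Integrability against |w2|^(-\<open>kap\<close>) is what is asked of F; it holds on the
  Bergman space and for the cut off test functions of the necessity part. The series is dominated
  since |\<open>uu z w\<close>| \<le> \<open>om z\<close> < 1 uniformly in w, which gives the
  majorant (1 + k) \<open>om z ^ k\<close>.\<close>

lemma kernel_integral_sums:
  assumes z: "z \<in> H" and F[measurable]: "F \<in> borel_measurable MH"
    and int: "integrable MH (\<lambda>w. cmod (snd w) powr (- kap) * cmod (F w))"
  shows "(\<lambda>k. \<Sum>a<m. \<integral>w. bterm (a + m * k) z w * F w \<partial>MH) sums (of_real (real m * pi\<^sup>2) * (\<integral>w. B z w * F w \<partial>MH))"
    and "integrable MH (\<lambda>w. B z w * F w)"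
    and "\<And>a. integrable MH (\<lambda>w. bterm a z w * F w)"
proof -
  have [measurable]: "(\<lambda>w. B z w) \<in> borel_measurable MH" "\<And>a. (\<lambda>w. bterm a z w) \<in> borel_measurable MH"
    by (intro measurable_MH; measurable)+
  define K where "K = cmod (snd z) powr (- kap) * (real m / (1 - cmod (snd z))\<^sup>2)"
  have K: "K \<ge> 0" by (simp add: K_def)
  have z1: "1 - cmod (snd z) > 0" using snd_less_1[OF z] by simp
  have bt0: "cmod (bterm a z w) \<le> real (a + 1) * K * cmod (snd w) powr (- kap)" if w: "w \<in> H" for a w
  proof -
    have "cmod (bterm a z w) = real (a + 1) * (cmod (ss z w ^ a * tt z w powi ee a) * cmod (hh a (tt z w)))"
      by (simp only: bterm_def norm_mult norm_of_nat mult.assoc)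
    also have "\<dots> \<le> real (a + 1) * ((cmod (snd z) powr (- kap) * cmod (snd w) powr (- kap)) * (real m / (1 - cmod (snd z))\<^sup>2))"
    proof (intro mult_left_mono mult_mono cmod_ss_tt_le z w order_trans[OF cmod_hh_le])
      show "real m / (cmod (1 - tt z w))\<^sup>2 \<le> real m / (1 - cmod (snd z))\<^sup>2"
        using one_minus_tt[OF z w] z1 by (intro divide_left_mono power_mono) (auto intro!: mult_pos_pos)
    qed auto
    finally show ?thesis by (simp add: K_def mult_ac)
  qed
  show *: "integrable MH (\<lambda>w. bterm a z w * F w)" for a
  proof (rule Bochner_Integration.integrable_bound[OF integrable_mult_right[OF int, of "real (a + 1) * K"]])
    show "AE w in MH. norm (bterm a z w * F w) \<le> norm (real (a + 1) * K * (cmod (snd w) powr (- kap) * cmod (F w)))"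
    proof (intro AE_I2)
      fix w assume "w \<in> space MH"
      then have "w \<in> H" by simp
      from mult_right_mono[OF bt0[OF this], of "cmod (F w)" a] K
      show "norm (bterm a z w * F w) \<le> norm (real (a + 1) * K * (cmod (snd w) powr (- kap) * cmod (F w)))"
        by (simp add: norm_mult mult.assoc abs_mult)
    qed
  qed measurable
  define f where "f k w = (\<Sum>a<m. bterm (a + m * k) z w) * F w" for k w
  have sumK: "summable (\<lambda>k. real m * (real m * K) * ((1 + real k) * om z ^ k))"
  proof -
    have "(\<lambda>l. (1 + 1 * of_nat l) * (of_real (om z) :: complex) ^ l) sums
      ((1 + (1 - 1) * of_real (om z)) / (1 - of_real (om z))\<^sup>2)"
      by (rule affine_geometric_sums) (use om_less_1[OF z] in auto)
    then have "summable (\<lambda>l. of_real ((1 + real l) * om z ^ l) :: complex)"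
      by (simp add: sums_iff)
    then show ?thesis by (subst (asm) summable_complex_of_real) (rule summable_mult)
  qed
  have bt: "cmod (bterm (a + m * k) z w) \<le> real m * K * ((1 + real k) * om z ^ k) * cmod (snd w) powr (- kap)"
    if w: "w \<in> H" and a: "a < m" for a k w
  proof -
    note bterm_shift[OF z w]
    then have "cmod (bterm (a + m * k) z w) = real (a + m * k + 1) * (cmod (ss z w ^ a * tt z w powi ee a) * cmod (uu z w) ^ k * cmod (hh a (tt z w)))"
      by (simp only: norm_mult norm_of_nat norm_power)
    also have "\<dots> \<le> real (m + m * k) * ((cmod (snd z) powr (- kap) * cmod (snd w) powr (- kap)) * om z ^ k * (real m / (1 - cmod (snd z))\<^sup>2))"
    proof (intro mult_mono cmod_ss_tt_le z w order_trans[OF cmod_hh_le] power_mono cmod_uu_less)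
      show "real m / (cmod (1 - tt z w))\<^sup>2 \<le> real m / (1 - cmod (snd z))\<^sup>2"
        using one_minus_tt[OF z w] z1 by (intro divide_left_mono power_mono) (auto intro!: mult_pos_pos)
      show "real (a + m * k + 1) \<le> real (m + m * k)" using a by simp
    qed auto
    also have "\<dots> = real m * K * ((1 + real k) * om z ^ k) * cmod (snd w) powr (- kap)"
      by (simp add: K_def algebra_simps)
    finally show ?thesis .
  qed
  have sums: "(\<lambda>k. \<integral>w. f k w \<partial>MH) sums (\<integral>w. (\<Sum>k. f k w) \<partial>MH)" and int2: "integrable MH (\<lambda>w. \<Sum>k. f k w)"
  proof -
    have fm: "f k \<in> borel_measurable MH" for k unfolding f_def[abs_def] by measurable
    have le: "norm (f k w) \<le> real m * (real m * K) * ((1 + real k) * om z ^ k) * (cmod (snd w) powr (- kap) * cmod (F w))"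
      if "w \<in> space MH" for k w
    proof -
      have w: "w \<in> H" using that by simp
      have "norm (\<Sum>a<m. bterm (a + m * k) z w) \<le> (\<Sum>a<m. real m * K * ((1 + real k) * om z ^ k) * cmod (snd w) powr (- kap))"
        by (intro sum_norm_le bt w) auto
      then have "norm (f k w) \<le> (\<Sum>a<m. real m * K * ((1 + real k) * om z ^ k) * cmod (snd w) powr (- kap)) * cmod (F w)"
        unfolding f_def norm_mult by (intro mult_right_mono) auto
      then show ?thesis by (simp add: mult_ac)
    qed
    show "(\<lambda>k. \<integral>w. f k w \<partial>MH) sums (\<integral>w. (\<Sum>k. f k w) \<partial>MH)" "integrable MH (\<lambda>w. \<Sum>k. f k w)"
      using integral_sums_dominated[OF fm int sumK le] by auto
  qed
  have eq: "(\<Sum>k. f k w) = of_real (real m * pi\<^sup>2) * (B z w * F w)" if "w \<in> H" for w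
    using sums_mult2[OF B_expansion[OF z that], of "F w"] by (simp add: f_def sums_iff)
  have "integrable MH (\<lambda>w. of_real (real m * pi\<^sup>2) * (B z w * F w))"
    using int2 by (rule Bochner_Integration.integrable_cong[THEN iffD1, rotated 2]) (auto simp: eq)
  from integrable_mult_right[OF this, of "inverse (of_real (real m * pi\<^sup>2))"] m_pos
  show "integrable MH (\<lambda>w. B z w * F w)"
    unfolding mult.assoc[symmetric] by (subst (asm) left_inverse) (auto simp del: of_real_mult)
  have "(\<integral>w. (\<Sum>k. f k w) \<partial>MH) = (\<integral>w. of_real (real m * pi\<^sup>2) * (B z w * F w) \<partial>MH)"
    by (intro Bochner_Integration.integral_cong) (auto simp: eq)
  moreover have "(\<integral>w. f k w \<partial>MH) = (\<Sum>a<m. \<integral>w. bterm (a + m * k) z w * F w \<partial>MH)" for k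
    unfolding f_def sum_distrib_right by (rule Bochner_Integration.integral_sum) (rule *)
  ultimately show "(\<lambda>k. \<Sum>a<m. \<integral>w. bterm (a + m * k) z w * F w \<partial>MH) sums (of_real (real m * pi\<^sup>2) * (\<integral>w. B z w * F w \<partial>MH))"
    using sums by simp
qed

lemma B_holomorphic2:
  assumes z: "z \<in> H"
  shows "(\<lambda>w. B w z) holomorphic2_on H"
  unfolding holomorphic2_on_iff
proof
  fix w assume w: "w \<in> H"
  have "1 - uu w z \<noteq> 0" "1 - tt w z \<noteq> 0" "tt w z \<noteq> 0" "snd w \<noteq> 0" "snd z \<noteq> 0"
    using cmod_uu_lt_1[OF w z] cmod_tt_lt_1[OF w z] tt_nonzero[OF w z] snd_nonzero w z by auto
  then show "holomorphic2_at (\<lambda>w. B w z) w"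
    using m_pos unfolding B_def hh_def uu_def ss_def tt_def
    by (intro holomorphic2_intros) auto
qed

subsection \<open>The reproducing property\<close>

lemma bergman_spaceD:
  assumes "f \<in> bergman_space H"
  shows "f holomorphic2_on H" "continuous_on H f" "f \<in> borel_measurable MH"
    and "integrable MH (\<lambda>w. (cmod (f w))\<^sup>2)"
proof -
  show 1: "f holomorphic2_on H"
    using assms by (simp add: bergman_space_def)
  then show "continuous_on H f" by (rule holomorphic2_on_imp_continuous_on)
  then show "f \<in> borel_measurable MH" by (rule continuous_on_H_measurable)
  have "cmod x powr 2 = (cmod x)\<^sup>2" for x
    by (cases "x = 0") (auto simp: powr_numeral)
  then show "integrable MH (\<lambda>w. (cmod (f w))\<^sup>2)"
    using assms by (simp add: bergman_space_def Lp_space_def)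
qed

section \<open>Taylor coefficients in the first variable\<close>

lemma slice1_holomorphic:
  assumes f: "f holomorphic2_on H" and y: "y \<in> ball 0 1 - {0}"
  shows "(\<lambda>x. f (x, y)) holomorphic_on ball 0 (rad y)"
proof (rule holomorphic_onI)
  fix x :: complex assume "x \<in> ball 0 (rad y)"
  with y have "(x, y) \<in> H" by (simp add: mem_H_rad)
  then obtain D where D: "(f has_derivative D) (at (x, y))" "\<And>c u v. D (c * u, c * v) = c * D (u, v)"
    using f unfolding holomorphic2_on_def by blast
  have "((\<lambda>x. (x, y)) has_derivative (\<lambda>h. (h, 0))) (at x)"
    by (auto intro!: derivative_eq_intros)
  from has_derivative_compose[OF this D(1)]
  have "((\<lambda>x. f (x, y)) has_derivative (\<lambda>h. D (h, 0))) (at x)" .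
  moreover have "D (h, 0) = D (1, 0) * h" for h
    using D(2)[of h 1 0] by (simp add: mult.commute)
  ultimately have "((\<lambda>x. f (x, y)) has_field_derivative D (1, 0)) (at x)"
    unfolding has_field_derivative_def by (metis (no_types, lifting) ext)
  then show "(\<lambda>x. f (x, y)) field_differentiable at x within ball 0 (rad y)"
    using field_differentiable_at_within field_differentiable_def by blast
qed

lemma slice2_holomorphic:
  assumes f: "f holomorphic2_on H" and S: "\<And>y. y \<in> S \<Longrightarrow> (x, y) \<in> H"
  shows "(\<lambda>y. f (x, y)) holomorphic_on S"
proof (rule holomorphic_onI)
  fix y assume "y \<in> S"
  with S have "(x, y) \<in> H" by blast
  then obtain D where D: "(f has_derivative D) (at (x, y))" "\<And>c u v. D (c * u, c * v) = c * D (u, v)"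
    using f unfolding holomorphic2_on_def by blast
  have "((\<lambda>y. (x, y)) has_derivative (\<lambda>h. (0, h))) (at y)"
    by (auto intro!: derivative_eq_intros)
  from has_derivative_compose[OF this D(1)]
  have "((\<lambda>y. f (x, y)) has_derivative (\<lambda>h. D (0, h))) (at y)" .
  moreover have "D (0, h) = D (0, 1) * h" for h
    using D(2)[of h 0 1] by (simp add: mult.commute)
  ultimately have "((\<lambda>y. f (x, y)) has_field_derivative D (0, 1)) (at y)"
    unfolding has_field_derivative_def by (metis (no_types, lifting) ext)
  then show "(\<lambda>y. f (x, y)) field_differentiable at y within S"
    using field_differentiable_at_within field_differentiable_def by blast
qed

definition taylor_coeff :: "(complex \<times> complex \<Rightarrow> complex) \<Rightarrow> nat \<Rightarrow> complex \<Rightarrow> complex" where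
  "taylor_coeff f a y = (deriv ^^ a) (\<lambda>x. f (x, y)) 0 / fact a"

lemma taylor_coeff_sums:
  assumes f: "f holomorphic2_on H" and xy: "(x, y) \<in> H"
  shows "(\<lambda>a. taylor_coeff f a y * x ^ a) sums f (x, y)"
  using holomorphic_power_series[OF slice1_holomorphic[OF f], of y x] xy
  by (simp add: taylor_coeff_def mem_H_rad)

text \<open>By induction on \<open>a\<close>: the \<open>a\<close>-th coefficient is the locally uniform limit, as \<open>x \<rightarrow> 0\<close>, of the
  Taylor remainder of order \<open>a\<close> divided by \<open>x\<^sup>a\<close>.\<close>

lemma taylor_coeff_differentiable:
  assumes f: "f holomorphic2_on H" and y0: "y0 \<in> ball 0 1 - {0}"
  shows "taylor_coeff f a field_differentiable at y0"
  using y0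
proof (induction a arbitrary: y0 rule: less_induct)
  case (less a)
  \<comment> \<open>Keeps the closed disc about y0 inside the punctured unit disc with |y| \<ge>
    |y0|/2, so that the slices over it share a disc of radius 2 \<rho>, with \<rho> as defined
    below.\<close>
  define \<delta> where "\<delta> = min (cmod y0 / 2) ((1 - cmod y0) / 2)"
  have \<delta>: "\<delta> > 0" using less.prems by (auto simp: \<delta>_def)
  have near: "cmod y0 / 2 \<le> cmod y \<and> cmod y < 1" if "y \<in> cball y0 \<delta>" for y
  proof -
    have "cmod (y0 - y) \<le> \<delta>" using that by (simp add: dist_norm)
    moreover have "cmod y0 - cmod y \<le> cmod (y0 - y)" "cmod y - cmod y0 \<le> cmod (y0 - y)"
      using norm_triangle_ineq2[of y0 y] norm_triangle_ineq2[of y y0] by (auto simp: norm_minus_commute)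
    moreover have "\<delta> \<le> cmod y0 / 2" "\<delta> \<le> (1 - cmod y0) / 2"
      unfolding \<delta>_def by (rule min.cobounded1, rule min.cobounded2)
    moreover have "cmod y0 < 1" using less.prems by simp
    ultimately show ?thesis by (simp add: field_simps)
  qed
  have near': "y \<in> ball 0 1 - {0}" if "y \<in> cball y0 \<delta>" for y
    using near[OF that] less.prems by auto
  define \<rho> where "\<rho> = (cmod y0 / 2) powr (real n / real m) / 2"
  have \<rho>: "\<rho> > 0" using less.prems by (simp add: \<rho>_def)
  have rad: "\<rho> < rad y" if "y \<in> cball y0 \<delta>" for y
  proof -
    have "2 * \<rho> \<le> rad y"
      unfolding \<rho>_def rad_def using near[OF that] by (simp add: powr_mono2)
    then show ?thesis using \<rho> by simp
  qed
  have inH: "(x, y) \<in> H" if "x \<in> cball 0 \<rho>" "y \<in> cball y0 \<delta>" for x y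
    using near'[OF that(2)] rad[OF that(2)] that(1) by (simp add: mem_H_rad)
  have "compact (f ` (cball 0 \<rho> \<times> cball y0 \<delta>))"
  proof (rule compact_continuous_image)
    show "continuous_on (cball 0 \<rho> \<times> cball y0 \<delta>) f"
      by (rule continuous_on_subset[OF holomorphic2_on_imp_continuous_on[OF f]]) (use inH in auto)
  qed (intro compact_Times compact_cball)
  then have "bounded (f ` (cball 0 \<rho> \<times> cball y0 \<delta>))"
    by (rule compact_imp_bounded)
  then obtain S where S': "\<And>w. w \<in> f ` (cball 0 \<rho> \<times> cball y0 \<delta>) \<Longrightarrow> cmod w \<le> S"
    by (auto simp only: bounded_iff)
  have S: "cmod (f (x, y)) \<le> S" if "x \<in> cball 0 \<rho>" "y \<in> cball y0 \<delta>" for x y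
    using that by (intro S' imageI SigmaI)
  have tc_le: "cmod (taylor_coeff f j y) \<le> S / \<rho> ^ j" if y: "y \<in> cball y0 \<delta>" for j y
  proof -
    have "cmod ((deriv ^^ j) (\<lambda>x. f (x, y)) 0) \<le> fact j * S / \<rho> ^ j"
    proof (rule Cauchy_inequality)
      have hol: "(\<lambda>x. f (x, y)) holomorphic_on ball 0 (rad y)"
        by (rule slice1_holomorphic[OF f near'[OF y]])
      show "(\<lambda>x. f (x, y)) holomorphic_on ball 0 \<rho>"
        by (rule holomorphic_on_subset[OF hol]) (use rad[OF y] in auto)
      show "continuous_on (cball 0 \<rho>) (\<lambda>x. f (x, y))"
        by (rule continuous_on_subset[OF holomorphic_on_imp_continuous_on[OF hol]]) (use rad[OF y] in auto)
      show "cmod (f (x, y)) \<le> S" if "cmod (0 - x) = \<rho>" for x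
        using that y by (intro S) auto
    qed (rule \<rho>)
    then show ?thesis
      by (simp add: taylor_coeff_def norm_divide field_simps)
  qed
  \<comment> \<open>The ratio \<open>xs N\<close> / \<rho> = 1/(N+2) is at most 1/2 and tends to 0,
    so Cauchy's estimates bound the Taylor tail by a geometric series of order 1/(N+1).\<close>
  define xs where "xs N = \<rho> / (real N + 2)" for N :: nat
  have xs: "xs N > 0" "xs N \<le> \<rho>" "xs N / \<rho> = 1 / (real N + 2)" for N
  proof -
    have "\<rho> / (real N + 2) \<le> \<rho> / 1"
      using \<rho> by (intro divide_left_mono) auto
    then show "xs N > 0" "xs N \<le> \<rho>" "xs N / \<rho> = 1 / (real N + 2)"
      using \<rho> by (simp_all add: xs_def)
  qed
  define g where "g N y = (f (of_real (xs N), y) - (\<Sum>j<a. taylor_coeff f j y * of_real (xs N) ^ j)) / of_real (xs N) ^ a" for N y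
  have g_hol: "g N holomorphic_on ball y0 \<delta>" for N
    unfolding g_def[abs_def]
  proof (intro holomorphic_on_divide holomorphic_on_diff holomorphic_on_sum holomorphic_on_mult holomorphic_on_const)
    show "(\<lambda>y. f (of_real (xs N), y)) holomorphic_on ball y0 \<delta>"
    proof (rule slice2_holomorphic[OF f])
      fix y assume "y \<in> ball y0 \<delta>"
      moreover have "complex_of_real (xs N) \<in> cball 0 \<rho>"
        using xs(1,2)[of N] by simp
      ultimately show "(complex_of_real (xs N), y) \<in> H"
        by (intro inH) simp_all
    qed
    show "taylor_coeff f j holomorphic_on ball y0 \<delta>" if "j \<in> {..<a}" for j
    proof (rule holomorphic_onI)
      fix y assume "y \<in> ball y0 \<delta>"
      then show "taylor_coeff f j field_differentiable at y within ball y0 \<delta>"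
        using that by (intro field_differentiable_at_within[OF less.IH] near') simp_all
    qed
    show "complex_of_real (xs N) ^ a \<noteq> 0" using xs(1)[of N] by simp
  qed
  have g_le: "cmod (g N y - taylor_coeff f a y) \<le> S / \<rho> ^ a * (1 / (real N + 1))" if y: "y \<in> cball y0 \<delta>" for N y
  proof -
    define x where "x = complex_of_real (xs N)"
    have x: "x \<noteq> 0" "x \<in> cball 0 \<rho>" "cmod x = xs N" using xs[of N] by (auto simp: x_def)
    from taylor_coeff_sums[OF f inH[OF x(2) y]]
    have "(\<lambda>i. taylor_coeff f (i + (a + 1)) y * x ^ (i + (a + 1))) sums (f (x, y) - (\<Sum>j<a + 1. taylor_coeff f j y * x ^ j))"
      by (rule sums_split_initial_segment)
    from sums_divide[OF this, of "x ^ a"]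
    have "(\<lambda>i. taylor_coeff f (i + (a + 1)) y * x ^ (i + 1)) sums (g N y - taylor_coeff f a y)"
      using x by (simp add: g_def x_def[symmetric] power_add diff_divide_distrib add_divide_distrib algebra_simps)
    moreover have "(\<lambda>i. S / \<rho> ^ a * (1 / (real N + 2)) * (1 / (real N + 2)) ^ i) sums (S / \<rho> ^ a * (1 / (real N + 2)) * (1 / (1 - 1 / (real N + 2))))"
      by (intro sums_mult geometric_sums) auto
    moreover have "norm (taylor_coeff f (i + (a + 1)) y * x ^ (i + 1)) \<le> S / \<rho> ^ a * (1 / (real N + 2)) * (1 / (real N + 2)) ^ i" for i
    proof -
      have "norm (taylor_coeff f (i + (a + 1)) y * x ^ (i + 1)) \<le> S / \<rho> ^ (i + (a + 1)) * xs N ^ (i + 1)"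
        unfolding norm_mult norm_power x(3) using xs(1)[of N] by (intro mult_right_mono tc_le y) auto
      also have "\<dots> = S / \<rho> ^ a * (xs N / \<rho>) ^ (i + 1)"
        by (simp add: power_add power_divide)
      finally show ?thesis by (simp add: xs(3) mult_ac)
    qed
    ultimately have "norm (g N y - taylor_coeff f a y) \<le> S / \<rho> ^ a * (1 / (real N + 2)) * (1 / (1 - 1 / (real N + 2)))"
      by (rule norm_sums_le)
    also have "\<dots> = S / \<rho> ^ a * (1 / (real N + 1))"
    proof -
      have "(1 / (real N + 2)) * (1 / (1 - 1 / (real N + 2))) = 1 / (real N + 1)"
        by (simp add: field_simps)
      then show ?thesis by (simp only: mult.assoc)
    qed
    finally show ?thesis .
  qed
  have lim: "uniform_limit (cball y0 \<delta>) g (taylor_coeff f a) sequentially"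
  proof (rule uniform_limitI)
    fix e :: real assume e: "e > 0"
    have "(\<lambda>N. S / \<rho> ^ a * (1 / (real N + 1))) \<longlonglongrightarrow> S / \<rho> ^ a * 0"
      using LIMSEQ_inverse_real_of_nat by (intro tendsto_mult tendsto_const) (simp add: inverse_eq_divide add.commute)
    then have "eventually (\<lambda>N. S / \<rho> ^ a * (1 / (real N + 1)) < e) sequentially"
      using e by (intro order_tendstoD) auto
    then show "\<forall>\<^sub>F N in sequentially. \<forall>y\<in>cball y0 \<delta>. dist (g N y) (taylor_coeff f a y) < e"
    proof eventually_elim
      case (elim N)
      show ?case
      proof
        fix y assume "y \<in> cball y0 \<delta>"
        from le_less_trans[OF g_le[OF this] elim] show "dist (g N y) (taylor_coeff f a y) < e"
          by (simp only: dist_norm)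
      qed
    qed
  qed
  have "taylor_coeff f a holomorphic_on ball y0 \<delta>"
  proof (rule holomorphic_uniform_sequence[OF _ g_hol])
    fix y assume "y \<in> ball y0 \<delta>"
    then obtain d where "0 < d" "cball y d \<subseteq> ball y0 \<delta>"
      by (meson open_ball open_contains_cball)
    moreover from this have "uniform_limit (cball y d) g (taylor_coeff f a) sequentially"
      using ball_subset_cball by (intro uniform_limit_on_subset[OF lim]) blast
    ultimately show "\<exists>d>0. cball y d \<subseteq> ball y0 \<delta> \<and> uniform_limit (cball y d) g (taylor_coeff f a) sequentially"
      by blast
  qed simp
  then show ?case
    using \<delta> by (intro holomorphic_on_imp_differentiable_at) auto
qed

lemma taylor_coeff_holomorphic:
  assumes "f holomorphic2_on H"
  shows "taylor_coeff f a holomorphic_on ball 0 1 - {0}"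
  using taylor_coeff_differentiable[OF assms] by (simp add: holomorphic_on_def field_differentiable_at_within)

text \<open>Supplies the hypothesis of \<open>kernel_integral_sums\<close> on the Bergman space:
  both factors are square integrable.\<close>

lemma integrable_kap_weight:
  assumes f: "f \<in> bergman_space H"
  shows "integrable MH (\<lambda>w. cmod (snd w) powr (- kap) * cmod (f w))"
proof (rule Bochner_Integration.integrable_bound)
  show "integrable MH (\<lambda>w. cmod (snd w) powr (- 2 * kap) + (cmod (f w))\<^sup>2)"
    by (intro Bochner_Integration.integrable_add integrable_kap_square bergman_spaceD(4)[OF f])
  have [measurable]: "(\<lambda>w. cmod (snd w) powr (- kap)) \<in> borel_measurable MH"
    by (intro measurable_MH) measurable
  show "(\<lambda>w. cmod (snd w) powr (- kap) * cmod (f w)) \<in> borel_measurable MH"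
    using bergman_spaceD(3)[OF f] by measurable
  show "AE w in MH. norm (cmod (snd w) powr (- kap) * cmod (f w)) \<le> norm (cmod (snd w) powr (- 2 * kap) + (cmod (f w))\<^sup>2)"
  proof (intro AE_I2)
    fix w :: "complex \<times> complex"
    define X where "X = cmod (snd w) powr (- kap)"
    have "cmod (snd w) powr (- 2 * kap) = X\<^sup>2"
      by (simp add: X_def power2_eq_square flip: powr_add)
    moreover have "X * cmod (f w) \<le> X\<^sup>2 + (cmod (f w))\<^sup>2"
    proof -
      have "2 * X * cmod (f w) \<le> X\<^sup>2 + (cmod (f w))\<^sup>2" by (rule sum_squares_bound)
      moreover have "0 \<le> X * cmod (f w)" by (simp add: X_def)
      ultimately show ?thesis by linarith
    qed
    ultimately have "cmod (snd w) powr (- kap) * cmod (f w) \<le> cmod (snd w) powr (- 2 * kap) + (cmod (f w))\<^sup>2"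
      by (simp only: X_def)
    then show "norm (cmod (snd w) powr (- kap) * cmod (f w)) \<le> norm (cmod (snd w) powr (- 2 * kap) + (cmod (f w))\<^sup>2)"
      by (simp add: abs_mult)
  qed
qed

text \<open>The left side is, up to a constant, the squared norm of x^a on the slice over w. Writing
  a coefficient as w^(\<open>ee a\<close>) G(w) therefore leaves |G|^2 with the weight
  |w|^(2\<beta>-2), \<beta> = \<open>jj a\<close> / m, which is the weight of
  \<open>weighted_disc_reproducing\<close>.\<close>

lemma rad_power_eq: "w \<noteq> 0 \<Longrightarrow> rad w powr (2 * real a + 2) = cmod w powr (2 * (real (jj a) / real m) - 2) / (cmod w powi ee a)\<^sup>2"
proof -
  assume w: "w \<noteq> 0"
  have "(cmod w powi ee a)\<^sup>2 = cmod w powr (2 * of_int (ee a))"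
  proof -
    have "cmod w powi ee a = cmod w powr of_int (ee a)"
      using w powr_real_of_int'[of "cmod w" "ee a"] by simp
    then show ?thesis
      by (simp add: power2_eq_square powr_add[symmetric])
  qed
  moreover have "real n * (2 * real a + 2) / real m = 2 * (real (jj a) / real m) - 2 - 2 * of_int (ee a)"
    using m_pos by (simp add: real_jj field_simps)
  ultimately show ?thesis
    using w by (simp add: rad_powr powr_diff[of "cmod w" _ "2 * of_int (ee a)"])
qed

lemma coefficient_integral:
  assumes y: "y \<in> ball 0 1 - {0}" and f: "f holomorphic2_on H"
    and int: "set_integrable lborel (ball 0 (rad y)) (\<lambda>x. f (x, y) * cnj x ^ a)"
  shows "(LINT x:ball 0 (rad y)|lborel. f (x, y) * cnj x ^ a)
    = taylor_coeff f a y * of_real (pi * rad y powr (2 * real a + 2) / (real a + 1))"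
proof -
  have "integrable lborel (indicator (ball (0::complex) (rad y)) :: _ \<Rightarrow> real)"
    by (rule integrable_real_indicator) (auto simp: emeasure_ball)
  then have "set_integrable lborel (ball (0::complex) (rad y)) (\<lambda>x. 1::real)"
    by (simp add: set_integrable_def)
  then have "(LINT x:ball 0 (rad y)|lborel. f (x, y) * cnj x ^ a * of_real ((\<lambda>_. 1) (cmod x)))
    = (deriv ^^ a) (\<lambda>x. f (x, y)) 0 / fact a * (LINT x:ball (0::complex) (rad y)|lborel. cmod x ^ (2 * a) * (\<lambda>_. 1) (cmod x))"
    using int by (intro set_integral_disc_coeff slice1_holomorphic[OF f y]) auto
  also have "(LINT x:ball (0::complex) (rad y)|lborel. cmod x ^ (2 * a) * (\<lambda>_. 1) (cmod x))
    = (LINT x:ball (0::complex) (rad y)|lborel. cmod x powr (2 * real a))"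
  proof (rule set_lebesgue_integral_cong_AE)
    have "AE x in lborel. x \<noteq> (0::complex)" by (rule AE_lborel_singleton)
    then show "AE x\<in>ball (0::complex) (rad y) in lborel. cmod x ^ (2 * a) * 1 = cmod x powr (2 * real a)"
      by eventually_elim (simp flip: powr_realpow)
  qed auto
  also have "\<dots> = 2 * pi * rad y powr (2 * real a + 2) / (2 * real a + 2)"
    by (rule set_integrable_disc_powr) auto
  also have "\<dots> = pi * rad y powr (2 * real a + 2) / (real a + 1)"
    by (simp add: field_simps)
  finally show ?thesis by (simp add: taylor_coeff_def)
qed

text \<open>Bessel's inequality for a single monomial on a slice. Integrating F X \<le> (T/2) X^2 +
  F^2/(2T), with T the modulus of the coefficient, takes the place of the Cauchy-Schwarz
  inequality.\<close>

lemma coefficient_L2: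
  assumes y: "y \<in> ball 0 1 - {0}" and f: "f holomorphic2_on H"
    and int: "set_integrable lborel (ball 0 (rad y)) (\<lambda>x. f (x, y) * cnj x ^ a)"
  shows "ennreal ((cmod (taylor_coeff f a y))\<^sup>2 * (pi * rad y powr (2 * real a + 2) / (real a + 1)))
    \<le> (\<integral>\<^sup>+x. ennreal ((cmod (f (x, y)))\<^sup>2) * indicator (ball 0 (rad y)) x \<partial>lborel)"
proof (cases "taylor_coeff f a y = 0")
  case False
  define T where "T = cmod (taylor_coeff f a y)"
  define K where "K = pi * rad y powr (2 * real a + 2) / (real a + 1)"
  define J where "J = (\<integral>\<^sup>+x. ennreal ((cmod (f (x, y)))\<^sup>2) * indicator (ball 0 (rad y)) x \<partial>lborel)"
  have T: "T > 0" using False by (simp add: T_def)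
  have K: "K \<ge> 0" by (simp add: K_def)
  have K_eq: "(\<integral>\<^sup>+x. ennreal (cmod x powr (2 * real a)) * indicator (ball (0::complex) (rad y)) x \<partial>lborel) = ennreal K"
  proof -
    have "2 * pi * rad y powr (2 * real a + 2) / (2 * real a + 2) = K"
      by (simp add: K_def field_simps)
    then show ?thesis by (subst nn_integral_cmod_powr) auto
  qed
  have hol: "(\<lambda>x. f (x, y)) holomorphic_on ball 0 (rad y)" by (rule slice1_holomorphic[OF f y])
  have [measurable]: "(\<lambda>x. ennreal ((cmod (f (x, y)))\<^sup>2) * indicator (ball 0 (rad y)) x) \<in> borel_measurable borel"
  proof -
    have "(\<lambda>x. indicator (ball 0 (rad y)) x *\<^sub>R f (x, y)) \<in> borel_measurable borel"
      by (intro borel_measurable_continuous_on_indicator holomorphic_on_imp_continuous_on[OF hol]) auto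
    then have "(\<lambda>x. ennreal ((cmod (indicator (ball 0 (rad y)) x *\<^sub>R f (x, y)))\<^sup>2)) \<in> borel_measurable borel"
      by measurable
    also have "(\<lambda>x. ennreal ((cmod (indicator (ball 0 (rad y)) x *\<^sub>R f (x, y)))\<^sup>2)) = (\<lambda>x. ennreal ((cmod (f (x, y)))\<^sup>2) * indicator (ball 0 (rad y)) x)"
      by (auto simp: fun_eq_iff indicator_def)
    finally show ?thesis .
  qed
  have "ennreal (T * K) = ennreal (norm (LINT x:ball 0 (rad y)|lborel. f (x, y) * cnj x ^ a))"
    unfolding coefficient_integral[OF assms] using K by (simp add: norm_mult T_def K_def del: of_real_mult of_real_divide)
  also have "\<dots> \<le> (\<integral>\<^sup>+x. ennreal (norm (indicator (ball 0 (rad y)) x *\<^sub>R (f (x, y) * cnj x ^ a))) \<partial>lborel)"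
    unfolding set_lebesgue_integral_def using int
    by (intro integral_norm_bound_ennreal) (simp add: set_integrable_def)
  also have "\<dots> \<le> (\<integral>\<^sup>+x. ennreal (T / 2) * (ennreal (cmod x powr (2 * real a)) * indicator (ball 0 (rad y)) x)
      + ennreal (1 / (2 * T)) * (ennreal ((cmod (f (x, y)))\<^sup>2) * indicator (ball 0 (rad y)) x) \<partial>lborel)"
  proof (intro nn_integral_mono_AE)
    have "AE x in lborel. x \<noteq> (0::complex)" by (rule AE_lborel_singleton)
    then show "AE x in lborel. ennreal (norm (indicator (ball 0 (rad y)) x *\<^sub>R (f (x, y) * cnj x ^ a)))
      \<le> ennreal (T / 2) * (ennreal (cmod x powr (2 * real a)) * indicator (ball 0 (rad y)) x)
      + ennreal (1 / (2 * T)) * (ennreal ((cmod (f (x, y)))\<^sup>2) * indicator (ball 0 (rad y)) x)"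
    proof eventually_elim
      case (elim x)
      define F X where "F = cmod (f (x, y))" and "X = cmod x ^ a"
      have X2: "cmod x powr (2 * real a) = X\<^sup>2"
        using elim powr_realpow[of "cmod x" "2 * a"] by (simp add: X_def power_mult mult.commute flip: power_mult)
      have "0 \<le> (T * X - F)\<^sup>2" by simp
      then have "2 * (T * (F * X)) \<le> T\<^sup>2 * X\<^sup>2 + F\<^sup>2"
        by (simp add: power2_eq_square algebra_simps)
      then have "F * X \<le> T / 2 * X\<^sup>2 + 1 / (2 * T) * F\<^sup>2"
        using T by (simp add: field_simps power2_eq_square)
      then have "ennreal (F * X) \<le> ennreal (T / 2) * ennreal (X\<^sup>2) + ennreal (1 / (2 * T)) * ennreal (F\<^sup>2)"
      proof -
        have "ennreal (T / 2) * ennreal (X\<^sup>2) + ennreal (1 / (2 * T)) * ennreal (F\<^sup>2) = ennreal (T / 2 * X\<^sup>2 + 1 / (2 * T) * F\<^sup>2)"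
          using T by (intro ennreal_mult_add_mult) auto
        with \<open>F * X \<le> _\<close> show ?thesis by (simp only: ennreal_leI)
      qed
      then show ?case
        by (auto simp: indicator_def norm_mult norm_power X2 simp flip: F_def X_def)
    qed
  qed
  also have "\<dots> = ennreal (T / 2) * ennreal K + ennreal (1 / (2 * T)) * J"
    by (simp add: nn_integral_add nn_integral_cmult K_eq J_def)
  finally have le: "ennreal (T * K) \<le> ennreal (T / 2) * ennreal K + ennreal (1 / (2 * T)) * J" .
  have "ennreal (T\<^sup>2 * K) \<le> J"
  proof (cases J)
    case (real j)
    with le T K have "ennreal (T * K) \<le> ennreal (T / 2 * K + 1 / (2 * T) * j)"
      by (simp add: ennreal_mult_add_mult)
    then have "T * K \<le> T / 2 * K + 1 / (2 * T) * j"
      using T K real by (subst (asm) ennreal_le_iff) auto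
    then have "T\<^sup>2 * K \<le> j"
      using T by (simp add: field_simps power2_eq_square)
    then show ?thesis using real by (simp add: ennreal_leI)
  qed simp
  then show ?thesis by (simp add: T_def K_def J_def)
qed simp

lemma kernel_cancel:
  fixes N U V :: complex
  assumes "N \<noteq> 0" "U \<noteq> 0" "V \<noteq> 0"
  shows "N * A * (Z * V) * (M * P) * (E * U * (Q / N * (W / (U * V)))) = M * Q * A * Z * (E * W * P)"
proof -
  have "N * A * (Z * V) * (M * P) * (E * U * (Q / N * (W / (U * V)))) = (N / N) * (U / U) * (V / V) * (M * Q * A * Z * (E * W * P))"
    by (simp only: divide_inverse inverse_mult_distrib mult_ac)
  then show ?thesis using assms by simp
qed

text \<open>After division by \<open>y\<close> to the power \<open>ee a\<close> the coefficient is square integrable on the punctured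
  disc, so its singularity is removable.\<close>

lemma bterm_integral:
  assumes f: "f \<in> bergman_space H" and z: "z \<in> H"
  shows "(\<integral>w. bterm a z w * f w \<partial>MH) = of_real (real m * pi\<^sup>2) * (taylor_coeff f a (snd z) * fst z ^ a)"
proof -
  note fh = bergman_spaceD(1)[OF f]
  obtain z1 z2 where z12: "z = (z1, z2)" by (cases z)
  have z2: "z2 \<noteq> 0" "cmod z2 < 1" using z by (auto simp: z12 mem_H_rad)
  define D where "D = ball (0::complex) 1 - {0}"
  define e where "e = ee a"
  define \<beta> where "\<beta> = real (jj a) / real m"
  have \<beta>: "\<beta> > 0" "\<beta> \<le> 1" using jj_bounds[of a] m_pos by (auto simp: \<beta>_def)
  define K where "K y = pi * rad y powr (2 * real a + 2) / (real a + 1)" for y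
  have AE0: "AE y in lborel. y \<noteq> (0::complex)" by (rule AE_lborel_singleton)
  have int_a: "AE y in lborel. y \<in> D \<longrightarrow> set_integrable lborel (ball 0 (rad y)) (\<lambda>x. f (x, y) * cnj x ^ a)"
  proof -
    define F where "F w = f w * cnj (fst w) ^ a" for w
    have cF: "continuous_on H F" unfolding F_def
      by (intro continuous_intros bergman_spaceD(2)[OF f])
    have "integrable MH F"
    proof (rule Bochner_Integration.integrable_bound)
      show "integrable MH (\<lambda>w. 1 + (cmod (f w))\<^sup>2)"
        using finite_measure.integrable_const[OF finite_measure_MH] bergman_spaceD(4)[OF f]
        by (intro Bochner_Integration.integrable_add)
      show "AE w in MH. norm (F w) \<le> norm (1 + (cmod (f w))\<^sup>2)"
      proof (intro AE_I2)
        fix w assume "w \<in> space MH"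
        then have "w \<in> ball 0 1 \<times> ball 0 1" using H_subset by auto
        then have "cmod (fst w) ^ a \<le> 1" by (intro power_le_one) (auto simp: mem_Times_iff)
        then have "norm (F w) \<le> cmod (f w) * 1"
          unfolding F_def norm_mult norm_power complex_mod_cnj by (intro mult_left_mono) auto
        moreover have "2 * cmod (f w) \<le> 1 + (cmod (f w))\<^sup>2"
          using sum_squares_bound[of 1 "cmod (f w)"] by simp
        moreover have "0 \<le> cmod (f w)" by simp
        ultimately have "norm (F w) \<le> 1 + (cmod (f w))\<^sup>2" by linarith
        then show "norm (F w) \<le> norm (1 + (cmod (f w))\<^sup>2)" by simp
      qed
    qed (rule continuous_on_H_measurable[OF cF])
    from integral_MH_iterated(1)[OF continuous_on_H_measurable(1)[OF cF] this]
    show ?thesis by (simp add: F_def D_def)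
  qed
  define G where "G y = taylor_coeff f a y / y powi e" for y
  have G_hol: "G holomorphic_on ball 0 1 - {0}"
    unfolding G_def
    by (intro holomorphic_on_divide taylor_coeff_holomorphic[OF fh] holomorphic_on_power_int holomorphic_on_ident) auto
  have G_sq: "(cmod (G y))\<^sup>2 * cmod y powr (2 * \<beta> - 2) * (pi / (real a + 1)) = (cmod (taylor_coeff f a y))\<^sup>2 * K y" if "y \<in> D" for y
  proof -
    have y: "y \<noteq> 0" using that by (simp add: D_def)
    have "K y = pi * (cmod y powr (2 * \<beta> - 2) / (cmod y powi e)\<^sup>2) / (real a + 1)"
      unfolding K_def rad_power_eq[OF y] \<beta>_def e_def ..
    moreover have "(cmod (G y))\<^sup>2 = (cmod (taylor_coeff f a y))\<^sup>2 / (cmod y powi e)\<^sup>2"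
      by (simp only: G_def norm_divide norm_power_int power_divide)
    ultimately show ?thesis by simp
  qed
  \<comment> \<open>Integrating \<open>coefficient_L2\<close> over y bounds this by a multiple of
    the squared norm of f; \<open>G_sq\<close> identifies the weight.\<close>
  have fin: "(\<integral>\<^sup>+y. ennreal ((cmod (G y))\<^sup>2 * cmod y powr (2 * \<beta> - 2)) * indicator D y \<partial>lborel) < \<infinity>"
  proof -
    define g where "g w = ennreal ((cmod (indicator H w *\<^sub>R f w))\<^sup>2)" for w
    define C where "C = (real a + 1) / pi"
    have C: "C \<ge> 0" by (simp add: C_def)
    have [measurable]: "(\<lambda>w. indicator H w *\<^sub>R f w) \<in> borel_measurable borel"
      by (rule continuous_on_H_measurable[OF bergman_spaceD(2)[OF f]])
    have g[measurable]: "g \<in> borel_measurable borel"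
      unfolding g_def[abs_def] by measurable
    have "(\<integral>\<^sup>+y. ennreal ((cmod (G y))\<^sup>2 * cmod y powr (2 * \<beta> - 2)) * indicator D y \<partial>lborel)
      \<le> (\<integral>\<^sup>+y. (\<integral>\<^sup>+x. (ennreal C * g (x, y)) * indicator (ball 0 (rad y)) x \<partial>lborel) * indicator D y \<partial>lborel)"
    proof (intro nn_integral_mono_AE)
      show "AE y in lborel. ennreal ((cmod (G y))\<^sup>2 * cmod y powr (2 * \<beta> - 2)) * indicator D y
        \<le> (\<integral>\<^sup>+x. (ennreal C * g (x, y)) * indicator (ball 0 (rad y)) x \<partial>lborel) * indicator D y"
        using int_a
      proof eventually_elim
        case (elim y)
        show ?case
        proof (cases "y \<in> D")
          case True
          have "(\<integral>\<^sup>+x. ennreal ((cmod (f (x, y)))\<^sup>2) * indicator (ball 0 (rad y)) x \<partial>lborel)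
            = (\<integral>\<^sup>+x. g (x, y) * indicator (ball 0 (rad y)) x \<partial>lborel)"
            using True by (intro nn_integral_cong) (auto simp: indicator_def D_def mem_H_rad g_def)
          with coefficient_L2[OF _ fh, of y a] elim True
          have "ennreal ((cmod (taylor_coeff f a y))\<^sup>2 * K y) \<le> (\<integral>\<^sup>+x. g (x, y) * indicator (ball 0 (rad y)) x \<partial>lborel)"
            by (simp add: K_def D_def)
          then have "ennreal C * ennreal ((cmod (taylor_coeff f a y))\<^sup>2 * K y)
            \<le> ennreal C * (\<integral>\<^sup>+x. g (x, y) * indicator (ball 0 (rad y)) x \<partial>lborel)"
            by (rule mult_left_mono) simp
          also have "\<dots> = (\<integral>\<^sup>+x. (ennreal C * g (x, y)) * indicator (ball 0 (rad y)) x \<partial>lborel)"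
            unfolding mult.assoc by (rule nn_integral_cmult[symmetric]) measurable
          also have "ennreal C * ennreal ((cmod (taylor_coeff f a y))\<^sup>2 * K y) = ennreal ((cmod (G y))\<^sup>2 * cmod y powr (2 * \<beta> - 2))"
          proof -
            define X q where "X = (cmod (G y))\<^sup>2 * cmod y powr (2 * \<beta> - 2)" and "q = real a + 1"
            have "q > 0" "X \<ge> 0" by (auto simp: q_def X_def)
            then have "ennreal (q / pi) * ennreal (X * (pi / q)) = ennreal X"
              by (subst ennreal_mult[symmetric]) auto
            then show ?thesis
              unfolding C_def G_sq[OF True, symmetric] X_def q_def .
          qed
          finally show ?thesis using True by simp
        qed simp
      qed
    qed
    also have "\<dots> = (\<integral>\<^sup>+w. ennreal C * g w \<partial>MH)"
      unfolding D_def by (rule nn_integral_MH[symmetric]) measurable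
    also have "\<dots> = ennreal C * (\<integral>\<^sup>+w. g w \<partial>MH)"
      by (intro nn_integral_cmult measurable_MH g)
    also have "\<dots> < \<infinity>"
    proof -
      have "(\<integral>\<^sup>+w. ennreal ((cmod (indicator H w *\<^sub>R f w))\<^sup>2) \<partial>MH) = (\<integral>\<^sup>+w. ennreal ((cmod (f w))\<^sup>2) \<partial>MH)"
        by (intro nn_integral_cong) simp
      also have "\<dots> < \<infinity>"
        using bergman_spaceD(4)[OF f] by (simp add: integrable_iff_bounded)
      finally show ?thesis by (simp add: ennreal_mult_less_top g_def)
    qed
    finally show ?thesis .
  qed
  \<comment> \<open>Since \<beta> \<le> 1 the weight |y|^(2\<beta>-2) is at least 1 on the punctured
    disc, so the weighted bound implies the unweighted one that
    \<open>removable_singularity_L2\<close> asks for.\<close>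
  have "(\<integral>\<^sup>+y. indicator (ball 0 1) y * ennreal ((cmod (G y))\<^sup>2) \<partial>lborel) < \<infinity>"
  proof (rule le_less_trans[OF nn_integral_mono_AE fin])
    show "AE y in lborel. indicator (ball 0 1) y * ennreal ((cmod (G y))\<^sup>2) \<le> ennreal ((cmod (G y))\<^sup>2 * cmod y powr (2 * \<beta> - 2)) * indicator D y"
      using AE0
    proof eventually_elim
      case (elim y)
      show ?case
      proof (cases "y \<in> D")
        case True
        then have "cmod y powr (2 * \<beta> - 2) \<ge> 1"
          using \<beta> powr_mono'[of "2 * \<beta> - 2" 0 "cmod y"] by (simp add: D_def)
        then have "(cmod (G y))\<^sup>2 * 1 \<le> (cmod (G y))\<^sup>2 * cmod y powr (2 * \<beta> - 2)"
          by (intro mult_left_mono) auto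
        then show ?thesis using True by (auto simp: D_def intro!: ennreal_leI)
      qed (use elim in \<open>auto simp: D_def\<close>)
    qed
  qed
  from removable_singularity_L2[OF G_hol this]
  obtain E where E: "E holomorphic_on ball 0 1" "\<And>y. y \<in> D \<Longrightarrow> E y = G y"
    unfolding D_def by blast
  \<comment> \<open>From |E| \<le> |E|^2 + 1: the first term is \<open>fin\<close>, and the weight
    alone is integrable because \<beta> > 0.\<close>
  have E_int: "set_integrable lborel (ball 0 1) (\<lambda>y. E y * of_real (cmod y powr (2 * \<beta> - 2)))"
    unfolding set_integrable_def
  proof (rule integrableI_bounded)
    have "(\<lambda>y. indicator (ball 0 1) y *\<^sub>R E y) \<in> borel_measurable borel"
      by (intro borel_measurable_continuous_on_indicator holomorphic_on_imp_continuous_on[OF E(1)]) auto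
    then have "(\<lambda>y. (indicator (ball 0 1) y *\<^sub>R E y) * of_real (cmod y powr (2 * \<beta> - 2))) \<in> borel_measurable lborel"
      by measurable
    then show "(\<lambda>y. indicator (ball 0 1) y *\<^sub>R (E y * of_real (cmod y powr (2 * \<beta> - 2)))) \<in> borel_measurable lborel"
      by simp
    have "(\<integral>\<^sup>+y. ennreal (norm (indicator (ball 0 1) y *\<^sub>R (E y * of_real (cmod y powr (2 * \<beta> - 2))))) \<partial>lborel)
      \<le> (\<integral>\<^sup>+y. ennreal ((cmod (G y))\<^sup>2 * cmod y powr (2 * \<beta> - 2)) * indicator D y
          + ennreal (cmod y powr (2 * \<beta> - 2)) * indicator (ball 0 1) y \<partial>lborel)"
    proof (intro nn_integral_mono_AE)
      show "AE y in lborel. ennreal (norm (indicator (ball 0 1) y *\<^sub>R (E y * of_real (cmod y powr (2 * \<beta> - 2)))))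
         \<le> ennreal ((cmod (G y))\<^sup>2 * cmod y powr (2 * \<beta> - 2)) * indicator D y
          + ennreal (cmod y powr (2 * \<beta> - 2)) * indicator (ball 0 1) y"
        using AE0
      proof eventually_elim
        case (elim y)
        show ?case
        proof (cases "y \<in> D")
          case True
          define g where "g = cmod (G y)"
          define W where "W = cmod y powr (2 * \<beta> - 2)"
          have "2 * g \<le> 1 + g\<^sup>2" using sum_squares_bound[of 1 g] by simp
          moreover have "0 \<le> g" by (simp add: g_def)
          ultimately have "g \<le> g\<^sup>2 + 1" by simp
          then have "g * W \<le> (g\<^sup>2 + 1) * W" by (intro mult_right_mono) (auto simp: W_def)
          then have "ennreal (g * W) \<le> ennreal (g\<^sup>2 * W + W)" by (intro ennreal_leI) (simp add: algebra_simps)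
          also have "\<dots> = ennreal (g\<^sup>2 * W) + ennreal W" by (intro ennreal_plus) (auto simp: W_def)
          finally show ?thesis
            using True E(2)[OF True] by (simp add: D_def norm_mult g_def W_def)
        qed (use elim in \<open>auto simp: D_def\<close>)
      qed
    qed
    also have "\<dots> = (\<integral>\<^sup>+y. ennreal ((cmod (G y))\<^sup>2 * cmod y powr (2 * \<beta> - 2)) * indicator D y \<partial>lborel)
       + (\<integral>\<^sup>+y. ennreal (cmod y powr (2 * \<beta> - 2)) * indicator (ball (0::complex) 1) y \<partial>lborel)"
    proof (rule nn_integral_add)
      have "(\<lambda>y. indicator D y *\<^sub>R G y) \<in> borel_measurable borel"
        unfolding D_def by (intro borel_measurable_continuous_on_indicator holomorphic_on_imp_continuous_on[OF G_hol]) auto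
      then have "(\<lambda>y. ennreal ((cmod (indicator D y *\<^sub>R G y))\<^sup>2 * cmod y powr (2 * \<beta> - 2))) \<in> borel_measurable borel"
        by measurable
      also have "(\<lambda>y. ennreal ((cmod (indicator D y *\<^sub>R G y))\<^sup>2 * cmod y powr (2 * \<beta> - 2)))
        = (\<lambda>y. ennreal ((cmod (G y))\<^sup>2 * cmod y powr (2 * \<beta> - 2)) * indicator D y)"
        by (auto simp: fun_eq_iff indicator_def)
      finally show "(\<lambda>y. ennreal ((cmod (G y))\<^sup>2 * cmod y powr (2 * \<beta> - 2)) * indicator D y) \<in> borel_measurable lborel"
        by simp
    qed measurable
    also have "\<dots> < \<infinity>"
      using fin \<beta> by (simp add: nn_integral_cmod_powr)
    finally show "(\<integral>\<^sup>+y. ennreal (norm (indicator (ball 0 1) y *\<^sub>R (E y * of_real (cmod y powr (2 * \<beta> - 2))))) \<partial>lborel) < \<infinity>" .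
  qed
  define c where "c y = of_nat (a + 1) * z1 ^ a * (z2 * cnj y) powi e * hh a (z2 * cnj y)" for y
  have contT: "continuous_on H (\<lambda>w. bterm a z w * f w)"
  proof (intro continuous_on_mult bergman_spaceD(2)[OF f])
    have nz: "snd z * cnj (snd w) \<noteq> 0" "(1 - snd z * cnj (snd w))\<^sup>2 \<noteq> 0" if "w \<in> H" for w
    proof -
      show "snd z * cnj (snd w) \<noteq> 0" using tt_nonzero[OF z that] by (simp only: tt_def not_False_eq_True)
      have "snd z * cnj (snd w) \<noteq> 1"
        using cmod_tt_lt_1[OF z that] by (metis norm_one less_irrefl tt_def)
      then show "(1 - snd z * cnj (snd w))\<^sup>2 \<noteq> 0" by simp
    qed
    have "continuous_on H (\<lambda>w. of_nat (a + 1) * (fst z * cnj (fst w)) ^ a * (snd z * cnj (snd w)) powi ee a *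
      ((of_nat (jj a) + (of_nat m - of_nat (jj a)) * (snd z * cnj (snd w))) / (1 - snd z * cnj (snd w))\<^sup>2))"
      by (intro continuous_on_mult continuous_on_const continuous_on_power continuous_on_power_int
          continuous_on_divide continuous_on_add continuous_on_diff continuous_on_cnj
          continuous_on_fst continuous_on_snd continuous_on_id) (use nz in blast)+
    then show "continuous_on H (bterm a z)"
      by (simp add: bterm_def[abs_def] ss_def tt_def hh_def)
  qed
  note I2 = integral_MH_iterated(2)[OF continuous_on_H_measurable(1)[OF contT] kernel_integral_sums(3)[OF z bergman_spaceD(3)[OF f] integrable_kap_weight[OF f]]]
  note I = integral_MH_iterated(3)[OF continuous_on_H_measurable(1)[OF contT] kernel_integral_sums(3)[OF z bergman_spaceD(3)[OF f] integrable_kap_weight[OF f]]]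
  \<comment> \<open>The inner integral extracts the a-th coefficient and leaves the weighted disc
    kernel in y. The powers y^e and its conjugate cancel against the slice norm, so what remains is
    the reproducing formula for E at \<open>z2\<close>.\<close>
  have "(\<integral>w. bterm a z w * f w \<partial>MH) = (LINT y:D|lborel. (LINT x:ball 0 (rad y)|lborel. bterm a z (x, y) * f (x, y)))"
    unfolding D_def by (rule I)
  also have "\<dots> = (LINT y:ball 0 1|lborel. of_nat m * of_real pi * z1 ^ a * z2 powi e *
      (E y * of_real (cmod y powr (2 * \<beta> - 2)) * ((of_real \<beta> + (1 - of_real \<beta>) * (z2 * cnj y)) / (1 - z2 * cnj y)\<^sup>2)))"
    unfolding set_lebesgue_integral_def[of _ D] set_lebesgue_integral_def[of _ "ball 0 1"]
  proof (rule integral_cong_AE)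
    show "AE y in lborel. indicator D y *\<^sub>R (LINT x:ball 0 (rad y)|lborel. bterm a z (x, y) * f (x, y))
      = indicator (ball 0 1) y *\<^sub>R (of_nat m * of_real pi * z1 ^ a * z2 powi e *
      (E y * of_real (cmod y powr (2 * \<beta> - 2)) * ((of_real \<beta> + (1 - of_real \<beta>) * (z2 * cnj y)) / (1 - z2 * cnj y)\<^sup>2)))"
      using int_a AE0
    proof eventually_elim
      case (elim y)
      show ?case
      proof (cases "y \<in> D")
        case True
        then have y: "y \<noteq> 0" "cmod y < 1" by (auto simp: D_def)
        have "(LINT x:ball 0 (rad y)|lborel. bterm a z (x, y) * f (x, y)) = (LINT x:ball 0 (rad y)|lborel. c y * (f (x, y) * cnj x ^ a))"
          by (simp add: bterm_def c_def ss_def tt_def z12 e_def power_mult_distrib mult_ac)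
        also have "\<dots> = c y * (taylor_coeff f a y * of_real (K y))"
          using coefficient_integral[OF _ fh, of y a] elim True by (simp add: D_def K_def)
        finally have 1: "(LINT x:ball 0 (rad y)|lborel. bterm a z (x, y) * f (x, y)) = c y * (taylor_coeff f a y * of_real (K y))" .
        have 2: "taylor_coeff f a y = E y * y powi e"
          using E(2)[OF True] y by (simp add: G_def)
        have 3: "K y = pi / (real a + 1) * (cmod y powr (2 * \<beta> - 2) / (cmod y powi e)\<^sup>2)"
          using y by (simp add: K_def rad_power_eq \<beta>_def e_def)
        define P where "P = (of_real \<beta> + (1 - of_real \<beta>) * (z2 * cnj y)) / (1 - z2 * cnj y)\<^sup>2"
        have 4: "hh a (z2 * cnj y) = of_nat m * P"
        proof -
          have mb: "of_nat m * complex_of_real \<beta> = of_nat (jj a)"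
            using m_pos by (simp add: \<beta>_def)
          have "of_nat m * (of_real \<beta> + (1 - of_real \<beta>) * (z2 * cnj y))
            = of_nat m * of_real \<beta> + (of_nat m - of_nat m * of_real \<beta>) * (z2 * cnj y)"
            by (simp add: algebra_simps)
          then show ?thesis
            unfolding mb by (simp add: hh_def P_def)
        qed
        have 5: "complex_of_real ((cmod y powi e)\<^sup>2) = y powi e * cnj y powi e"
          using complex_norm_square[of "y powi e"] by (simp only: norm_power_int cnj_powi)
        have ne: "y powi e \<noteq> 0" "cnj y powi e \<noteq> 0" "of_nat (a + 1) \<noteq> (0::complex)"
          using y of_nat_neq_0[of a, where 'a=complex] by (simp_all only: power_int_eq_0_iff complex_cnj_zero_iff Suc_eq_plus1 simp_thms not_False_eq_True)
        have ra: "real a + 1 = real (a + 1)" by simp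
        have Kc: "complex_of_real (K y) = of_real pi / of_nat (a + 1) * (of_real (cmod y powr (2 * \<beta> - 2)) / (y powi e * cnj y powi e))"
          unfolding 3 ra of_real_mult of_real_divide of_real_of_nat_eq 5 ..
        have "c y * (taylor_coeff f a y * of_real (K y)) = of_nat m * of_real pi * z1 ^ a * z2 powi e * (E y * of_real (cmod y powr (2 * \<beta> - 2)) * P)"
          unfolding c_def 2 4 Kc power_int_mult_distrib by (rule kernel_cancel[OF ne(3,1,2)])
        with 1 have "(LINT x:ball 0 (rad y)|lborel. bterm a z (x, y) * f (x, y))
          = of_nat m * of_real pi * z1 ^ a * z2 powi e * (E y * of_real (cmod y powr (2 * \<beta> - 2)) * P)" by (simp only:)
        then show ?thesis using True unfolding P_def by (simp add: D_def)
      qed (use elim in \<open>auto simp: D_def\<close>)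
    qed
    show "(\<lambda>y. indicator D y *\<^sub>R (LINT x:ball 0 (rad y)|lborel. bterm a z (x, y) * f (x, y))) \<in> borel_measurable lborel"
      using I2 unfolding set_integrable_def D_def by (rule borel_measurable_integrable)
    have [measurable]: "(\<lambda>y. indicator (ball 0 1) y *\<^sub>R E y) \<in> borel_measurable borel"
      by (intro borel_measurable_continuous_on_indicator holomorphic_on_imp_continuous_on[OF E(1)]) auto
    have "(\<lambda>y. of_nat m * of_real pi * z1 ^ a * z2 powi e *
      ((indicator (ball 0 1) y *\<^sub>R E y) * of_real (cmod y powr (2 * \<beta> - 2)) * ((of_real \<beta> + (1 - of_real \<beta>) * (z2 * cnj y)) / (1 - z2 * cnj y)\<^sup>2)))
      \<in> borel_measurable lborel"
      by measurable
    then show "(\<lambda>y. indicator (ball 0 1) y *\<^sub>R (of_nat m * of_real pi * z1 ^ a * z2 powi e *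
      (E y * of_real (cmod y powr (2 * \<beta> - 2)) * ((of_real \<beta> + (1 - of_real \<beta>) * (z2 * cnj y)) / (1 - z2 * cnj y)\<^sup>2)))) \<in> borel_measurable lborel"
      by (simp only: mult_scaleR_left mult_scaleR_right)
  qed
  also have "\<dots> = of_nat m * of_real pi * z1 ^ a * z2 powi e * (of_real pi * E z2)"
    by (simp only: set_integral_mult_right weighted_disc_reproducing[OF E(1) \<beta>(1) z2(2) E_int])
  also have "E z2 = taylor_coeff f a z2 / z2 powi e"
    using E(2)[of z2] z2 by (simp add: D_def G_def)
  finally have "(\<integral>w. bterm a z w * f w \<partial>MH) = of_nat m * of_real pi * z1 ^ a * z2 powi e * (of_real pi * (taylor_coeff f a z2 / z2 powi e))" .
  also have "\<dots> = of_real (real m * pi\<^sup>2) * (taylor_coeff f a z2 * z1 ^ a)"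
  proof -
    have "of_nat m * of_real pi * A * Z * (of_real pi * (T / Z)) = of_real (real m * pi\<^sup>2) * (T * A)"
      if "Z \<noteq> 0" for A Z T :: complex
      using that by (simp add: power2_eq_square)
    from this[of "z2 powi e"] show ?thesis using z2 by (simp only: power_int_not_zero not_False_eq_True simp_thms)
  qed
  finally show ?thesis by (simp only: z12 fst_conv snd_conv)
qed

end

lemma holomorphic2_at_cong_open:
  assumes "holomorphic2_at f z" "open S" "z \<in> S" "\<And>w. w \<in> S \<Longrightarrow> f w = g w"
  shows "holomorphic2_at g z"
proof -
  obtain D where D: "(f has_derivative D) (at z)" "\<And>c u v. D (c * u, c * v) = c * D (u, v)"
    using assms(1) by (auto simp: holomorphic2_at_def)
  have "(g has_derivative D) (at z)"
    using has_derivative_transform_within_open[OF D(1) assms(2,3)] assms(4) by blast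
  with D(2) show ?thesis unfolding holomorphic2_at_def by blast
qed

context hartogs
begin

text \<open>The kernel expansion yields the Taylor terms of f in z1; grouping the Taylor series into
  blocks of length m matches the two series. Completeness of the monomials in the Bergman space is
  not invoked.\<close>

theorem reproducing:
  assumes f: "f \<in> bergman_space H" and z: "z \<in> H"
  shows "(\<integral>w. B z w * f w \<partial>MH) = f z"
proof -
  define g where "g a = taylor_coeff f a (snd z) * fst z ^ a" for a
  define c where "c = complex_of_real (real m * pi\<^sup>2)"
  have c: "c \<noteq> 0" using m_pos by (simp add: c_def)
  have "g sums f z"
    using taylor_coeff_sums[OF bergman_spaceD(1)[OF f], of "fst z" "snd z"] z by (simp add: g_def[abs_def])
  from sums_group[OF this m_pos] have "(\<lambda>k. \<Sum>a<m. g (a + m * k)) sums f z"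
  proof (rule sums_cong[THEN iffD1, rotated])
    fix k
    have "{k * m..<k * m + m} = {0 + m * k..<m + m * k}" by (simp add: mult.commute add.commute)
    then show "sum g {k * m..<k * m + m} = (\<Sum>a<m. g (a + m * k))"
      by (simp only: sum.shift_bounds_nat_ivl lessThan_atLeast0)
  qed
  then have "(\<lambda>k. c * (\<Sum>a<m. g (a + m * k))) sums (c * f z)"
    by (rule sums_mult)
  moreover have "(\<lambda>k. c * (\<Sum>a<m. g (a + m * k))) sums (c * (\<integral>w. B z w * f w \<partial>MH))"
    using kernel_integral_sums(1)[OF z bergman_spaceD(3)[OF f] integrable_kap_weight[OF f]]
    unfolding bterm_integral[OF f z] c_def[symmetric] g_def sum_distrib_left[symmetric] .
  ultimately have "c * f z = c * (\<integral>w. B z w * f w \<partial>MH)"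
    by (rule sums_unique2)
  with c show ?thesis by simp
qed

section \<open>Identification of the Bergman kernel\<close>

lemma Lp_space_2_iff:
  "f \<in> Lp_space 2 MH \<longleftrightarrow> f \<in> borel_measurable MH \<and> integrable MH (\<lambda>w. (cmod (f w))\<^sup>2)"
proof -
  have "cmod x powr 2 = (cmod x)\<^sup>2" for x
    by (cases "x = 0") (auto simp: powr_numeral)
  then show ?thesis by (simp add: Lp_space_def)
qed

text \<open>The value 0 off \<open>H\<close> matches the normalization in
  \<open>bergman_representer\<close>. The order of arguments makes it holomorphic in w.\<close>

definition kernel_at :: "complex \<times> complex \<Rightarrow> complex \<times> complex \<Rightarrow> complex" where
  "kernel_at z w = (if w \<in> H then B w z else 0)"

text \<open>For fixed z in \<open>H\<close> both denominators stay away from 0, so the kernel is at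
  most a constant times |w2|^(-\<open>kap\<close>), which is square integrable.\<close>

lemma kernel_at_bergman_space:
  assumes z: "z \<in> H"
  shows "kernel_at z \<in> bergman_space H"
proof -
  have hol: "kernel_at z holomorphic2_on H"
    unfolding holomorphic2_on_iff
  proof
    fix w assume w: "w \<in> H"
    show "holomorphic2_at (kernel_at z) w"
      by (rule holomorphic2_at_cong_open[OF _ open_H w, of "\<lambda>w. B w z"])
        (use B_holomorphic2[OF z] w in \<open>auto simp: holomorphic2_on_iff kernel_at_def\<close>)
  qed
  have meas: "kernel_at z \<in> borel_measurable MH"
    by (rule continuous_on_H_measurable[OF holomorphic2_on_imp_continuous_on[OF hol]])
  define K where "K = real m ^ 2 * cmod (snd z) powr (- kap) * (1 - om z) powr (-2) * (1 - cmod (snd z)) powr (-2)"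
  have int: "integrable MH (\<lambda>w. K\<^sup>2 * cmod (snd w) powr (- 2 * kap))"
    by (intro integrable_mult_right integrable_kap_square)
  have "integrable MH (\<lambda>w. (cmod (kernel_at z w))\<^sup>2)"
  proof (rule Bochner_Integration.integrable_bound[OF int])
    show "(\<lambda>w. (cmod (kernel_at z w))\<^sup>2) \<in> borel_measurable MH" using meas by measurable
    show "AE w in MH. norm ((cmod (kernel_at z w))\<^sup>2) \<le> norm (K\<^sup>2 * cmod (snd w) powr (- 2 * kap))"
    proof (intro AE_I2)
      fix w assume "w \<in> space MH"
      then have w: "w \<in> H" by simp
      have u: "(cmod (1 - uu w z)) powr (-2) \<le> (1 - om z) powr (-2)"
        using one_minus_uu[OF z w] om_less_1[OF z] cmod_cnj_diff[of "uu z w"] unfolding uu_cnj[of w z]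
        by (intro powr_mono2') auto
      have t: "(cmod (1 - tt w z)) powr (-2) \<le> (1 - cmod (snd z)) powr (-2)"
        using one_minus_tt[OF z w] snd_less_1[OF z] cmod_cnj_diff[of "tt z w"] unfolding tt_cnj[of w z]
        by (intro powr_mono2') auto
      have "cmod (kernel_at z w) \<le> real m ^ 2 * (cmod (snd w) powr (- kap) * cmod (snd z) powr (- kap))
          * cmod (1 - uu w z) powr (-2) * cmod (1 - tt w z) powr (-2)"
        using cmod_B_le[OF w z] w by (simp add: kernel_at_def)
      also have "\<dots> \<le> real m ^ 2 * (cmod (snd w) powr (- kap) * cmod (snd z) powr (- kap))
          * (1 - om z) powr (-2) * (1 - cmod (snd z)) powr (-2)"
        by (intro mult_mono mult_nonneg_nonneg u t order_refl) auto
      also have "\<dots> = K * cmod (snd w) powr (- kap)"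
        by (simp add: K_def mult_ac)
      finally have "(cmod (kernel_at z w))\<^sup>2 \<le> (K * cmod (snd w) powr (- kap))\<^sup>2"
        by (rule power_mono) simp
      also have "\<dots> = K\<^sup>2 * cmod (snd w) powr (- 2 * kap)"
        by (simp add: power_mult_distrib power2_eq_square powr_add[symmetric])
      finally show "norm ((cmod (kernel_at z w))\<^sup>2) \<le> norm (K\<^sup>2 * cmod (snd w) powr (- 2 * kap))"
        by simp
    qed
  qed
  with hol meas show ?thesis by (simp add: bergman_space_def Lp_space_2_iff)
qed

lemma bergman_mult_integrable:
  assumes f: "f \<in> bergman_space H" and g: "g \<in> bergman_space H"
  shows "integrable MH (\<lambda>w. f w * cnj (g w))"
proof (rule Bochner_Integration.integrable_bound[OF Bochner_Integration.integrable_add[OF bergman_spaceD(4)[OF f] bergman_spaceD(4)[OF g]]])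
  show "(\<lambda>w. f w * cnj (g w)) \<in> borel_measurable MH"
    using bergman_spaceD(3)[OF f] bergman_spaceD(3)[OF g] by measurable
  show "AE w in MH. norm (f w * cnj (g w)) \<le> norm ((cmod (f w))\<^sup>2 + (cmod (g w))\<^sup>2)"
  proof (intro AE_I2)
    fix w
    have "2 * cmod (f w) * cmod (g w) \<le> (cmod (f w))\<^sup>2 + (cmod (g w))\<^sup>2" by (rule sum_squares_bound)
    moreover have "0 \<le> cmod (f w) * cmod (g w)" by simp
    ultimately have "cmod (f w) * cmod (g w) \<le> (cmod (f w))\<^sup>2 + (cmod (g w))\<^sup>2" by linarith
    then show "norm (f w * cnj (g w)) \<le> norm ((cmod (f w))\<^sup>2 + (cmod (g w))\<^sup>2)"
      by (simp add: norm_mult)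
  qed
qed

lemma bergman_space_diff:
  assumes f: "f \<in> bergman_space H" and g: "g \<in> bergman_space H"
  shows "(\<lambda>w. f w - g w) \<in> bergman_space H"
proof -
  have "integrable MH (\<lambda>w. (cmod (f w - g w))\<^sup>2)"
  proof (rule Bochner_Integration.integrable_bound)
    show "integrable MH (\<lambda>w. 2 * (cmod (f w))\<^sup>2 + 2 * (cmod (g w))\<^sup>2)"
      by (intro Bochner_Integration.integrable_add integrable_mult_right bergman_spaceD(4) f g)
    show "(\<lambda>w. (cmod (f w - g w))\<^sup>2) \<in> borel_measurable MH"
      using bergman_spaceD(3)[OF f] bergman_spaceD(3)[OF g] by measurable
    show "AE w in MH. norm ((cmod (f w - g w))\<^sup>2) \<le> norm (2 * (cmod (f w))\<^sup>2 + 2 * (cmod (g w))\<^sup>2)"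
    proof (intro AE_I2)
      fix w
      have "(cmod (f w - g w))\<^sup>2 \<le> (cmod (f w) + cmod (g w))\<^sup>2"
        by (intro power_mono norm_triangle_ineq4) auto
      also have "\<dots> \<le> 2 * (cmod (f w))\<^sup>2 + 2 * (cmod (g w))\<^sup>2"
        using sum_squares_bound[of "cmod (f w)" "cmod (g w)"] by (simp add: power2_sum)
      finally show "norm ((cmod (f w - g w))\<^sup>2) \<le> norm (2 * (cmod (f w))\<^sup>2 + 2 * (cmod (g w))\<^sup>2)"
        by simp
    qed
  qed
  then show ?thesis
    using bergman_spaceD(1,3)[OF f] bergman_spaceD(1,3)[OF g]
    by (simp add: bergman_space_def Lp_space_2_iff holomorphic2_on_diff)
qed

text \<open>By continuity, as nonempty open sets are not negligible. Uniqueness of the representer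
  as a function, and not only modulo null sets, needs this.\<close>

lemma bergman_space_AE_0:
  assumes f: "f \<in> bergman_space H" and ae: "AE w in MH. f w = 0" and z: "z \<in> H"
  shows "f z = 0"
proof (rule ccontr)
  assume "f z \<noteq> 0"
  define U where "U = f -` (- {0}) \<inter> H"
  have "open U"
    unfolding U_def using bergman_spaceD(2)[OF f] open_H continuous_on_open_vimage by blast
  moreover have "z \<in> U" using z \<open>f z \<noteq> 0\<close> by (simp add: U_def)
  ultimately have "\<not> negligible U" using open_not_negligible by blast
  moreover have "AE w in lebesgue. w \<in> H \<longrightarrow> f w = 0"
    using ae by (subst (asm) AE_restrict_space_iff) auto
  then have "AE w in lebesgue. w \<notin> U"
    by eventually_elim (auto simp: U_def)
  then have "negligible U"
    using \<open>open U\<close> by (subst (asm) AE_iff_null_sets[symmetric]) (auto simp: negligible_iff_null_sets)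
  ultimately show False by simp
qed

text \<open>Uniqueness tests the formulas of two representers on their difference d: both give d(z),
  so the squared norm of d is 0.\<close>

lemma bergman_representer_eq:
  assumes z: "z \<in> H"
  shows "bergman_representer H z = kernel_at z"
  unfolding bergman_representer_def
proof (rule the_equality)
  have rep: "f z = (\<integral>w. f w * cnj (kernel_at z w) \<partial>MH)" if "f \<in> bergman_space H" for f
  proof -
    have "(\<integral>w. f w * cnj (kernel_at z w) \<partial>MH) = (\<integral>w. B z w * f w \<partial>MH)"
      by (intro Bochner_Integration.integral_cong) (auto simp: kernel_at_def B_cnj[of _ z])
    then show ?thesis using reproducing[OF that z] by simp
  qed
  show "kernel_at z \<in> bergman_space H \<and> (\<forall>w. w \<notin> H \<longrightarrow> kernel_at z w = 0) \<and>
      (\<forall>f\<in>bergman_space H. f z = (\<integral>w. f w * cnj (kernel_at z w) \<partial>MH))"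
    using kernel_at_bergman_space[OF z] rep by (auto simp: kernel_at_def)
  fix k
  assume k: "k \<in> bergman_space H \<and> (\<forall>w. w \<notin> H \<longrightarrow> k w = 0) \<and>
      (\<forall>f\<in>bergman_space H. f z = (\<integral>w. f w * cnj (k w) \<partial>MH))"
  define d where "d w = k w - kernel_at z w" for w
  have d: "d \<in> bergman_space H"
    unfolding d_def using k kernel_at_bergman_space[OF z] by (intro bergman_space_diff) auto
  have "0 = (\<integral>w. d w * cnj (k w) \<partial>MH) - (\<integral>w. d w * cnj (kernel_at z w) \<partial>MH)"
    using k rep[OF d] d by auto
  also have "\<dots> = (\<integral>w. d w * cnj (k w) - d w * cnj (kernel_at z w) \<partial>MH)"
    by (rule Bochner_Integration.integral_diff[symmetric])
      (use d k kernel_at_bergman_space[OF z] in \<open>auto intro!: bergman_mult_integrable\<close>)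
  also have "\<dots> = (\<integral>w. complex_of_real ((cmod (d w))\<^sup>2) \<partial>MH)"
  proof (intro Bochner_Integration.integral_cong refl)
    fix w
    have "d w * cnj (k w) - d w * cnj (kernel_at z w) = d w * cnj (d w)"
      by (simp add: d_def right_diff_distrib)
    then show "d w * cnj (k w) - d w * cnj (kernel_at z w) = complex_of_real ((cmod (d w))\<^sup>2)"
      by (simp only: complex_norm_square)
  qed
  also have "\<dots> = complex_of_real (\<integral>w. (cmod (d w))\<^sup>2 \<partial>MH)"
    by (rule integral_complex_of_real)
  finally have "(\<integral>w. (cmod (d w))\<^sup>2 \<partial>MH) = 0" by simp
  then have "AE w in MH. (cmod (d w))\<^sup>2 = 0"
    by (subst (asm) integral_nonneg_eq_0_iff_AE[OF bergman_spaceD(4)[OF d]]) auto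
  then have "AE w in MH. d w = 0" by eventually_elim simp
  from bergman_space_AE_0[OF d this] have "k w = kernel_at z w" if "w \<in> H" for w
    using that by (simp add: d_def)
  moreover have "k w = kernel_at z w" if "w \<notin> H" for w
    using that k by (cases w) (simp add: kernel_at_def)
  ultimately show "k = kernel_at z" by blast
qed

lemma bergman_kernel_eq: "z \<in> H \<Longrightarrow> w \<in> H \<Longrightarrow> bergman_kernel H z w = B z w"
  by (simp add: bergman_kernel_def bergman_representer_eq kernel_at_def B_cnj[of w z])

lemma toeplitz_eq:
  assumes "z \<in> H"
  shows "toeplitz H \<phi> f z = (\<integral>w. B z w * (\<phi> w * f w) \<partial>MH)"
  unfolding toeplitz_def bergman_projection_def
  by (intro Bochner_Integration.integral_cong) (use assms in \<open>auto simp: bergman_kernel_eq\<close>)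

lemma kernel_integrable_cong:
  assumes "z \<in> H"
  shows "integrable MH (\<lambda>w. bergman_kernel H z w * g w) \<longleftrightarrow> integrable MH (\<lambda>w. B z w * g w)"
  by (intro Bochner_Integration.integrable_cong) (use assms in \<open>auto simp: bergman_kernel_eq\<close>)

end

subsection \<open>The off-diagonal Schur test\<close>

text \<open>Young's inequality twice, first for the weights \<alpha> and \<beta> normalized by
  \<alpha> + \<beta>. The middle weight may vanish, which is the case p = q of the Schur
  test.\<close>

lemma weighted_am_gm3:
  fixes A S B :: real
  assumes "A > 0" "S > 0" "B > 0" "\<alpha> > 0" "\<beta> \<ge> 0" "\<gamma> > 0" "\<alpha> + \<beta> + \<gamma> = 1"
  shows "A powr \<alpha> * S powr \<beta> * B powr \<gamma> \<le> \<alpha> * A + \<beta> * S + \<gamma> * B"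
proof -
  define \<delta> where "\<delta> = \<alpha> + \<beta>"
  have \<delta>: "\<delta> > 0" "\<delta> + \<gamma> = 1" using assms by (auto simp: \<delta>_def)
  define Y where "Y = A powr (\<alpha> / \<delta>) * S powr (\<beta> / \<delta>)"
  have Y: "Y > 0" using assms by (simp add: Y_def)
  have "\<alpha> / \<delta> + \<beta> / \<delta> = 1" using \<delta> by (simp add: \<delta>_def flip: add_divide_distrib)
  then have "Y \<le> \<alpha> / \<delta> * A + \<beta> / \<delta> * S"
    unfolding Y_def using assms \<delta> by (intro Youngs_inequality_0) auto
  then have 1: "\<delta> * Y \<le> \<alpha> * A + \<beta> * S"
    using \<delta> by (simp add: field_simps)
  have "Y powr \<delta> = A powr \<alpha> * S powr \<beta>"
    using assms \<delta> by (simp add: Y_def powr_mult powr_powr)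
  moreover have "Y powr \<delta> * B powr \<gamma> \<le> \<delta> * Y + \<gamma> * B"
    using Y assms \<delta> by (intro Youngs_inequality_0) auto
  ultimately show ?thesis using 1 by simp
qed

lemma ennreal_mult_add_mult3:
  assumes "0 \<le> a" "0 \<le> x" "0 \<le> b" "0 \<le> y" "0 \<le> c" "0 \<le> z"
  shows "ennreal a * ennreal x + ennreal b * ennreal y + ennreal c * ennreal z = ennreal (a * x + b * y + c * z)"
  using assms by (simp add: ennreal_mult)

text \<open>Hoelder with exponents \<open>q\<close>, \<open>(1/p - 1/q)\<inverse>\<close>, \<open>p'\<close> for the factors \<open>a f\<^bsup>p/q\<^esup>\<close>, \<open>f\<^bsup>1-p/q\<^esup>\<close>, \<open>b\<close>; this
  avoids Minkowski's integral inequality.\<close>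

lemma schur_pointwise:
  fixes a b f :: "'a \<Rightarrow> real"
  assumes [measurable]: "a \<in> borel_measurable M" "b \<in> borel_measurable M" "f \<in> borel_measurable M"
    and nn: "\<And>w. a w \<ge> 0" "\<And>w. b w \<ge> 0" "\<And>w. f w \<ge> 0"
    and p: "p > 1" "p \<le> q" "1 / p + 1 / p' = 1"
    and f1: "(\<integral>\<^sup>+w. ennreal (f w powr p) \<partial>M) \<le> 1"
    and C1: "C1 > 0" "(\<integral>\<^sup>+w. ennreal (b w powr p') \<partial>M) \<le> ennreal C1"
    and X: "X \<ge> 0" "(\<integral>\<^sup>+w. ennreal (a w powr q * f w powr p) \<partial>M) = ennreal X"
  shows "(\<integral>\<^sup>+w. ennreal (a w * b w * f w) \<partial>M) \<le> ennreal (X powr (1 / q) * C1 powr (1 / p'))"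
\<comment> \<open>The general argument divides by X, so an integrand that vanishes almost everywhere
  is treated separately.\<close>
proof (cases "X = 0")
  case True
  with X(2) have "(\<integral>\<^sup>+w. ennreal (a w powr q * f w powr p) \<partial>M) = 0" by simp
  then have "AE w in M. ennreal (a w powr q * f w powr p) = 0"
    by (subst (asm) nn_integral_0_iff_AE) auto
  then have "AE w in M. ennreal (a w * b w * f w) = 0"
  proof eventually_elim
    case (elim w)
    then have "a w powr q * f w powr p \<le> 0" by (simp only: ennreal_eq_0_iff)
    moreover have "0 \<le> a w powr q * f w powr p" by simp
    ultimately have "a w powr q * f w powr p = 0" by (rule antisym)
    then show ?case by auto
  qed
  then have "(\<integral>\<^sup>+w. ennreal (a w * b w * f w) \<partial>M) = 0"
    by (subst nn_integral_0_iff_AE) auto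
  then show ?thesis by simp
next
  case False
  with X have X0: "X > 0" by simp
  have q: "q > 0" using p by simp
  have p': "1 / p' > 0" "p' > 0"
  proof -
    have "1 / p < 1" using p by simp
    then show "1 / p' > 0" using p(3) by linarith
    then show "p' > 0" by simp
  qed
  define \<beta> where "\<beta> = 1 / p - 1 / q"
  have \<beta>: "\<beta> \<ge> 0" "1 / q + \<beta> + 1 / p' = 1"
    using p q by (auto simp: \<beta>_def field_simps)
  define c where "c = X powr (1 / q) * C1 powr (1 / p')"
  have c: "c > 0" using X0 C1 by (simp add: c_def)
  \<comment> \<open>The factors are normalized before the inequality of means is applied, and
    \<open>c\<close> collects the norms. After integration the bracket is at most 1/q + \<beta> +
    1/p' = 1.\<close>
  have pw: "a w * b w * f w \<le> c * (1 / q / X * (a w powr q * f w powr p) + \<beta> * f w powr p + 1 / p' / C1 * b w powr p')" for w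
  proof (cases "a w = 0 \<or> b w = 0 \<or> f w = 0")
    case True
    moreover have "0 \<le> c * (1 / q / X * (a w powr q * f w powr p) + \<beta> * f w powr p + 1 / p' / C1 * b w powr p')"
      using c q X0 \<beta> p' C1 by (intro mult_nonneg_nonneg add_nonneg_nonneg) auto
    ultimately show ?thesis by auto
  next
    case False
    then have pos: "a w > 0" "b w > 0" "f w > 0" using nn[of w] by (auto simp: less_le)
    define A where "A = a w powr q * f w powr p / X"
    define B where "B = b w powr p' / C1"
    have AB: "A > 0" "B > 0" using pos X0 C1 by (auto simp: A_def B_def)
    have "A powr (1 / q) * (f w powr p) powr \<beta> * B powr (1 / p') \<le> 1 / q * A + \<beta> * (f w powr p) + 1 / p' * B"
      using AB pos q p' \<beta> by (intro weighted_am_gm3) auto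
    moreover have "c * (A powr (1 / q) * (f w powr p) powr \<beta> * B powr (1 / p')) = a w * b w * f w"
    proof -
      have "A powr (1 / q) = a w * f w powr (p / q) / X powr (1 / q)"
        using pos X0 q by (simp add: A_def powr_divide powr_mult powr_powr)
      moreover have "B powr (1 / p') = b w / C1 powr (1 / p')"
        using pos C1 p' by (simp add: B_def powr_divide powr_powr)
      moreover have "f w powr (p / q) * f w powr (p * \<beta>) = f w"
      proof -
        have "p / q + p * \<beta> = 1" using p q by (simp add: \<beta>_def right_diff_distrib)
        then show ?thesis using pos by (simp add: powr_add[symmetric])
      qed
      ultimately show ?thesis
        using X0 C1 by (simp add: c_def powr_powr)
    qed
    ultimately have "a w * b w * f w \<le> c * (1 / q * A + \<beta> * (f w powr p) + 1 / p' * B)"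
      using c by (metis mult_le_cancel_left_pos)
    then show ?thesis by (simp add: A_def B_def)
  qed
  have "(\<integral>\<^sup>+w. ennreal (a w * b w * f w) \<partial>M) \<le> (\<integral>\<^sup>+w. ennreal c * (ennreal (1 / q / X) * ennreal (a w powr q * f w powr p)
      + ennreal \<beta> * ennreal (f w powr p) + ennreal (1 / p' / C1) * ennreal (b w powr p')) \<partial>M)"
  proof (rule nn_integral_mono)
    fix w
    have sum3: "ennreal (1 / q / X) * ennreal (a w powr q * f w powr p)
      + ennreal \<beta> * ennreal (f w powr p) + ennreal (1 / p' / C1) * ennreal (b w powr p')
      = ennreal (1 / q / X * (a w powr q * f w powr p) + \<beta> * f w powr p + 1 / p' / C1 * b w powr p')"
      by (rule ennreal_mult_add_mult3) (use q X0 \<beta> p' C1 in auto)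
    have "0 \<le> 1 / q / X * (a w powr q * f w powr p) + \<beta> * f w powr p + 1 / p' / C1 * b w powr p'"
      using q X0 \<beta> p' C1 by (intro add_nonneg_nonneg mult_nonneg_nonneg) auto
    then have "ennreal c * (ennreal (1 / q / X) * ennreal (a w powr q * f w powr p)
      + ennreal \<beta> * ennreal (f w powr p) + ennreal (1 / p' / C1) * ennreal (b w powr p'))
      = ennreal (c * (1 / q / X * (a w powr q * f w powr p) + \<beta> * f w powr p + 1 / p' / C1 * b w powr p'))"
      unfolding sum3 using c by (intro ennreal_mult[symmetric]) auto
    then show "ennreal (a w * b w * f w) \<le> ennreal c * (ennreal (1 / q / X) * ennreal (a w powr q * f w powr p)
      + ennreal \<beta> * ennreal (f w powr p) + ennreal (1 / p' / C1) * ennreal (b w powr p'))"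
      using pw[of w] by (simp only: ennreal_leI)
  qed
  also have "\<dots> = ennreal c * (ennreal (1 / q / X) * ennreal X
      + ennreal \<beta> * (\<integral>\<^sup>+w. ennreal (f w powr p) \<partial>M) + ennreal (1 / p' / C1) * (\<integral>\<^sup>+w. ennreal (b w powr p') \<partial>M))"
    by (simp add: nn_integral_add nn_integral_cmult X(2))
  also have "\<dots> \<le> ennreal c * (ennreal (1 / q / X) * ennreal X + ennreal \<beta> * 1 + ennreal (1 / p' / C1) * ennreal C1)"
    using f1 C1 by (intro mult_left_mono add_mono order_refl) auto
  also have "\<dots> = ennreal c * ennreal (1 / q + \<beta> + 1 / p')"
  proof -
    have "ennreal (1 / q / X) * ennreal X = ennreal (1 / q)" "ennreal (1 / p' / C1) * ennreal C1 = ennreal (1 / p')"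
      using q X0 p' C1 by (auto simp: ennreal_mult[symmetric])
    then show ?thesis
      using q \<beta>(1) p' by (simp add: ennreal_plus del: ennreal_plus[symmetric])
  qed
  also have "\<dots> = ennreal c" using \<beta>(2) by simp
  finally show ?thesis by (simp add: c_def)
qed

text \<open>The q-th power of \<open>schur_pointwise\<close> is integrated over z; Tonelli's theorem
  moves the z integration onto a^q, where \<open>C2\<close> bounds it. \<open>enn2real\<close> sends
  \<infinity> to 0, which the first conclusion confines to a null set.\<close>

lemma schur_test:
  fixes a b :: "'a \<Rightarrow> 'a \<Rightarrow> real" and f :: "'a \<Rightarrow> real"
  assumes M: "sigma_finite_measure M"
    and a[measurable]: "(\<lambda>(z, w). a z w) \<in> borel_measurable (M \<Otimes>\<^sub>M M)"
    and b[measurable]: "(\<lambda>(z, w). b z w) \<in> borel_measurable (M \<Otimes>\<^sub>M M)"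
    and f[measurable]: "f \<in> borel_measurable M"
    and nn: "\<And>z w. a z w \<ge> 0" "\<And>z w. b z w \<ge> 0" "\<And>w. f w \<ge> 0"
    and p: "p > 1" "p \<le> q" "1 / p + 1 / p' = 1"
    and f1: "(\<integral>\<^sup>+w. ennreal (f w powr p) \<partial>M) \<le> 1"
    and C1: "C1 > 0" "\<And>z. z \<in> space M \<Longrightarrow> (\<integral>\<^sup>+w. ennreal (b z w powr p') \<partial>M) \<le> ennreal C1"
    and C2: "C2 \<ge> 0" "\<And>w. w \<in> space M \<Longrightarrow> (\<integral>\<^sup>+z. ennreal (a z w powr q) \<partial>M) \<le> ennreal C2"
  shows "AE z in M. (\<integral>\<^sup>+w. ennreal (a z w * b z w * f w) \<partial>M) < \<infinity>"
    and "(\<integral>\<^sup>+z. ennreal (enn2real (\<integral>\<^sup>+w. ennreal (a z w * b z w * f w) \<partial>M) powr q) \<partial>M) \<le> ennreal (C1 powr (q / p') * C2)"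
proof -
  interpret sigma_finite_measure M by (rule M)
  interpret pair_sigma_finite M M ..
  have q: "q > 0" using p by simp
  define X where "X z = (\<integral>\<^sup>+w. ennreal (a z w powr q * f w powr p) \<partial>M)" for z
  define F where "F z = (\<integral>\<^sup>+w. ennreal (a z w * b z w * f w) \<partial>M)" for z
  have [measurable]: "X \<in> borel_measurable M"
    unfolding X_def by measurable
  have "(\<integral>\<^sup>+z. X z \<partial>M) = (\<integral>\<^sup>+w. \<integral>\<^sup>+z. ennreal (a z w powr q * f w powr p) \<partial>M \<partial>M)"
    unfolding X_def by (rule Fubini'[symmetric]) measurable
  also have "\<dots> = (\<integral>\<^sup>+w. (\<integral>\<^sup>+z. ennreal (a z w powr q) \<partial>M) * ennreal (f w powr p) \<partial>M)"
    by (intro nn_integral_cong) (auto simp: ennreal_mult intro!: nn_integral_multc)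
  also have "\<dots> \<le> (\<integral>\<^sup>+w. ennreal C2 * ennreal (f w powr p) \<partial>M)"
    by (intro nn_integral_mono mult_right_mono C2) auto
  also have "\<dots> = ennreal C2 * (\<integral>\<^sup>+w. ennreal (f w powr p) \<partial>M)"
    by (rule nn_integral_cmult) measurable
  also have "\<dots> \<le> ennreal C2 * 1"
    using f1 by (intro mult_left_mono) auto
  finally have X_le: "(\<integral>\<^sup>+z. X z \<partial>M) \<le> ennreal C2" by simp
  then have "AE z in M. X z \<noteq> \<infinity>"
    by (intro nn_integral_PInf_AE) (auto simp: top_unique)
  have F_le: "F z \<le> ennreal (enn2real (X z) powr (1 / q) * C1 powr (1 / p'))" if "X z \<noteq> \<infinity>" "z \<in> space M" for z
    unfolding F_def
  proof (rule schur_pointwise[where p = p and q = q])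
    show "(\<integral>\<^sup>+w. ennreal (a z w powr q * f w powr p) \<partial>M) = ennreal (enn2real (X z))"
      using that by (simp add: X_def less_top)
    show "(\<lambda>w. a z w) \<in> borel_measurable M" "(\<lambda>w. b z w) \<in> borel_measurable M"
      using that by measurable
  qed (use that assms in auto)
  from \<open>AE z in M. X z \<noteq> \<infinity>\<close> AE_space[of M]
  show "AE z in M. (\<integral>\<^sup>+w. ennreal (a z w * b z w * f w) \<partial>M) < \<infinity>"
    unfolding F_def[symmetric]
  proof eventually_elim
    case (elim z)
    from F_le[OF this] show ?case by (rule le_less_trans) simp
  qed
  have "(\<integral>\<^sup>+z. ennreal (enn2real (F z) powr q) \<partial>M) \<le> (\<integral>\<^sup>+z. ennreal (C1 powr (q / p')) * X z \<partial>M)"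
  proof (rule nn_integral_mono_AE)
    from \<open>AE z in M. X z \<noteq> \<infinity>\<close> AE_space[of M]
    show "AE z in M. ennreal (enn2real (F z) powr q) \<le> ennreal (C1 powr (q / p')) * X z"
    proof eventually_elim
      case (elim z)
      have "enn2real (F z) \<le> enn2real (X z) powr (1 / q) * C1 powr (1 / p')"
        using F_le[OF elim] by (intro enn2real_leI) auto
      then have "enn2real (F z) powr q \<le> (enn2real (X z) powr (1 / q) * C1 powr (1 / p')) powr q"
        using q by (intro powr_mono2) auto
      also have "\<dots> = C1 powr (q / p') * enn2real (X z)"
        using q C1 by (simp add: powr_mult powr_powr)
      finally have "ennreal (enn2real (F z) powr q) \<le> ennreal (C1 powr (q / p') * enn2real (X z))"
        by (rule ennreal_leI)
      also have "\<dots> = ennreal (C1 powr (q / p')) * X z"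
        using elim by (simp add: ennreal_mult less_top)
      finally show ?case .
    qed
  qed
  also have "\<dots> = ennreal (C1 powr (q / p')) * (\<integral>\<^sup>+z. X z \<partial>M)"
    by (rule nn_integral_cmult) measurable
  also have "\<dots> \<le> ennreal (C1 powr (q / p')) * ennreal C2"
    using X_le by (intro mult_left_mono) auto
  also have "\<dots> = ennreal (C1 powr (q / p') * C2)"
    using C2 by (simp add: ennreal_mult)
  finally show "(\<integral>\<^sup>+z. ennreal (enn2real (\<integral>\<^sup>+w. ennreal (a z w * b z w * f w) \<partial>M) powr q) \<partial>M) \<le> ennreal (C1 powr (q / p') * C2)"
    by (simp add: F_def)
qed

subsection \<open>Boundedness\<close>

lemma powr_cancel_pair:
  fixes x y :: real
  assumes "x > 0" "y > 0" "a + b = 0"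
  shows "x powr a * y powr a * (C * x powr b * y powr b) = C"
proof -
  have "x powr a * y powr a * (C * x powr b * y powr b) = C * (x powr a * x powr b) * (y powr a * y powr b)"
    by (simp only: mult_ac)
  then show ?thesis using assms by (simp flip: powr_add)
qed

context hartogs
begin

lemma id_measurable_MH [measurable]: "(\<lambda>x. x) \<in> borel_measurable MH"
  by (rule measurable_MH) simp

lemma pair_measurable_MH:
  "(\<lambda>p. fst p) \<in> borel_measurable (MH \<Otimes>\<^sub>M MH)" "(\<lambda>p. snd p) \<in> borel_measurable (MH \<Otimes>\<^sub>M MH)"
  using measurable_compose[OF measurable_fst id_measurable_MH] measurable_compose[OF measurable_snd id_measurable_MH]
  by auto

lemma sigma_finite_MH: "sigma_finite_measure MH"
  using finite_measure_MH by (simp add: finite_measure_def)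

section \<open>Splitting kernel and symbol for the Schur test\<close>

lemma cmod_symbol:
  assumes "w \<in> H"
  shows "cmod (hartogs_symbol m n \<eta> w) = cmod (snd w) powr (real n * \<eta>) * (1 - om w) powr \<eta> * (1 - (cmod (snd w))\<^sup>2) powr \<eta>"
proof -
  obtain w1 w2 where w12: "w = (w1, w2)" by (cases w)
  have w2: "w2 \<noteq> 0" using snd_nonzero[OF assms] by (simp add: w12)
  have "cmod w2 ^ n - cmod w1 ^ m = cmod w2 ^ n * (1 - om w)"
    using w2 by (simp add: w12 om_def right_diff_distrib)
  then have "(cmod w2 ^ n - cmod w1 ^ m) powr \<eta> = (cmod w2 ^ n) powr \<eta> * (1 - om w) powr \<eta>"
    using om_less_1[OF assms] by (simp add: powr_mult)
  also have "(cmod w2 ^ n) powr \<eta> = cmod w2 powr (real n * \<eta>)"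
    using w2 by (simp add: powr_powr flip: powr_realpow)
  finally show ?thesis
    by (simp add: hartogs_symbol_def w12 norm_mult)
qed

text \<open>Of the boundary decay only the order \<eta>' is kept, since the bases are at most 1,
  while the power |w2|^(n\<eta>) stays in full because it governs p > L. The factor 2^\<eta> comes
  from 1 - |w2|^2 = (1 + |w2|)(1 - |w2|).\<close>

lemma kernel_symbol_bound:
  assumes z: "z \<in> H" and w: "w \<in> H" and \<eta>': "0 \<le> \<eta>'" "\<eta>' \<le> \<eta>"
  shows "cmod (B z w) * cmod (hartogs_symbol m n \<eta> w) \<le>
    real m ^ 2 * 2 powr \<eta> * (cmod (snd z) powr (- kap) * cmod (snd w) powr (real n * \<eta> - kap)
      * (1 - om w) powr \<eta>' * (1 - cmod (snd w)) powr \<eta>' * cmod (1 - uu z w) powr (-2) * cmod (1 - tt z w) powr (-2))"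
proof -
  have w2: "0 < cmod (snd w)" "cmod (snd w) < 1"
    using snd_nonzero[OF w] snd_less_1[OF w] by auto
  have om: "0 < 1 - om w" "1 - om w \<le> 1" using om_less_1[OF w] by auto
  have "1 - (cmod (snd w))\<^sup>2 = (1 + cmod (snd w)) * (1 - cmod (snd w))"
    by (simp add: power2_eq_square algebra_simps)
  then have "(1 - (cmod (snd w))\<^sup>2) powr \<eta> = (1 + cmod (snd w)) powr \<eta> * (1 - cmod (snd w)) powr \<eta>"
    using w2 by (simp add: powr_mult)
  also have "\<dots> \<le> 2 powr \<eta> * (1 - cmod (snd w)) powr \<eta>'"
    using w2 \<eta>' by (intro mult_mono powr_mono2 powr_mono') auto
  finally have 1: "(1 - (cmod (snd w))\<^sup>2) powr \<eta> \<le> 2 powr \<eta> * (1 - cmod (snd w)) powr \<eta>'" .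
  have 2: "(1 - om w) powr \<eta> \<le> (1 - om w) powr \<eta>'"
    using om \<eta>' by (intro powr_mono') auto
  have "cmod (B z w) * cmod (hartogs_symbol m n \<eta> w) \<le>
     (real m ^ 2 * (cmod (snd z) powr (- kap) * cmod (snd w) powr (- kap)) * cmod (1 - uu z w) powr (-2) * cmod (1 - tt z w) powr (-2))
     * (cmod (snd w) powr (real n * \<eta>) * (1 - om w) powr \<eta>' * (2 powr \<eta> * (1 - cmod (snd w)) powr \<eta>'))"
    unfolding cmod_symbol[OF w]
    by (intro mult_mono mult_nonneg_nonneg cmod_B_le z w 1 2 order_refl) auto
  also have "\<dots> = real m ^ 2 * 2 powr \<eta> * (cmod (snd z) powr (- kap) * cmod (snd w) powr (real n * \<eta> - kap)
      * (1 - om w) powr \<eta>' * (1 - cmod (snd w)) powr \<eta>' * cmod (1 - uu z w) powr (-2) * cmod (1 - tt z w) powr (-2))"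
    using powr_add[of "cmod (snd w)" "real n * \<eta>" "- kap"] by (simp add: mult_ac)
  finally show ?thesis .
qed

text \<open>The two factors of the Schur test. The kernel is split with the power \<open>2 / (2 - \<eta>')\<close>, for which
  both halves carry the same exponent, and \<open>((1 - om w) (1 - |w\<^sub>2|))\<close> to the power \<open>- A\<close> is the test function.\<close>

definition core_a :: "real \<Rightarrow> real \<Rightarrow> real \<Rightarrow> complex \<times> complex \<Rightarrow> complex \<times> complex \<Rightarrow> real" where
  "core_a A x l z w = cmod (snd z) powr (- kap) * (1 - om z) powr (- A) * (1 - cmod (snd z)) powr (- A)
     * ((1 - om w) powr (x + A) * (1 - cmod (snd w)) powr (x + A))
     * (cmod (1 - uu z w) powr (- l) * cmod (1 - tt z w) powr (- l))"

definition core_b :: "real \<Rightarrow> real \<Rightarrow> real \<Rightarrow> real \<Rightarrow> complex \<times> complex \<Rightarrow> complex \<times> complex \<Rightarrow> real" where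
  "core_b c A x l z w = cmod (snd w) powr c * (1 - om w) powr (x - A) * (1 - cmod (snd w)) powr (x - A)
     * ((1 - om z) powr A * (1 - cmod (snd z)) powr A)
     * (cmod (1 - uu z w) powr (- l) * cmod (1 - tt z w) powr (- l))"

lemma core_nonneg: "core_a A x l z w \<ge> 0" "core_b c A x l z w \<ge> 0"
  by (auto simp: core_a_def core_b_def)

lemma core_measurable:
  "(\<lambda>(z, w). core_a A x l z w) \<in> borel_measurable (MH \<Otimes>\<^sub>M MH)"
  "(\<lambda>(z, w). core_b c A x l z w) \<in> borel_measurable (MH \<Otimes>\<^sub>M MH)"
proof -
  note pair_measurable_MH [measurable]
  show "(\<lambda>(z, w). core_a A x l z w) \<in> borel_measurable (MH \<Otimes>\<^sub>M MH)"
    "(\<lambda>(z, w). core_b c A x l z w) \<in> borel_measurable (MH \<Otimes>\<^sub>M MH)"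
    unfolding core_a_def core_b_def case_prod_unfold by measurable
qed

lemma core_measurable_right:
  "(\<lambda>w. core_a A x l z w) \<in> borel_measurable MH" "(\<lambda>w. core_b c A x l z w) \<in> borel_measurable MH"
  unfolding core_a_def core_b_def by (rule measurable_MH, measurable)+

lemma core_mult:
  assumes "z \<in> H" "w \<in> H"
  shows "core_a A x1 l1 z w * core_b c A x2 l2 z w = cmod (snd z) powr (- kap) * cmod (snd w) powr c
      * (1 - om w) powr (x1 + x2) * (1 - cmod (snd w)) powr (x1 + x2)
      * cmod (1 - uu z w) powr (- (l1 + l2)) * cmod (1 - tt z w) powr (- (l1 + l2))"
proof -
  have cancel: "y powr (- A) * y powr A = 1" if "y > 0" for y :: real
    using that by (simp add: powr_minus)
  have z1: "1 - om z > 0" "1 - cmod (snd z) > 0" using om_less_1[OF assms(1)] snd_less_1[OF assms(1)] by auto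
  have e: "y powr (x1 + A) * y powr (x2 - A) = y powr (x1 + x2)" for y :: real
    by (simp add: powr_add[symmetric])
  have l: "y powr (- l1) * y powr (- l2) = y powr (- (l1 + l2))" for y :: real
    by (simp add: powr_add[symmetric])
  have "core_a A x1 l1 z w * core_b c A x2 l2 z w = cmod (snd z) powr (- kap) * cmod (snd w) powr c
      * ((1 - om z) powr (- A) * (1 - om z) powr A) * ((1 - cmod (snd z)) powr (- A) * (1 - cmod (snd z)) powr A)
      * ((1 - om w) powr (x1 + A) * (1 - om w) powr (x2 - A)) * ((1 - cmod (snd w)) powr (x1 + A) * (1 - cmod (snd w)) powr (x2 - A))
      * (cmod (1 - uu z w) powr (- l1) * cmod (1 - uu z w) powr (- l2)) * (cmod (1 - tt z w) powr (- l1) * cmod (1 - tt z w) powr (- l2))"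
    by (simp only: core_a_def core_b_def mult_ac)
  also have "\<dots> = cmod (snd z) powr (- kap) * cmod (snd w) powr c
      * (1 - om w) powr (x1 + x2) * (1 - cmod (snd w)) powr (x1 + x2)
      * cmod (1 - uu z w) powr (- (l1 + l2)) * cmod (1 - tt z w) powr (- (l1 + l2))"
    unfolding e l cancel[OF z1(1)] cancel[OF z1(2)] by simp
  finally show ?thesis .
qed

text \<open>\<open>bal\<close> makes the exponent produced by the Forelli-Rudin estimate exactly the
  one that the test function in z cancels, so the bound is uniform in z. In use, s is the conjugate
  exponent of p, and the condition on c expresses p > L.\<close>

lemma core_b_bound:
  assumes c: "c * s + 2 * real n / real m > -2" and s: "s > 0"
    and e: "(x - A) * s > -1" and l: "l * s \<ge> 2" and bal: "(x - A) * s + 2 - l * s = - A * s" and A: "A > 0"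
  shows "\<exists>C>0. \<forall>z\<in>H. (\<integral>\<^sup>+w. ennreal (core_b c A x l z w powr s) \<partial>MH) \<le> ennreal C"
proof -
  have "l * s > (x - A) * s + 2" using bal A s by (smt (verit) mult_pos_pos mult_minus_left)
  from forelli_rudin_H[OF c e l this]
  obtain C where C: "C \<ge> 0" "\<And>z. z \<in> H \<Longrightarrow>
    (\<integral>\<^sup>+w. ennreal (cmod (snd w) powr (c * s) * (1 - om w) powr ((x - A) * s) * (1 - cmod (snd w)) powr ((x - A) * s)
         * cmod (1 - uu z w) powr (- (l * s)) * cmod (1 - tt z w) powr (- (l * s))) \<partial>MH)
     \<le> ennreal (C * (1 - om z) powr ((x - A) * s + 2 - l * s) * (1 - cmod (snd z)) powr ((x - A) * s + 2 - l * s))"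
    by blast
  \<comment> \<open>Adding 1 makes the constant strictly positive; the Schur test divides by
    it.\<close>
  have "(\<integral>\<^sup>+w. ennreal (core_b c A x l z w powr s) \<partial>MH) \<le> ennreal (C + 1)" if z: "z \<in> H" for z
  proof -
    define D where "D = (1 - om z) powr (A * s) * (1 - cmod (snd z)) powr (A * s)"
    have D: "D \<ge> 0" by (simp add: D_def)
    have z1: "1 - om z > 0" "1 - cmod (snd z) > 0" using om_less_1[OF z] snd_less_1[OF z] by auto
    define g where "g w = cmod (snd w) powr (c * s) * (1 - om w) powr ((x - A) * s) * (1 - cmod (snd w)) powr ((x - A) * s)
         * cmod (1 - uu z w) powr (- (l * s)) * cmod (1 - tt z w) powr (- (l * s))" for w
    have [measurable]: "g \<in> borel_measurable MH"
      unfolding g_def[abs_def] by (rule measurable_MH) measurable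
    have g0: "g w \<ge> 0" for w by (simp add: g_def)
    have "core_b c A x l z w powr s = D * g w" if "w \<in> H" for w
      using z1 om_less_1[OF that] snd_less_1[OF that]
      by (simp add: core_b_def D_def g_def powr_mult powr_powr)
    then have "(\<integral>\<^sup>+w. ennreal (core_b c A x l z w powr s) \<partial>MH) = (\<integral>\<^sup>+w. ennreal D * ennreal (g w) \<partial>MH)"
      by (intro nn_integral_cong) (simp add: ennreal_mult D g0)
    also have "\<dots> = ennreal D * (\<integral>\<^sup>+w. ennreal (g w) \<partial>MH)"
      by (rule nn_integral_cmult) measurable
    also have "\<dots> \<le> ennreal D * ennreal (C * (1 - om z) powr ((x - A) * s + 2 - l * s) * (1 - cmod (snd z)) powr ((x - A) * s + 2 - l * s))"
      using C(2)[OF z] by (intro mult_left_mono) (simp_all add: g_def)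
    also have "\<dots> = ennreal (D * (C * (1 - om z) powr (- A * s) * (1 - cmod (snd z)) powr (- A * s)))"
      unfolding bal using D C by (intro ennreal_mult[symmetric]) auto
    also have "D * (C * (1 - om z) powr (- A * s) * (1 - cmod (snd z)) powr (- A * s)) = C"
      unfolding D_def by (rule powr_cancel_pair[OF z1]) simp
    also have "ennreal C \<le> ennreal (C + 1)" by (intro ennreal_leI) simp
    finally show ?thesis .
  qed
  with C(1) show ?thesis by (intro exI[of _ "C + 1"]) auto
qed

text \<open>The counterpart in z, used with s = q, where the condition on \<open>kap\<close> is q <
  M. Conjugate symmetry of \<open>uu\<close> and \<open>tt\<close> lets the Forelli-Rudin estimate
  be read with z as the integration variable.\<close>

lemma core_a_bound:
  assumes c: "- kap * s + 2 * real n / real m > -2" and s: "s > 0"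
    and e: "- A * s > -1" and l: "l * s \<ge> 2" and bal: "- A * s + 2 - l * s = - (x + A) * s" and xA: "x + A > 0"
  shows "\<exists>C\<ge>0. \<forall>w\<in>H. (\<integral>\<^sup>+z. ennreal (core_a A x l z w powr s) \<partial>MH) \<le> ennreal C"
proof -
  have "l * s > - A * s + 2" using bal xA s by (smt (verit) mult_pos_pos mult_minus_left)
  from forelli_rudin_H[OF c e l this]
  obtain C where C: "C \<ge> 0" "\<And>z. z \<in> H \<Longrightarrow>
    (\<integral>\<^sup>+w. ennreal (cmod (snd w) powr (- kap * s) * (1 - om w) powr (- A * s) * (1 - cmod (snd w)) powr (- A * s)
         * cmod (1 - uu z w) powr (- (l * s)) * cmod (1 - tt z w) powr (- (l * s))) \<partial>MH)
     \<le> ennreal (C * (1 - om z) powr (- A * s + 2 - l * s) * (1 - cmod (snd z)) powr (- A * s + 2 - l * s))"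
    by blast
  have "(\<integral>\<^sup>+z. ennreal (core_a A x l z w powr s) \<partial>MH) \<le> ennreal C" if w: "w \<in> H" for w
  proof -
    define D where "D = (1 - om w) powr ((x + A) * s) * (1 - cmod (snd w)) powr ((x + A) * s)"
    have D: "D \<ge> 0" by (simp add: D_def)
    have w1: "1 - om w > 0" "1 - cmod (snd w) > 0" using om_less_1[OF w] snd_less_1[OF w] by auto
    define g where "g z = cmod (snd z) powr (- kap * s) * (1 - om z) powr (- A * s) * (1 - cmod (snd z)) powr (- A * s)
         * cmod (1 - uu w z) powr (- (l * s)) * cmod (1 - tt w z) powr (- (l * s))" for z
    have [measurable]: "g \<in> borel_measurable MH"
      unfolding g_def[abs_def] by (rule measurable_MH) measurable
    have g0: "g z \<ge> 0" for z by (simp add: g_def)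
    have "core_a A x l z w powr s = D * g z" if "z \<in> H" for z
      using w1 om_less_1[OF that] snd_less_1[OF that]
      by (simp add: core_a_def D_def g_def powr_mult powr_powr uu_cnj[of w z] tt_cnj[of w z] cmod_cnj_diff)
    then have "(\<integral>\<^sup>+z. ennreal (core_a A x l z w powr s) \<partial>MH) = (\<integral>\<^sup>+z. ennreal D * ennreal (g z) \<partial>MH)"
      by (intro nn_integral_cong) (simp add: ennreal_mult D g0)
    also have "\<dots> = ennreal D * (\<integral>\<^sup>+z. ennreal (g z) \<partial>MH)"
      by (rule nn_integral_cmult) measurable
    also have "\<dots> \<le> ennreal D * ennreal (C * (1 - om w) powr (- A * s + 2 - l * s) * (1 - cmod (snd w)) powr (- A * s + 2 - l * s))"
      using C(2)[OF w] by (intro mult_left_mono) (simp_all add: g_def)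
    also have "\<dots> = ennreal (D * (C * (1 - om w) powr (- (x + A) * s) * (1 - cmod (snd w)) powr (- (x + A) * s)))"
      unfolding bal using D C by (intro ennreal_mult[symmetric]) auto
    also have "D * (C * (1 - om w) powr (- (x + A) * s) * (1 - cmod (snd w)) powr (- (x + A) * s)) = C"
      unfolding D_def by (rule powr_cancel_pair[OF w1]) (simp only: mult_minus_left add.right_inverse)
    finally show ?thesis .
  qed
  with C(1) show ?thesis by blast
qed

text \<open>The modulus stands inside the integral, so almost everywhere convergence and the norm
  bound come from one estimate.\<close>

theorem core_bound:
  assumes p: "p > 1" "p \<le> q" and \<eta>': "0 \<le> \<eta>'" "\<eta>' \<le> \<eta>" "1 / q = 1 / p - \<eta>' / 2"
    and qM: "- kap * q + 2 * real n / real m > -2"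
    and pL: "(real n * \<eta> - kap) * (p / (p - 1)) + 2 * real n / real m > -2"
  shows "\<exists>C\<ge>0. \<forall>f\<in>borel_measurable MH. (\<integral>\<^sup>+w. ennreal (cmod (f w) powr p) \<partial>MH) \<le> 1 \<longrightarrow>
    (AE z in MH. (\<integral>\<^sup>+w. ennreal (cmod (B z w * (hartogs_symbol m n \<eta> w * f w))) \<partial>MH) < \<infinity>) \<and>
    (\<integral>\<^sup>+z. ennreal (enn2real (\<integral>\<^sup>+w. ennreal (cmod (B z w * (hartogs_symbol m n \<eta> w * f w))) \<partial>MH) powr q) \<partial>MH) \<le> ennreal C"
proof -
  define s where "s = p / (p - 1)"
  have s: "s > 0" "1 / p + 1 / s = 1" using p by (auto simp: s_def field_simps)
  have q: "q > 0" using p by simp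
  have "1 / p < 1" "1 / q > 0" using p q by auto
  then have \<eta>2: "\<eta>' < 2" using \<eta>'(3) by simp
  \<comment> \<open>Both halves of the kernel are to carry the same power 2 \<open>lam\<close> after
    raising to q and s. Their exponents then add up to 2 \<open>lam\<close> (1/q + 1/s), which must
    be 2; as 1/q + 1/s = 1 - \<eta>'/2, this determines \<open>lam\<close>.\<close>
  define lam where "lam = 2 / (2 - \<eta>')"
  have lam: "lam \<ge> 1" "lam * (2 - \<eta>') = 2" using \<eta>' \<eta>2 by (auto simp: lam_def field_simps)
  have sq: "1 / s + 1 / q = 1 - \<eta>' / 2" using s(2) \<eta>'(3) by simp
  have l1: "lam / q + lam / s = 1"
  proof -
    have "lam / q + lam / s = lam * (1 / s + 1 / q)" by (simp add: distrib_left)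
    also have "\<dots> = lam * (2 - \<eta>') / 2" unfolding sq by (simp add: right_diff_distrib)
    finally show ?thesis using lam(2) by simp
  qed
  \<comment> \<open>Any positive A with A s < 1 and A q < 1 serves; it keeps both test weights
    integrable up to the boundary.\<close>
  define A where "A = 1 / (2 * (q + s))"
  have A: "A > 0" "A * s < 1" "A * q < 1"
    using q s by (auto simp: A_def field_simps)
  define xa xb la lb where "xa = \<eta>' * lam / q" and "xb = \<eta>' * lam / s" and "la = 2 * lam / q" and "lb = 2 * lam / s"
  have m1: "xa * q = \<eta>' * lam" "xb * s = \<eta>' * lam" "la * q = 2 * lam" "lb * s = 2 * lam"
    using q s by (auto simp: xa_def xb_def la_def lb_def)
  have xx: "xa + xb = \<eta>'" "la + lb = 2"
  proof -
    have "xa + xb = \<eta>' * (lam / q + lam / s)" "la + lb = 2 * (lam / q + lam / s)"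
      by (simp_all add: xa_def xb_def la_def lb_def distrib_left)
    then show "xa + xb = \<eta>'" "la + lb = 2" using l1 by auto
  qed
  have \<eta>l: "\<eta>' * lam \<ge> 0" using \<eta>' lam by simp
  have bal: "\<eta>' * lam + 2 - 2 * lam = 0" using lam(2) by (simp add: algebra_simps)
  obtain C1 where C1: "C1 > 0" "\<And>z. z \<in> H \<Longrightarrow> (\<integral>\<^sup>+w. ennreal (core_b (real n * \<eta> - kap) A xb lb z w powr s) \<partial>MH) \<le> ennreal C1"
  proof -
    have "\<exists>C>0. \<forall>z\<in>H. (\<integral>\<^sup>+w. ennreal (core_b (real n * \<eta> - kap) A xb lb z w powr s) \<partial>MH) \<le> ennreal C"
    proof (rule core_b_bound)
      show "(real n * \<eta> - kap) * s + 2 * real n / real m > -2" using pL by (simp add: s_def)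
      show "(xb - A) * s > -1" using m1 \<eta>l A by (simp add: left_diff_distrib)
      show "lb * s \<ge> 2" using m1 lam by simp
      show "(xb - A) * s + 2 - lb * s = - A * s" using m1 bal by (simp add: left_diff_distrib)
    qed (use s A in auto)
    then show thesis using that by blast
  qed
  obtain C2 where C2: "C2 \<ge> 0" "\<And>w. w \<in> H \<Longrightarrow> (\<integral>\<^sup>+z. ennreal (core_a A xa la z w powr q) \<partial>MH) \<le> ennreal C2"
  proof -
    have "\<exists>C\<ge>0. \<forall>w\<in>H. (\<integral>\<^sup>+z. ennreal (core_a A xa la z w powr q) \<partial>MH) \<le> ennreal C"
    proof (rule core_a_bound)
      show "- kap * q + 2 * real n / real m > -2" by (rule qM)
      show "- A * q > -1" using A by simp
      show "la * q \<ge> 2" using m1 lam by simp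
      show "- A * q + 2 - la * q = - (xa + A) * q"
        using m1 bal by (simp add: left_diff_distrib distrib_right)
      have "xa \<ge> 0" using \<eta>l q by (simp add: xa_def)
      then show "xa + A > 0" using A by simp
    qed (use q in auto)
    then show thesis using that by blast
  qed
  define K where "K = real m ^ 2 * 2 powr \<eta>"
  have K: "K > 0" using m_pos by (simp add: K_def)
  define C where "C = K powr q * (C1 powr (q / s) * C2)"
  show ?thesis
  proof (intro exI[of _ C] conjI ballI impI)
    show "C \<ge> 0" using C2 by (simp add: C_def)
    fix f :: "complex \<times> complex \<Rightarrow> complex"
    assume f[measurable]: "f \<in> borel_measurable MH" and f1: "(\<integral>\<^sup>+w. ennreal (cmod (f w) powr p) \<partial>MH) \<le> 1"
    define F where "F z = (\<integral>\<^sup>+w. ennreal (core_a A xa la z w * core_b (real n * \<eta> - kap) A xb lb z w * cmod (f w)) \<partial>MH)" for z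
    define T where "T z = (\<integral>\<^sup>+w. ennreal (cmod (B z w * (hartogs_symbol m n \<eta> w * f w))) \<partial>MH)" for z
    have fm: "(\<lambda>w. cmod (f w)) \<in> borel_measurable MH" by measurable
    have "AE z in MH. (\<integral>\<^sup>+w. ennreal (core_a A xa la z w * core_b (real n * \<eta> - kap) A xb lb z w * cmod (f w)) \<partial>MH) < \<infinity>"
      by (rule schur_test(1)[OF sigma_finite_MH core_measurable fm core_nonneg _ p s(2) f1 C1(1) _ C2(1)])
        (use C1(2) C2(2) in auto)
    then have F_fin: "AE z in MH. F z < \<infinity>" by (simp add: F_def)
    have F_int: "(\<integral>\<^sup>+z. ennreal (enn2real (F z) powr q) \<partial>MH) \<le> ennreal (C1 powr (q / s) * C2)"
      unfolding F_def
      by (rule schur_test(2)[OF sigma_finite_MH core_measurable fm core_nonneg _ p s(2) f1 C1(1) _ C2(1)])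
        (use C1(2) C2(2) in auto)
    have [measurable]: "(\<lambda>(z, w). core_a A xa la z w) \<in> borel_measurable (MH \<Otimes>\<^sub>M MH)"
      "(\<lambda>(z, w). core_b (real n * \<eta> - kap) A xb lb z w) \<in> borel_measurable (MH \<Otimes>\<^sub>M MH)"
      by (rule core_measurable)+
    have T_le: "T z \<le> ennreal K * F z" if z: "z \<in> H" for z
    proof -
      have "T z \<le> (\<integral>\<^sup>+w. ennreal K * ennreal (core_a A xa la z w * core_b (real n * \<eta> - kap) A xb lb z w * cmod (f w)) \<partial>MH)"
        unfolding T_def
      proof (intro nn_integral_mono)
        fix w assume "w \<in> space MH"
        then have w: "w \<in> H" by simp
        have "cmod (B z w) * cmod (hartogs_symbol m n \<eta> w) \<le> K * (core_a A xa la z w * core_b (real n * \<eta> - kap) A xb lb z w)"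
          using kernel_symbol_bound[OF z w \<eta>'(1,2)] unfolding core_mult[OF z w] xx K_def by simp
        then have "cmod (B z w) * cmod (hartogs_symbol m n \<eta> w) * cmod (f w) \<le> K * (core_a A xa la z w * core_b (real n * \<eta> - kap) A xb lb z w) * cmod (f w)"
          by (rule mult_right_mono) simp
        then have "ennreal (cmod (B z w * (hartogs_symbol m n \<eta> w * f w))) \<le> ennreal (K * (core_a A xa la z w * core_b (real n * \<eta> - kap) A xb lb z w * cmod (f w)))"
          by (intro ennreal_leI) (simp add: norm_mult mult.assoc)
        also have "\<dots> = ennreal K * ennreal (core_a A xa la z w * core_b (real n * \<eta> - kap) A xb lb z w * cmod (f w))"
          using K core_nonneg by (intro ennreal_mult) (auto intro!: mult_nonneg_nonneg)
        finally show "ennreal (cmod (B z w * (hartogs_symbol m n \<eta> w * f w))) \<le> ennreal K * ennreal (core_a A xa la z w * core_b (real n * \<eta> - kap) A xb lb z w * cmod (f w))" .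
      qed
      also have "\<dots> = ennreal K * F z"
        unfolding F_def
        by (intro nn_integral_cmult measurable_compose[OF _ measurable_ennreal] borel_measurable_times core_measurable_right fm)
      finally show ?thesis .
    qed
    show "AE z in MH. (\<integral>\<^sup>+w. ennreal (cmod (B z w * (hartogs_symbol m n \<eta> w * f w))) \<partial>MH) < \<infinity>"
      unfolding T_def[symmetric] using F_fin AE_space[of MH]
    proof eventually_elim
      case (elim z)
      then have "T z \<le> ennreal K * F z" by (intro T_le) simp
      also have "\<dots> < \<infinity>" using elim by (simp add: ennreal_mult_less_top)
      finally show ?case .
    qed
    have "(\<integral>\<^sup>+z. ennreal (enn2real (T z) powr q) \<partial>MH) \<le> (\<integral>\<^sup>+z. ennreal (K powr q) * ennreal (enn2real (F z) powr q) \<partial>MH)"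
    proof (rule nn_integral_mono_AE)
      show "AE z in MH. ennreal (enn2real (T z) powr q) \<le> ennreal (K powr q) * ennreal (enn2real (F z) powr q)"
        using F_fin AE_space[of MH]
      proof eventually_elim
        case (elim z)
        then have "T z \<le> ennreal K * F z" by (intro T_le) simp
        also have "\<dots> = ennreal (K * enn2real (F z))"
          using elim K by (simp add: ennreal_mult)
        finally have "enn2real (T z) \<le> K * enn2real (F z)"
          using K by (intro enn2real_leI) auto
        then have "enn2real (T z) powr q \<le> (K * enn2real (F z)) powr q"
          using q by (intro powr_mono2) auto
        also have "\<dots> = K powr q * enn2real (F z) powr q"
          using K by (simp add: powr_mult)
        finally show ?case
          by (simp add: ennreal_leI flip: ennreal_mult)
      qed
    qed
    also have "\<dots> = ennreal (K powr q) * (\<integral>\<^sup>+z. ennreal (enn2real (F z) powr q) \<partial>MH)"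
    proof (rule nn_integral_cmult)
      have "sigma_finite_measure MH" by (rule sigma_finite_MH)
      then interpret sigma_finite_measure MH .
      have [measurable]: "F \<in> borel_measurable MH" unfolding F_def by measurable
      show "(\<lambda>z. ennreal (enn2real (F z) powr q)) \<in> borel_measurable MH" by measurable
    qed
    also have "\<dots> \<le> ennreal (K powr q) * ennreal (C1 powr (q / s) * C2)"
      using F_int by (intro mult_left_mono) auto
    also have "\<dots> = ennreal C"
      unfolding C_def using C2 by (intro ennreal_mult[symmetric]) auto
    finally show "(\<integral>\<^sup>+z. ennreal (enn2real (\<integral>\<^sup>+w. ennreal (cmod (B z w * (hartogs_symbol m n \<eta> w * f w))) \<partial>MH) powr q) \<partial>MH) \<le> ennreal C"
      by (simp add: T_def)
  qed
qed

section \<open>From normalized functions to operator bounds\<close>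

lemma symbol_measurable [measurable]: "hartogs_symbol m n \<eta> \<in> borel_measurable MH"
proof (rule measurable_MH)
  show "hartogs_symbol m n \<eta> \<in> borel_measurable borel"
    unfolding hartogs_symbol_def case_prod_unfold by measurable
qed

lemma B_measurable_MH [measurable]: "(\<lambda>w. B z w) \<in> borel_measurable MH"
  by (rule measurable_MH) measurable

lemma toeplitz_measurable:
  assumes [measurable]: "\<phi> \<in> borel_measurable MH" "f \<in> borel_measurable MH"
  shows "toeplitz H \<phi> f \<in> borel_measurable MH"
proof -
  interpret sigma_finite_measure MH by (rule sigma_finite_MH)
  note pair_measurable_MH [measurable]
  have [measurable]: "(\<lambda>(z, w). B z w) \<in> borel_measurable (MH \<Otimes>\<^sub>M MH)"
    unfolding case_prod_unfold by measurable
  have "(\<lambda>z. \<integral>w. B z w * (\<phi> w * f w) \<partial>MH) \<in> borel_measurable MH"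
    by measurable
  then show ?thesis
    by (rule measurable_cong[THEN iffD1, rotated]) (simp add: toeplitz_eq)
qed

text \<open>Homogeneity reduces to p-norm at most 1. The target exponent drops from q to r through
  x^r \<le> 1 + x^q, at the cost of adding the finite measure of \<open>H\<close> to the
  constant.\<close>

lemma toeplitz_bounded_of_normalized:
  assumes p: "p > 0" and r: "1 \<le> r" "r \<le> q" and C: "C \<ge> 0"
    and \<phi>[measurable]: "\<phi> \<in> borel_measurable MH"
    and core: "\<And>f. f \<in> borel_measurable MH \<Longrightarrow> (\<integral>\<^sup>+w. ennreal (cmod (f w) powr p) \<partial>MH) \<le> 1 \<Longrightarrow>
      (AE z in MH. (\<integral>\<^sup>+w. ennreal (cmod (B z w * (\<phi> w * f w))) \<partial>MH) < \<infinity>) \<and>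
      (\<integral>\<^sup>+z. ennreal (enn2real (\<integral>\<^sup>+w. ennreal (cmod (B z w * (\<phi> w * f w))) \<partial>MH) powr q) \<partial>MH) \<le> ennreal C"
  shows "toeplitz_bounded H \<phi> p r"
proof -
  define V where "V = measure MH H"
  have V: "V \<ge> 0" "emeasure MH H = ennreal V"
    using finite_measure.emeasure_eq_measure[OF finite_measure_MH, of H] by (auto simp: V_def)
  define C' where "C' = C + V"
  have C': "C' \<ge> 0" using C V by (simp add: C'_def)
  define K where "K = C' powr (1 / r)"
  have r0: "r > 0" using r by simp
  have main: "(AE z in MH. integrable MH (\<lambda>w. B z w * (\<phi> w * f w))) \<and>
        toeplitz H \<phi> f \<in> Lp_space r MH \<and> Lp_norm r MH (toeplitz H \<phi> f) \<le> K * Lp_norm p MH f"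
    if f: "f \<in> Lp_space p MH" for f
  proof -
    have fm[measurable]: "f \<in> borel_measurable MH" and fi: "integrable MH (\<lambda>w. cmod (f w) powr p)"
      using f by (auto simp: Lp_space_def)
    define N where "N = (\<integral>w. cmod (f w) powr p \<partial>MH)"
    have N: "N \<ge> 0" "(\<integral>\<^sup>+w. ennreal (cmod (f w) powr p) \<partial>MH) = ennreal N"
      unfolding N_def using fi by (auto intro: nn_integral_eq_integral)
    have Tm[measurable]: "toeplitz H \<phi> f \<in> borel_measurable MH"
      by (rule toeplitz_measurable) measurable
    show ?thesis
    \<comment> \<open>A function of norm 0 cannot be normalized; its image vanishes on all of
      \<open>H\<close>.\<close>
    proof (cases "N = 0")
      case True
      then have "(\<integral>\<^sup>+w. ennreal (cmod (f w) powr p) \<partial>MH) = 0" using N by simp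
      then have "AE w in MH. ennreal (cmod (f w) powr p) = 0"
        by (subst (asm) nn_integral_0_iff_AE) auto
      then have f0: "AE w in MH. B z w * (\<phi> w * f w) = 0" for z
        by eventually_elim (simp add: ennreal_eq_0_iff)
      have m: "(\<lambda>w. B z w * (\<phi> w * f w)) \<in> borel_measurable MH" for z by measurable
      have 1: "integrable MH (\<lambda>w. B z w * (\<phi> w * f w))" for z
        by (rule integrable_cong_AE_imp[OF integrable_zero m]) (use f0 in \<open>auto elim: eventually_mono\<close>)
      have 2: "toeplitz H \<phi> f z = 0" if "z \<in> H" for z
        unfolding toeplitz_eq[OF that] by (rule integral_eq_zero_AE[OF f0])
      have 3: "(\<integral>z. cmod (toeplitz H \<phi> f z) powr r \<partial>MH) = 0"
        by (rule integral_eq_zero_AE) (auto intro!: AE_I2 simp: 2)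
      have "integrable MH (\<lambda>z. cmod (toeplitz H \<phi> f z) powr r) \<longleftrightarrow> integrable MH (\<lambda>z. 0::real)"
        by (rule Bochner_Integration.integrable_cong) (auto simp: 2)
      then have "toeplitz H \<phi> f \<in> Lp_space r MH"
        by (simp add: Lp_space_def)
      moreover have "Lp_norm r MH (toeplitz H \<phi> f) = 0" by (simp add: Lp_norm_def 3)
      ultimately show ?thesis using 1 by (auto simp: Lp_norm_def K_def)
    next
      case False
      then have N0: "N > 0" using N by simp
      define t where "t = N powr (1 / p)"
      have t: "t > 0" "t powr p = N" using N0 p by (auto simp: t_def powr_powr)
      define g where "g w = f w / of_real t" for w
      have [measurable]: "g \<in> borel_measurable MH" unfolding g_def[abs_def] by measurable
      have "(\<integral>\<^sup>+w. ennreal (cmod (g w) powr p) \<partial>MH) = (\<integral>\<^sup>+w. ennreal (1 / N) * ennreal (cmod (f w) powr p) \<partial>MH)"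
        using t N0 by (intro nn_integral_cong) (simp add: g_def norm_divide powr_divide ennreal_mult[symmetric])
      also have "\<dots> = ennreal (1 / N) * ennreal N"
        unfolding N(2)[symmetric] by (rule nn_integral_cmult) measurable
      also have "\<dots> = 1" using N0 by (simp add: ennreal_mult[symmetric])
      finally have "(\<integral>\<^sup>+w. ennreal (cmod (g w) powr p) \<partial>MH) \<le> 1" by simp
      define S where "S z = (\<integral>\<^sup>+w. ennreal (cmod (B z w * (\<phi> w * g w))) \<partial>MH)" for z
      from core[OF _ \<open>(\<integral>\<^sup>+w. ennreal (cmod (g w) powr p) \<partial>MH) \<le> 1\<close>]
      have S: "AE z in MH. S z < \<infinity>" "(\<integral>\<^sup>+z. ennreal (enn2real (S z) powr q) \<partial>MH) \<le> ennreal C"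
        by (auto simp: S_def)
      have fg: "B z w * (\<phi> w * f w) = of_real t * (B z w * (\<phi> w * g w))" for z w
        using t by (simp add: g_def)
      have int_g: "integrable MH (\<lambda>w. B z w * (\<phi> w * g w))" if "S z < \<infinity>" for z
        using that by (intro integrableI_bounded) (auto simp: S_def)
      have 1: "AE z in MH. integrable MH (\<lambda>w. B z w * (\<phi> w * f w))"
        using S(1) unfolding fg by eventually_elim (intro integrable_mult_right int_g)
      have T_le: "cmod (toeplitz H \<phi> f z) \<le> t * enn2real (S z)" if "S z < \<infinity>" "z \<in> H" for z
      proof -
        have "ennreal (cmod (\<integral>w. B z w * (\<phi> w * g w) \<partial>MH)) \<le> S z"
          unfolding S_def by (rule integral_norm_bound_ennreal[OF int_g[OF that(1)]])
        then have "cmod (\<integral>w. B z w * (\<phi> w * g w) \<partial>MH) \<le> enn2real (S z)"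
          using that(1) by (metis enn2real_ennreal enn2real_mono norm_ge_zero infinity_ennreal_def)
        then show ?thesis
          unfolding toeplitz_eq[OF that(2)] fg using t by (simp add: norm_mult)
      qed
      have Sm: "S \<in> borel_measurable MH"
      proof -
        interpret sigma_finite_measure MH by (rule sigma_finite_MH)
        note pair_measurable_MH [measurable]
        have [measurable]: "(\<lambda>(z, w). B z w) \<in> borel_measurable (MH \<Otimes>\<^sub>M MH)"
          unfolding case_prod_unfold by measurable
        show ?thesis unfolding S_def by measurable
      qed
      have "(\<integral>\<^sup>+z. ennreal (cmod (toeplitz H \<phi> f z) powr r) \<partial>MH) \<le> (\<integral>\<^sup>+z. ennreal (t powr r) * (1 + ennreal (enn2real (S z) powr q)) \<partial>MH)"
      proof (rule nn_integral_mono_AE)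
        show "AE z in MH. ennreal (cmod (toeplitz H \<phi> f z) powr r) \<le> ennreal (t powr r) * (1 + ennreal (enn2real (S z) powr q))"
          using S(1) AE_space[of MH]
        proof eventually_elim
          case (elim z)
          define x where "x = enn2real (S z)"
          have x: "x \<ge> 0" by (simp add: x_def)
          have "cmod (toeplitz H \<phi> f z) powr r \<le> (t * x) powr r"
            using T_le[of z] elim r0 by (intro powr_mono2) (auto simp: x_def)
          also have "\<dots> = t powr r * x powr r" using t x by (simp add: powr_mult)
          also have "\<dots> \<le> t powr r * (1 + x powr q)"
          proof (rule mult_left_mono)
            show "x powr r \<le> 1 + x powr q"
            proof (cases "x \<le> 1")
              case True
              then have "x powr r \<le> 1" using x r0 by (intro powr_le1) auto
              then show ?thesis by (simp add: add_increasing2)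
            next
              case False
              then have "x powr r \<le> x powr q" using r by (intro powr_mono) auto
              then show ?thesis by simp
            qed
          qed simp
          finally have "ennreal (cmod (toeplitz H \<phi> f z) powr r) \<le> ennreal (t powr r * (1 + x powr q))"
            by (rule ennreal_leI)
          also have "\<dots> = ennreal (t powr r) * (1 + ennreal (x powr q))"
            by (simp add: ennreal_mult)
          finally show ?case by (simp add: x_def)
        qed
      qed
      also have "\<dots> = ennreal (t powr r) * (emeasure MH H + (\<integral>\<^sup>+z. ennreal (enn2real (S z) powr q) \<partial>MH))"
        using Sm by (simp add: nn_integral_cmult nn_integral_add)
      also have "\<dots> \<le> ennreal (t powr r) * (ennreal V + ennreal C)"
        using S(2) V(2) by (intro mult_left_mono add_mono) auto
      also have "\<dots> = ennreal (t powr r * C')"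
        using V C by (simp add: C'_def ennreal_mult add.commute)
      finally have le: "(\<integral>\<^sup>+z. ennreal (cmod (toeplitz H \<phi> f z) powr r) \<partial>MH) \<le> ennreal (t powr r * C')" .
      have int: "integrable MH (\<lambda>z. cmod (toeplitz H \<phi> f z) powr r)"
        by (rule integrableI_nonneg) (use le in \<open>auto intro: le_less_trans\<close>)
      have "ennreal (\<integral>z. cmod (toeplitz H \<phi> f z) powr r \<partial>MH) \<le> ennreal (t powr r * C')"
        using le by (subst nn_integral_eq_integral[symmetric]) (auto simp: int)
      then have "(\<integral>z. cmod (toeplitz H \<phi> f z) powr r \<partial>MH) \<le> t powr r * C'"
        using C' by (subst (asm) ennreal_le_iff) auto
      then have "Lp_norm r MH (toeplitz H \<phi> f) \<le> (t powr r * C') powr (1 / r)"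
        unfolding Lp_norm_def using r0 by (intro powr_mono2) auto
      also have "\<dots> = K * t" using t C' r0 by (simp add: powr_mult powr_powr K_def)
      also have "t = Lp_norm p MH f" by (simp add: t_def N_def Lp_norm_def)
      finally show ?thesis using 1 int by (simp add: Lp_space_def)
    qed
  qed
  show ?thesis
    unfolding toeplitz_bounded_def
  proof (intro exI[of _ K] ballI)
    fix f assume f: "f \<in> Lp_space p MH"
    have "AE z in MH. integrable MH (\<lambda>w. bergman_kernel H z w * (\<phi> w * f w))"
      using main[OF f, THEN conjunct1] AE_space[of MH]
      by eventually_elim (simp add: kernel_integrable_cong)
    with main[OF f] show "(AE z in MH. integrable MH (\<lambda>w. bergman_kernel H z w * (\<phi> w * f w))) \<and>
        toeplitz H \<phi> f \<in> Lp_space r MH \<and> Lp_norm r MH (toeplitz H \<phi> f) \<le> K * Lp_norm p MH f"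
      by blast
  qed
qed

theorem toeplitz_bounded_symbol:
  assumes p: "p > 1" "p \<le> q" and r: "1 \<le> r" "r \<le> q"
    and \<eta>': "0 \<le> \<eta>'" "\<eta>' \<le> \<eta>" "1 / q = 1 / p - \<eta>' / 2"
    and qM: "- kap * q + 2 * real n / real m > -2"
    and pL: "(real n * \<eta> - kap) * (p / (p - 1)) + 2 * real n / real m > -2"
  shows "toeplitz_bounded H (hartogs_symbol m n \<eta>) p r"
proof -
  obtain C where C: "C \<ge> 0" "\<And>f. f \<in> borel_measurable MH \<Longrightarrow> (\<integral>\<^sup>+w. ennreal (cmod (f w) powr p) \<partial>MH) \<le> 1 \<Longrightarrow>
    (AE z in MH. (\<integral>\<^sup>+w. ennreal (cmod (B z w * (hartogs_symbol m n \<eta> w * f w))) \<partial>MH) < \<infinity>) \<and>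
    (\<integral>\<^sup>+z. ennreal (enn2real (\<integral>\<^sup>+w. ennreal (cmod (B z w * (hartogs_symbol m n \<eta> w * f w))) \<partial>MH) powr q) \<partial>MH) \<le> ennreal C"
    using core_bound[OF p \<eta>' qM pL] by blast
  show ?thesis
    by (rule toeplitz_bounded_of_normalized[OF _ r C(1) symbol_measurable C(2)]) (use p in auto)
qed

end

subsection \<open>Necessity\<close>

lemma lborel_distr_rotation2:
  assumes c: "cmod u = 1" "cmod v = 1"
  shows "distr lborel borel (\<lambda>(x, y). (u * x, v * y)) = lborel"
proof (rule measure_eqI)
  have [measurable]: "(\<lambda>(x, y). (u * x, v * y)) \<in> borel_measurable borel"
    unfolding case_prod_unfold by measurable
  fix A assume "A \<in> sets (distr lborel borel (\<lambda>(x, y). (u * x, v * y)))"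
  then have A[measurable]: "A \<in> sets borel" by simp
  have Am: "(indicator A :: complex \<times> complex \<Rightarrow> ennreal) \<in> borel_measurable (lborel \<Otimes>\<^sub>M lborel)"
    by (simp add: lborel_prod)
  have m: "(\<lambda>p. indicator A (u * fst p, v * snd p) :: ennreal) \<in> borel_measurable (lborel \<Otimes>\<^sub>M lborel)"
    by (simp only: lborel_prod) measurable
  have "emeasure (distr lborel borel (\<lambda>(x, y). (u * x, v * y))) A = (\<integral>\<^sup>+p. indicator A (u * fst p, v * snd p) \<partial>lborel)"
    by (simp add: nn_integral_distr case_prod_unfold flip: nn_integral_indicator)
  also have "\<dots> = (\<integral>\<^sup>+p. indicator A (u * fst p, v * snd p) \<partial>(lborel \<Otimes>\<^sub>M lborel))"
    by (simp add: lborel_prod)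
  also have "\<dots> = (\<integral>\<^sup>+x. \<integral>\<^sup>+y. indicator A (u * x, v * y) \<partial>lborel \<partial>lborel)"
    by (subst lborel.nn_integral_fst[OF m, symmetric]) simp
  also have "\<dots> = (\<integral>\<^sup>+x. \<integral>\<^sup>+y. indicator A (u * x, y) \<partial>lborel \<partial>lborel)"
  proof (rule nn_integral_cong)
    fix x
    have [measurable]: "(\<lambda>y. indicator A (u * x, y) :: ennreal) \<in> borel_measurable borel" by measurable
    show "(\<integral>\<^sup>+y. indicator A (u * x, v * y) \<partial>lborel) = (\<integral>\<^sup>+y. indicator A (u * x, y) \<partial>lborel)"
      using c(2) nn_integral_complex_mult[of "\<lambda>y. indicator A (u * x, y)" v] by (cases "v = 0") auto
  qed
  also have "\<dots> = (\<integral>\<^sup>+x. \<integral>\<^sup>+y. indicator A (x, y) \<partial>lborel \<partial>lborel)"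
  proof -
    have "(\<lambda>x. \<integral>\<^sup>+y. indicator A (x, y) \<partial>lborel :: ennreal) \<in> borel_measurable lborel"
      by (rule lborel.borel_measurable_nn_integral_fst[OF Am])
    then show ?thesis
      using c(1) nn_integral_complex_mult[of "\<lambda>x. \<integral>\<^sup>+y. indicator A (x, y) \<partial>lborel" u] by (cases "u = 0") auto
  qed
  also have "\<dots> = emeasure lborel A"
    by (subst lborel.nn_integral_fst[OF Am]) (simp add: lborel_prod)
  finally show "emeasure (distr lborel borel (\<lambda>(x, y). (u * x, v * y))) A = emeasure lborel A" .
qed simp

context hartogs
begin

text \<open>\<open>H\<close> is invariant under independent rotations of its two coordinates, so
  either angle can separate powers of its coordinate.\<close>

lemma integral_MH_rotation_eq_0:
  fixes F :: "complex \<times> complex \<Rightarrow> complex"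
  assumes F[measurable]: "F \<in> borel_measurable borel" and c: "cmod u = 1" "cmod v = 1"
    and rot: "\<And>x y. F (u * x, v * y) = d * F (x, y)" and d: "d \<noteq> 1"
  shows "(\<integral>w. F w \<partial>MH) = 0"
proof -
  define G where "G w = indicator H w *\<^sub>R F w" for w
  have G[measurable]: "G \<in> borel_measurable borel" unfolding G_def by measurable
  have [measurable]: "(\<lambda>(x, y). (u * x, v * y)) \<in> borel_measurable borel"
    unfolding case_prod_unfold by measurable
  have rotG: "G (u * x, v * y) = d * G (x, y)" for x y
    using c by (simp add: G_def rot indicator_def mem_H norm_mult)
  have "(\<integral>w. F w \<partial>MH) = (\<integral>w. G w \<partial>lborel)"
    using G by (simp add: integral_MH_lborel G_def)
  also have "\<dots> = (\<integral>w. G (case w of (x, y) \<Rightarrow> (u * x, v * y)) \<partial>lborel)"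
    by (subst lborel_distr_rotation2[OF c, symmetric]) (simp add: integral_distr)
  also have "\<dots> = (\<integral>w. d * G w \<partial>lborel)"
    by (intro Bochner_Integration.integral_cong) (auto simp: rotG)
  also have "\<dots> = d * (\<integral>w. G w \<partial>lborel)" by simp
  finally have "(\<integral>w. G w \<partial>lborel) = 0" using d by (simp add: \<open>(\<integral>w. F w \<partial>MH) = (\<integral>w. G w \<partial>lborel)\<close>)
  then show ?thesis using \<open>(\<integral>w. F w \<partial>MH) = (\<integral>w. G w \<partial>lborel)\<close> by simp
qed

text \<open>Coprimality enters here: it gives n x = m y + 1, so n x - 1 has remainder 0 modulo m and
  \<open>jj (x - 1) = 1\<close>. Periodicity of \<open>jj\<close> brings the index below m.\<close>

lemma exists_jj_1:
  assumes "gcd m n = 1"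
  shows "\<exists>a<m. jj a = 1"
proof -
  from bezout_nat[of n m] n_pos assms obtain x y where xy: "n * x = m * y + 1"
    by (auto simp: gcd.commute)
  then have x: "x > 0" by (cases x) auto
  define a where "a = (x - 1) mod m"
  have "jj (x - 1) = 1" using x xy by (simp add: jj_def)
  moreover have "x - 1 = a + m * ((x - 1) div m)" by (simp add: a_def)
  ultimately have "jj a = 1" using jj_shift[of a "(x - 1) div m"] by simp
  moreover have "a < m" using m_pos by (simp add: a_def)
  ultimately show ?thesis by blast
qed

text \<open>For a given power a of z1, the square integrable monomial with the lowest power of z2.
  The extremal ones have \<open>jj a = 1\<close>.\<close>

definition monomial :: "nat \<Rightarrow> complex \<times> complex \<Rightarrow> complex" where
  "monomial a w = fst w ^ a * snd w powi ee a"

lemma monomial_measurable [measurable]: "monomial a \<in> borel_measurable borel"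
  unfolding monomial_def[abs_def] by measurable

lemma cmod_monomial: "cmod (monomial a w) = cmod (fst w) ^ a * cmod (snd w) powi ee a"
  by (simp add: monomial_def norm_mult norm_power norm_power_int)

lemma cmod_monomial_le: "w \<in> H \<Longrightarrow> cmod (monomial a w) \<le> cmod (snd w) powr (- kap)"
  unfolding cmod_monomial by (rule monomial_bound)

text \<open>Rotating w1 removes every other power of w1 from the kernel, and rotating w2 removes
  every positive power in \<open>hh\<close>, so a multiple of the monomial is left. The factor is
  the weighted squared norm divided by the plain one, m \<pi>^2 / (a + 1) for
  \<open>jj a = 1\<close>. The bound D secures the interchange of sum and integral.\<close>

lemma B_radial_integral:
  fixes \<psi> :: "real \<Rightarrow> real \<Rightarrow> real"
  assumes a: "a < m" "jj a = 1" and z: "z \<in> H"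
    and \<psi>[measurable]: "(\<lambda>w. \<psi> (cmod (fst w)) (cmod (snd w))) \<in> borel_measurable (borel :: (complex \<times> complex) measure)"
    and \<psi>0: "\<And>x y. \<psi> x y \<ge> 0"
    and D: "\<And>w. w \<in> H \<Longrightarrow> cmod (monomial a w) * \<psi> (cmod (fst w)) (cmod (snd w)) * cmod (snd w) powr (- kap) \<le> D"
  shows "(\<integral>w. B z w * (monomial a w * of_real (\<psi> (cmod (fst w)) (cmod (snd w)))) \<partial>MH)
    = of_real ((real a + 1) / (real m * pi\<^sup>2) * (\<integral>w. (cmod (monomial a w))\<^sup>2 * \<psi> (cmod (fst w)) (cmod (snd w)) \<partial>MH)) * monomial a z"
proof -
  define P where "P w = \<psi> (cmod (fst w)) (cmod (snd w))" for w :: "complex \<times> complex"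
  have P0: "P w \<ge> 0" for w by (simp add: P_def \<psi>0)
  have [measurable]: "P \<in> borel_measurable borel" unfolding P_def[abs_def] by measurable
  define F where "F w = monomial a w * of_real (P w)" for w
  have Fb[measurable]: "F \<in> borel_measurable borel" unfolding F_def[abs_def] by measurable
  have Fm: "F \<in> borel_measurable MH" by (rule measurable_MH) measurable
  note const = finite_measure.integrable_const[OF finite_measure_MH]
  have Fint: "integrable MH (\<lambda>w. cmod (snd w) powr (- kap) * cmod (F w))"
  proof (rule Bochner_Integration.integrable_bound[OF const[of D]])
    show "(\<lambda>w. cmod (snd w) powr (- kap) * cmod (F w)) \<in> borel_measurable MH"
      by (rule measurable_MH) measurable
    show "AE w in MH. norm (cmod (snd w) powr (- kap) * cmod (F w)) \<le> norm D"
    proof (intro AE_I2)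
      fix w assume "w \<in> space MH"
      then have "cmod (snd w) powr (- kap) * cmod (F w) \<le> D"
        using D[of w] P0[of w] by (simp add: F_def P_def norm_mult mult_ac)
      then show "norm (cmod (snd w) powr (- kap) * cmod (F w)) \<le> norm D" by simp
    qed
  qed
  define W where "W w = (cmod (monomial a w))\<^sup>2 * P w" for w
  have W0: "W w \<ge> 0" for w by (simp add: W_def P0)
  have [measurable]: "W \<in> borel_measurable borel" unfolding W_def[abs_def] by measurable
  have Wint: "integrable MH W"
  proof (rule Bochner_Integration.integrable_bound[OF const[of D]])
    show "W \<in> borel_measurable MH" by (rule measurable_MH) measurable
    show "AE w in MH. norm (W w) \<le> norm D"
    proof (intro AE_I2)
      fix w assume "w \<in> space MH"
      then have w: "w \<in> H" by simp
      have "W w = cmod (monomial a w) * P w * cmod (monomial a w)" by (simp add: W_def power2_eq_square)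
      also have "\<dots> \<le> cmod (monomial a w) * P w * cmod (snd w) powr (- kap)"
        using cmod_monomial_le[OF w] P0 by (intro mult_left_mono) auto
      also have "\<dots> \<le> D" using D[OF w] by (simp add: P_def)
      finally show "norm (W w) \<le> norm D" using W0[of w] by simp
    qed
  qed
  define I where "I = (\<integral>w. W w \<partial>MH)"
  have off: "(\<integral>w. bterm b z w * F w \<partial>MH) = 0" if "b \<noteq> a" for b
  proof (rule integral_MH_rotation_eq_0[where u="cis (pi / (real a - real b))" and v=1 and d="-1"])
    show "bterm b z (cis (pi / (real a - real b)) * x, 1 * y) * F (cis (pi / (real a - real b)) * x, 1 * y)
       = -1 * (bterm b z (x, y) * F (x, y))" for x y
      unfolding cis_rotation[OF that[symmetric], symmetric]
      by (simp add: bterm_def ss_def tt_def F_def monomial_def P_def norm_mult power_mult_distrib mult_ac)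
  qed auto
  have on: "(\<integral>w. bterm a z w * F w \<partial>MH) = of_nat (a + 1) * monomial a z * of_real I"
  proof -
    define f where "f l w = of_nat (a + 1) * monomial a z * of_real (W w) * ((1 + of_nat m * of_nat l) * tt z w ^ l)" for l w
    have [measurable]: "f l \<in> borel_measurable borel" for l unfolding f_def[abs_def] by measurable
    have sumz: "summable (\<lambda>l. cmod (of_nat (a + 1) * monomial a z) * ((1 + real m * real l) * cmod (snd z) ^ l))"
    proof -
      have "(\<lambda>l. (1 + of_nat m * of_nat l) * (of_real (cmod (snd z)) :: complex) ^ l) sums
        ((1 + (of_nat m - 1) * of_real (cmod (snd z))) / (1 - of_real (cmod (snd z)))\<^sup>2)"
        by (rule affine_geometric_sums) (use snd_less_1[OF z] in auto)
      then have "summable (\<lambda>l. of_real ((1 + real m * real l) * cmod (snd z) ^ l) :: complex)"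
        by (simp add: sums_iff)
      then show ?thesis by (subst (asm) summable_complex_of_real) (rule summable_mult)
    qed
    have "(\<lambda>l. \<integral>w. f l w \<partial>MH) sums (\<integral>w. (\<Sum>l. f l w) \<partial>MH)"
    proof (rule integral_sums_dominated(1)[OF _ Wint sumz])
      show "f l \<in> borel_measurable MH" for l by (rule measurable_MH) measurable
      fix l w assume "w \<in> space MH"
      then have w: "w \<in> H" by simp
      have "cmod (1 + of_nat m * of_nat l) = 1 + real m * real l"
      proof -
        have "cmod (of_nat (1 + m * l)) = real (1 + m * l)" by (rule norm_of_nat)
        then show ?thesis by simp
      qed
      then have "norm (f l w) = cmod (of_nat (a + 1) * monomial a z) * W w * ((1 + real m * real l) * cmod (tt z w) ^ l)"
        using W0[of w] by (simp only: f_def norm_mult norm_power norm_of_real abs_of_nonneg)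
      also have "\<dots> \<le> cmod (of_nat (a + 1) * monomial a z) * W w * ((1 + real m * real l) * cmod (snd z) ^ l)"
        using W0[of w] cmod_tt_less[OF w, of z] by (intro mult_left_mono power_mono mult_nonneg_nonneg) auto
      finally show "norm (f l w) \<le> cmod (of_nat (a + 1) * monomial a z) * ((1 + real m * real l) * cmod (snd z) ^ l) * W w"
        by (simp only: mult_ac)
    qed
    moreover have "(\<integral>w. f l w \<partial>MH) = (if l = 0 then of_nat (a + 1) * monomial a z * of_real I else 0)" for l
    proof (cases "l = 0")
      case True
      then have "(\<integral>w. f l w \<partial>MH) = (\<integral>w. of_nat (a + 1) * monomial a z * of_real (W w) \<partial>MH)"
        by (simp add: f_def)
      also have "\<dots> = of_nat (a + 1) * monomial a z * of_real I"
        by (simp only: I_def integral_mult_right_zero integral_complex_of_real)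
      finally show ?thesis using True by simp
    next
      case False
      have "(\<integral>w. f l w \<partial>MH) = 0"
      proof (rule integral_MH_rotation_eq_0[where u=1 and v="cis (pi / (real 0 - real l))" and d="-1"])
        have r: "cnj (cis (pi / (real 0 - real l))) ^ l = -1"
          using cis_rotation[of 0 l] False by simp
        show "f l (1 * x, cis (pi / (real 0 - real l)) * y) = -1 * f l (x, y)" for x y
          unfolding r[symmetric]
          by (simp add: f_def W_def P_def monomial_def tt_def norm_mult norm_power norm_power_int power_mult_distrib power_int_mult_distrib mult_ac)
      qed auto
      then show ?thesis using False by simp
    qed
    ultimately have "(\<lambda>l. if l = 0 then of_nat (a + 1) * monomial a z * of_real I else 0) sums (\<integral>w. (\<Sum>l. f l w) \<partial>MH)"
      by simp
    moreover have "(\<lambda>l. if l = 0 then of_nat (a + 1) * monomial a z * of_real I else 0) sums (of_nat (a + 1) * monomial a z * of_real I)"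
      using sums_single[of 0 "\<lambda>_. of_nat (a + 1) * monomial a z * of_real I"] by simp
    ultimately have "(\<integral>w. (\<Sum>l. f l w) \<partial>MH) = of_nat (a + 1) * monomial a z * of_real I"
      by (rule sums_unique2)
    moreover have "(\<integral>w. (\<Sum>l. f l w) \<partial>MH) = (\<integral>w. bterm a z w * F w \<partial>MH)"
    proof (intro Bochner_Integration.integral_cong refl)
      fix w assume "w \<in> space MH"
      then have w: "w \<in> H" by simp
      have "(\<lambda>l. f l w) sums (of_nat (a + 1) * monomial a z * of_real (W w) * hh a (tt z w))"
        unfolding f_def hh_def a(2) of_nat_1
        by (intro sums_mult affine_geometric_sums cmod_tt_lt_1 z w)
      also have "of_nat (a + 1) * monomial a z * of_real (W w) * hh a (tt z w) = bterm a z w * F w"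
      proof -
        have "complex_of_real (W w) = monomial a w * cnj (monomial a w) * of_real (P w)"
          unfolding W_def of_real_mult complex_norm_square ..
        moreover have "bterm a z w = of_nat (a + 1) * monomial a z * cnj (monomial a w) * hh a (tt z w)"
          by (simp add: bterm_def ss_def tt_def monomial_def power_mult_distrib power_int_mult_distrib cnj_powi mult_ac)
        ultimately show ?thesis by (simp add: F_def mult_ac)
      qed
      finally show "(\<Sum>l. f l w) = bterm a z w * F w" by (simp add: sums_iff)
    qed
    ultimately show ?thesis by simp
  qed
  have "(\<Sum>b<m. \<integral>w. bterm (b + m * k) z w * F w \<partial>MH) = (if k = 0 then of_nat (a + 1) * monomial a z * of_real I else 0)" for k
  proof (cases "k = 0")
    case True
    then have "(\<Sum>b<m. \<integral>w. bterm (b + m * k) z w * F w \<partial>MH) = (\<Sum>b<m. if b = a then of_nat (a + 1) * monomial a z * of_real I else 0)"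
      by (intro sum.cong) (auto simp: on off)
    then show ?thesis using True a by simp
  next
    case False
    \<comment> \<open>A later block has indices at least m > a, so all its terms vanish.\<close>
    then have "m * 1 \<le> m * k" by (intro mult_le_mono) auto
    then have "b + m * k \<noteq> a" for b
      using a(1) by linarith
    then show ?thesis using False by (simp add: off)
  qed
  with kernel_integral_sums(1)[OF z Fm Fint]
  have "(\<lambda>k. if k = 0 then of_nat (a + 1) * monomial a z * of_real I else 0) sums (of_real (real m * pi\<^sup>2) * (\<integral>w. B z w * F w \<partial>MH))"
    by simp
  moreover have "(\<lambda>k. if k = 0 then of_nat (a + 1) * monomial a z * of_real I else 0) sums (of_nat (a + 1) * monomial a z * of_real I)"
    using sums_single[of 0 "\<lambda>_. of_nat (a + 1) * monomial a z * of_real I"] by simp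
  ultimately have "of_real (real m * pi\<^sup>2) * (\<integral>w. B z w * F w \<partial>MH) = of_nat (a + 1) * monomial a z * of_real I"
    by (rule sums_unique2)
  moreover have "complex_of_real (real m * pi\<^sup>2) \<noteq> 0" using m_pos by simp
  ultimately have "(\<integral>w. B z w * F w \<partial>MH) = of_nat (a + 1) * monomial a z * of_real I / of_real (real m * pi\<^sup>2)"
    by (metis nonzero_mult_div_cancel_left)
  then show ?thesis by (simp add: F_def P_def I_def W_def add.commute)
qed

definition radial_symbol :: "real \<Rightarrow> real \<Rightarrow> real \<Rightarrow> real" where
  "radial_symbol \<eta> x y = (y ^ n - x ^ m) powr \<eta> * (1 - y\<^sup>2) powr \<eta>"

lemma radial_symbol_nonneg [simp]: "radial_symbol \<eta> x y \<ge> 0"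
  by (simp add: radial_symbol_def)

lemma symbol_eq: "hartogs_symbol m n \<eta> w = of_real (radial_symbol \<eta> (cmod (fst w)) (cmod (snd w)))"
  by (simp add: hartogs_symbol_def radial_symbol_def case_prod_unfold)

lemma radial_symbol_eq:
  "w \<in> H \<Longrightarrow> radial_symbol \<eta> (cmod (fst w)) (cmod (snd w))
    = cmod (snd w) powr (real n * \<eta>) * (1 - om w) powr \<eta> * (1 - (cmod (snd w))\<^sup>2) powr \<eta>"
  using cmod_symbol[of w \<eta>] by (simp add: symbol_eq)

lemma radial_symbol_le_1:
  assumes "w \<in> H" "\<eta> \<ge> 0"
  shows "radial_symbol \<eta> (cmod (fst w)) (cmod (snd w)) \<le> 1"
proof -
  have "cmod (snd w) \<le> 1" using snd_less_1[OF assms(1)] by simp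
  moreover from this have "(cmod (snd w))\<^sup>2 \<le> 1" by (simp add: power_le_one)
  moreover have "0 \<le> om w" "om w \<le> 1" using om_less_1[OF assms(1)] by auto
  ultimately show ?thesis
    unfolding radial_symbol_eq[OF assms(1)] using assms(2)
    by (intro mult_le_one powr_le1) (auto intro!: mult_nonneg_nonneg)
qed

lemma monomial_bergman_space: "monomial a \<in> bergman_space H"
proof -
  have hol: "monomial a holomorphic2_on H"
    unfolding holomorphic2_on_iff monomial_def[abs_def]
    by (auto intro!: holomorphic2_intros simp: mem_H_rad)
  have "integrable MH (\<lambda>w. (cmod (monomial a w))\<^sup>2)"
  proof (rule Bochner_Integration.integrable_bound[OF integrable_kap_square])
    show "(\<lambda>w. (cmod (monomial a w))\<^sup>2) \<in> borel_measurable MH" by (rule measurable_MH) measurable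
    show "AE w in MH. norm ((cmod (monomial a w))\<^sup>2) \<le> norm (cmod (snd w) powr (- 2 * kap))"
    proof (intro AE_I2)
      fix w assume "w \<in> space MH"
      then have "(cmod (monomial a w))\<^sup>2 \<le> (cmod (snd w) powr (- kap))\<^sup>2"
        by (intro power_mono cmod_monomial_le) auto
      also have "\<dots> = cmod (snd w) powr (- 2 * kap)"
        by (simp add: power2_eq_square powr_add[symmetric])
      finally show "norm ((cmod (monomial a w))\<^sup>2) \<le> norm (cmod (snd w) powr (- 2 * kap))" by simp
    qed
  qed
  with hol show ?thesis
    by (simp add: bergman_space_def Lp_space_2_iff measurable_MH)
qed

lemma monomial_not_AE_0: "\<not> (AE w in MH. monomial a w = 0)"
proof
  assume ae: "AE w in MH. monomial a w = 0"
  \<comment> \<open>A point (x, 1/2) of \<open>H\<close> with nonzero first coordinate: x \<le> 1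
    gives x^m \<le> x < (1/2)^n.\<close>
  define x :: real where "x = (1/2) ^ n / 2"
  have "(1/2 :: real) ^ n \<le> 1" "0 < (1/2 :: real) ^ n" by (auto simp: power_le_one)
  then have x: "x > 0" "x \<le> 1" "x < (1/2) ^ n" unfolding x_def by linarith+
  have "x ^ m \<le> x ^ 1" using x m_pos by (intro power_decreasing) auto
  then have "x ^ m < (1/2) ^ n" using x by simp
  then have "(complex_of_real x, 1/2) \<in> H"
    using x(1) by (simp add: mem_H norm_divide)
  from bergman_space_AE_0[OF monomial_bergman_space ae this] show False
    using x by (simp add: monomial_def)
qed

text \<open>The operator is tested on the functions that are extremal for pairing \<open>monomial a\<close> times the
  symbol with \<open>L\<^sup>p\<close>, cut off near \<open>z\<^sub>2 = 0\<close>; it maps each of them to a multiple of \<open>monomial a\<close>.\<close>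

lemma necessity:
  assumes a: "a < m" "jj a = 1" and p: "p > 1" and r: "r > 0" and \<eta>: "\<eta> \<ge> 0"
    and bdd: "toeplitz_bounded H (hartogs_symbol m n \<eta>) p r"
  shows "integrable MH (\<lambda>w. cmod (monomial a w) powr r)"
    and "(\<integral>\<^sup>+w. ennreal ((cmod (monomial a w) * cmod (hartogs_symbol m n \<eta> w)) powr (p / (p - 1))) \<partial>MH) < \<infinity>"
proof -
  define s where "s = p / (p - 1)"
  have s: "s > 1" "(s - 1) * p = s" "1 - 1 / p = 1 / s" "s > 0"
    using p by (auto simp: s_def field_simps)
  define Sy where "Sy w = radial_symbol \<eta> (cmod (fst w)) (cmod (snd w))" for w :: "complex \<times> complex"
  have Sy0: "Sy w \<ge> 0" for w by (simp add: Sy_def)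
  have sym: "hartogs_symbol m n \<eta> w = of_real (Sy w)" for w by (simp add: symbol_eq Sy_def)
  have [measurable]: "Sy \<in> borel_measurable borel"
    unfolding Sy_def[abs_def] radial_symbol_def by measurable
  define g where "g w = (cmod (monomial a w) * Sy w) powr s" for w
  have [measurable]: "g \<in> borel_measurable borel" unfolding g_def[abs_def] by measurable
  have g0: "g w \<ge> 0" for w by (simp add: g_def)
  \<comment> \<open>The cutoff |w2| \<ge> \<delta> bounds the quantities to be integrated, so the
    norms are finite before \<delta> tends to 0.\<close>
  define ind where "ind \<delta> w = (indicator {\<delta>..} (cmod (snd w)) :: real)" for \<delta> :: real and w :: "complex \<times> complex"
  have [measurable]: "ind \<delta> \<in> borel_measurable borel" for \<delta> unfolding ind_def[abs_def] by measurable
  define \<psi> where "\<psi> \<delta> x y = (x ^ a * y powi ee a) powr (s - 2) * radial_symbol \<eta> x y powr s * indicator {\<delta>..} y" for \<delta> x y :: real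
  define I where "I \<delta> = (\<integral>w. g w * ind \<delta> w \<partial>MH)" for \<delta>
  define c where "c = (real a + 1) / (real m * pi\<^sup>2)"
  have c: "c > 0" using m_pos by (simp add: c_def)
  \<comment> \<open>The equality case of Hoelder's inequality: since (s - 1) p = s, both the p-th
    power of the norm of \<open>f \<delta>\<close> and the pairing of the symbol times
    \<open>f \<delta>\<close> with the monomial are equal to \<open>I \<delta>\<close>.\<close>
  define f where "f \<delta> w = monomial a w * of_real (cmod (monomial a w) powr (s - 2) * Sy w powr (s - 1) * ind \<delta> w)" for \<delta> w
  have [measurable]: "f \<delta> \<in> borel_measurable borel" for \<delta> unfolding f_def[abs_def] by measurable
  have \<psi>_eq: "\<psi> \<delta> (cmod (fst w)) (cmod (snd w)) = cmod (monomial a w) powr (s - 2) * Sy w powr s * ind \<delta> w" for \<delta> w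
    by (simp add: \<psi>_def cmod_monomial Sy_def ind_def)
  have mult_powr: "x * x powr t = x powr (t + 1)" if "x \<ge> 0" for x t :: real
    using that by (cases "x = 0") (auto simp: powr_add)
  have W_eq: "(cmod (monomial a w))\<^sup>2 * \<psi> \<delta> (cmod (fst w)) (cmod (snd w)) = g w * ind \<delta> w" for \<delta> w
  proof -
    have "(cmod (monomial a w))\<^sup>2 * cmod (monomial a w) powr (s - 2) = cmod (monomial a w) * (cmod (monomial a w) * cmod (monomial a w) powr (s - 2))"
      by (simp add: power2_eq_square)
    also have "\<dots> = cmod (monomial a w) powr s" by (simp add: mult_powr)
    finally show ?thesis
      unfolding \<psi>_eq using Sy0[of w] by (simp add: g_def powr_mult)
  qed
  have f_norm: "cmod (f \<delta> w) powr p = g w * ind \<delta> w" for \<delta> w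
  proof -
    have "cmod (f \<delta> w) = (cmod (monomial a w) * cmod (monomial a w) powr (s - 2)) * Sy w powr (s - 1) * ind \<delta> w"
      by (simp add: f_def norm_mult abs_mult ind_def)
    also have "\<dots> = cmod (monomial a w) powr (s - 1) * Sy w powr (s - 1) * ind \<delta> w"
      by (simp add: mult_powr)
    finally show ?thesis
      using Sy0[of w] p by (auto simp: g_def powr_mult powr_powr s(2) ind_def indicator_def)
  qed
  have mono_g: "cmod (monomial a w) * \<psi> \<delta> (cmod (fst w)) (cmod (snd w)) \<le> \<delta> powr (- kap * (s - 1))"
    and g_le: "g w * ind \<delta> w \<le> \<delta> powr (- kap * s)"
    if \<delta>: "\<delta> > 0" and w: "w \<in> H" for \<delta> w
  proof -
    have Sy1: "Sy w \<le> 1" unfolding Sy_def by (rule radial_symbol_le_1[OF w \<eta>])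
    have Sys: "Sy w powr s \<le> 1" using Sy0 Sy1 s by (intro powr_le1) auto
    have mono_le: "cmod (monomial a w) powr t \<le> \<delta> powr (- kap * t)" if "t > 0" "\<delta> \<le> cmod (snd w)" for t
    proof -
      have "cmod (monomial a w) \<le> \<delta> powr (- kap)"
        using cmod_monomial_le[OF w] that \<delta> kap_nonneg by (meson order_trans powr_mono2' neg_le_0_iff_le)
      then have "cmod (monomial a w) powr t \<le> (\<delta> powr (- kap)) powr t"
        using that by (intro powr_mono2) auto
      then show ?thesis by (simp add: powr_powr)
    qed
    show "cmod (monomial a w) * \<psi> \<delta> (cmod (fst w)) (cmod (snd w)) \<le> \<delta> powr (- kap * (s - 1))"
    proof (cases "\<delta> \<le> cmod (snd w)")
      case True
      have "cmod (monomial a w) * \<psi> \<delta> (cmod (fst w)) (cmod (snd w)) = (cmod (monomial a w) * cmod (monomial a w) powr (s - 2)) * Sy w powr s"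
        using True by (simp add: \<psi>_eq ind_def)
      also have "\<dots> = cmod (monomial a w) powr (s - 1) * Sy w powr s" by (simp add: mult_powr)
      also have "\<dots> \<le> \<delta> powr (- kap * (s - 1)) * 1"
        using Sys True s by (intro mult_mono mono_le) auto
      finally show ?thesis by simp
    qed (simp add: \<psi>_eq ind_def)
    show "g w * ind \<delta> w \<le> \<delta> powr (- kap * s)"
    proof (cases "\<delta> \<le> cmod (snd w)")
      case True
      have "g w * ind \<delta> w = cmod (monomial a w) powr s * Sy w powr s"
        using True Sy0 by (simp add: g_def powr_mult ind_def)
      also have "\<dots> \<le> \<delta> powr (- kap * s) * 1"
        using Sys True s by (intro mult_mono mono_le) auto
      finally show ?thesis by simp
    qed (simp add: ind_def)
  qed
  have g_int: "integrable MH (\<lambda>w. g w * ind \<delta> w)" if \<delta>: "\<delta> > 0" for \<delta>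
  proof (rule Bochner_Integration.integrable_bound[OF finite_measure.integrable_const[OF finite_measure_MH, of "\<delta> powr (- kap * s)"]])
    show "(\<lambda>w. g w * ind \<delta> w) \<in> borel_measurable MH" by (rule measurable_MH) measurable
    show "AE w in MH. norm (g w * ind \<delta> w) \<le> norm (\<delta> powr (- kap * s))"
      using g_le[OF \<delta>] g0 by (intro AE_I2) (auto simp: ind_def abs_mult)
  qed
  have T_eq: "toeplitz H (hartogs_symbol m n \<eta>) (f \<delta>) z = of_real (c * I \<delta>) * monomial a z"
    if \<delta>: "\<delta> > 0" and z: "z \<in> H" for \<delta> z
  proof -
    have "hartogs_symbol m n \<eta> w * f \<delta> w = monomial a w * of_real (\<psi> \<delta> (cmod (fst w)) (cmod (snd w)))" for w
    proof -
      have "Sy w * Sy w powr (s - 1) = Sy w powr s" using Sy0 by (simp add: mult_powr)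
      then have "\<psi> \<delta> (cmod (fst w)) (cmod (snd w)) = Sy w * (cmod (monomial a w) powr (s - 2) * Sy w powr (s - 1) * ind \<delta> w)"
        unfolding \<psi>_eq by (simp add: mult_ac)
      then show ?thesis by (simp only: sym f_def of_real_mult mult_ac)
    qed
    then have "toeplitz H (hartogs_symbol m n \<eta>) (f \<delta>) z = (\<integral>w. B z w * (monomial a w * of_real (\<psi> \<delta> (cmod (fst w)) (cmod (snd w)))) \<partial>MH)"
      unfolding toeplitz_eq[OF z] by simp
    also have "\<dots> = of_real ((real a + 1) / (real m * pi\<^sup>2) * (\<integral>w. (cmod (monomial a w))\<^sup>2 * \<psi> \<delta> (cmod (fst w)) (cmod (snd w)) \<partial>MH)) * monomial a z"
    proof (rule B_radial_integral[OF a z])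
      show "(\<lambda>w. \<psi> \<delta> (cmod (fst w)) (cmod (snd w))) \<in> borel_measurable (borel :: (complex \<times> complex) measure)"
        unfolding \<psi>_eq by measurable
      show "\<psi> \<delta> x y \<ge> 0" for x y by (simp add: \<psi>_def)
      fix w assume w: "w \<in> H"
      show "cmod (monomial a w) * \<psi> \<delta> (cmod (fst w)) (cmod (snd w)) * cmod (snd w) powr (- kap) \<le> \<delta> powr (- kap * (s - 1)) * \<delta> powr (- kap)"
      proof (cases "\<delta> \<le> cmod (snd w)")
        case True
        then have "cmod (snd w) powr (- kap) \<le> \<delta> powr (- kap)"
          using \<delta> kap_nonneg by (intro powr_mono2') auto
        then show ?thesis
          by (intro mult_mono mono_g[OF \<delta> w]) auto
      qed (simp add: \<psi>_eq ind_def)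
    qed
    finally show ?thesis by (simp only: W_eq I_def c_def)
  qed
  have I0: "I \<delta> \<ge> 0" for \<delta> unfolding I_def by (rule Bochner_Integration.integral_nonneg) (simp add: g0 ind_def)
  obtain C where C: "\<And>f. f \<in> Lp_space p MH \<Longrightarrow> toeplitz H (hartogs_symbol m n \<eta>) f \<in> Lp_space r MH \<and>
       Lp_norm r MH (toeplitz H (hartogs_symbol m n \<eta>) f) \<le> C * Lp_norm p MH f"
    using bdd unfolding toeplitz_bounded_def by blast
  have f_Lp: "f \<delta> \<in> Lp_space p MH" if "\<delta> > 0" for \<delta>
    using g_int[OF that] by (simp add: Lp_space_def f_norm measurable_MH)
  \<comment> \<open>Exhaustion by |w2| \<ge> 1/(k+1): the second coordinate never vanishes on
    \<open>H\<close>, so monotone convergence recovers the full integral.\<close>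
  define SI where "SI = (\<lambda>k. \<integral>\<^sup>+w. ennreal (g w * ind (1 / real (Suc k)) w) \<partial>MH)"
  have SI: "SI k = ennreal (I (1 / real (Suc k)))" for k
    unfolding SI_def I_def by (intro nn_integral_eq_integral g_int) (auto simp: g0 ind_def)
  have sup: "(\<integral>\<^sup>+w. ennreal (g w) \<partial>MH) = (SUP k. SI k)"
  proof -
    have "(\<integral>\<^sup>+w. (SUP k. ennreal (g w * ind (1 / real (Suc k)) w)) \<partial>MH) = (SUP k. SI k)"
      unfolding SI_def
    proof (rule nn_integral_monotone_convergence_SUP)
      show "incseq (\<lambda>k w. ennreal (g w * ind (1 / real (Suc k)) w))"
      proof (intro incseq_SucI le_funI ennreal_leI mult_left_mono g0)
        fix k w
        have "1 / real (Suc (Suc k)) \<le> 1 / real (Suc k)" by (simp add: frac_le)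
        then show "ind (1 / real (Suc k)) w \<le> ind (1 / real (Suc (Suc k))) w"
          by (auto simp: ind_def indicator_def)
      qed
      show "(\<lambda>w. ennreal (g w * ind (1 / real (Suc k)) w)) \<in> borel_measurable MH" for k
        by (rule measurable_MH) measurable
    qed
    moreover have "(\<integral>\<^sup>+w. (SUP k. ennreal (g w * ind (1 / real (Suc k)) w)) \<partial>MH) = (\<integral>\<^sup>+w. ennreal (g w) \<partial>MH)"
    proof (intro nn_integral_cong antisym)
      fix w assume "w \<in> space MH"
      then have "cmod (snd w) > 0" using snd_nonzero[of w] by simp
      then obtain k where "1 / real (Suc k) < cmod (snd w)"
        using nat_approx_posE by metis
      then have "ennreal (g w) = ennreal (g w * ind (1 / real (Suc k)) w)" by (simp add: ind_def)
      also have "\<dots> \<le> (SUP k. ennreal (g w * ind (1 / real (Suc k)) w))" by (rule SUP_upper) simp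
      finally show "ennreal (g w) \<le> (SUP k. ennreal (g w * ind (1 / real (Suc k)) w))" .
      show "(SUP k. ennreal (g w * ind (1 / real (Suc k)) w)) \<le> ennreal (g w)"
        by (intro SUP_least ennreal_leI) (auto simp: ind_def indicator_def g0)
    qed
    ultimately show ?thesis by simp
  qed
  \<comment> \<open>A positive \<open>I\<close> means that the image is a nonzero multiple of the
    monomial; one such test function suffices for its r-integrability.\<close>
  have "\<exists>k. I (1 / real (Suc k)) > 0"
  proof (rule ccontr)
    assume "\<not> (\<exists>k. I (1 / real (Suc k)) > 0)"
    then have "SI k = 0" for k using I0[of "1 / real (Suc k)"] unfolding SI by (metis ennreal_0 less_eq_real_def)
    then have "(\<integral>\<^sup>+w. ennreal (g w) \<partial>MH) = 0" unfolding sup by simp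
    then have "AE w in MH. ennreal (g w) = 0"
      by (subst (asm) nn_integral_0_iff_AE) (auto intro!: measurable_MH)
    then have "AE w in MH. monomial a w = 0"
      using AE_space[of MH]
    proof eventually_elim
      case (elim w)
      then have w: "w \<in> H" by simp
      have "(cmod (snd w))\<^sup>2 < 1"
        using snd_less_1[OF w] by (simp add: power_less_one_iff)
      then have "Sy w > 0"
        unfolding Sy_def radial_symbol_eq[OF w] using snd_nonzero[OF w] om_less_1[OF w] by simp
      moreover have "g w = 0" using elim(1) g0[of w] by (simp add: ennreal_eq_0_iff)
      ultimately show "monomial a w = 0" by (simp add: g_def)
    qed
    with monomial_not_AE_0 show False by blast
  qed
  then obtain k where k: "I (1 / real (Suc k)) > 0" by blast
  have norm_eq: "cmod (toeplitz H (hartogs_symbol m n \<eta>) (f \<delta>) z) powr r = (c * I \<delta>) powr r * cmod (monomial a z) powr r"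
    if "\<delta> > 0" "z \<in> H" for \<delta> z
    unfolding T_eq[OF that] norm_mult norm_of_real using c I0[of \<delta>] by (simp add: powr_mult abs_mult)
  show mono_int: "integrable MH (\<lambda>w. cmod (monomial a w) powr r)"
  proof -
    define \<delta> where "\<delta> = 1 / real (Suc k)"
    have \<delta>: "\<delta> > 0" by (simp add: \<delta>_def)
    have "integrable MH (\<lambda>z. cmod (toeplitz H (hartogs_symbol m n \<eta>) (f \<delta>) z) powr r)"
      using C[OF f_Lp[OF \<delta>]] by (simp add: Lp_space_def)
    then have "integrable MH (\<lambda>z. (c * I \<delta>) powr r * cmod (monomial a z) powr r)"
      by (rule Bochner_Integration.integrable_cong[THEN iffD1, rotated 2]) (auto simp: norm_eq[OF \<delta>])
    then have "integrable MH (\<lambda>z. 1 / (c * I \<delta>) powr r * ((c * I \<delta>) powr r * cmod (monomial a z) powr r))"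
      by (rule integrable_mult_right)
    moreover have "(c * I \<delta>) powr r \<noteq> 0" using c k by (simp add: \<delta>_def)
    ultimately show ?thesis by simp
  qed
  define J where "J = (\<integral>w. cmod (monomial a w) powr r \<partial>MH)"
  have J: "J > 0"
  proof -
    have "J \<ge> 0" unfolding J_def by (rule Bochner_Integration.integral_nonneg) simp
    moreover have "J \<noteq> 0"
    proof
      assume "J = 0"
      then have "AE w in MH. cmod (monomial a w) powr r = 0"
        unfolding J_def by (subst (asm) integral_nonneg_eq_0_iff_AE[OF mono_int]) auto
      then have "AE w in MH. monomial a w = 0" by eventually_elim simp
      with monomial_not_AE_0 show False by blast
    qed
    ultimately show ?thesis by simp
  qed
  define R where "R = J powr (1 / r)"
  have R: "R > 0" using J by (simp add: R_def)
  \<comment> \<open>Boundedness reads c I R \<le> C I^(1/p), with R the r-norm of the monomial.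
    Dividing by I^(1/p) bounds I^(1/s) independently of \<delta>, which passes to the limit.\<close>
  have I_le: "I \<delta> \<le> (C / (c * R)) powr s" if \<delta>: "\<delta> > 0" for \<delta>
  proof (cases "I \<delta> = 0")
    case False
    then have Ip: "I \<delta> > 0" using I0[of \<delta>] by simp
    have "(\<integral>z. cmod (toeplitz H (hartogs_symbol m n \<eta>) (f \<delta>) z) powr r \<partial>MH) = (\<integral>z. (c * I \<delta>) powr r * cmod (monomial a z) powr r \<partial>MH)"
      by (intro Bochner_Integration.integral_cong) (auto simp: norm_eq[OF \<delta>])
    also have "\<dots> = (c * I \<delta>) powr r * J" by (simp add: J_def)
    finally have "Lp_norm r MH (toeplitz H (hartogs_symbol m n \<eta>) (f \<delta>)) = c * I \<delta> * R"
      using c Ip r J by (simp add: Lp_norm_def powr_mult powr_powr R_def)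
    moreover have "Lp_norm p MH (f \<delta>) = I \<delta> powr (1 / p)"
      by (simp add: Lp_norm_def f_norm I_def)
    ultimately have "c * I \<delta> * R \<le> C * I \<delta> powr (1 / p)"
      using C[OF f_Lp[OF \<delta>]] by simp
    then have "I \<delta> / I \<delta> powr (1 / p) \<le> C / (c * R)"
      using c R Ip by (simp add: field_simps)
    moreover have "I \<delta> / I \<delta> powr (1 / p) = I \<delta> powr (1 / s)"
      using Ip powr_diff[of "I \<delta>" 1 "1 / p"] by (simp add: s(3))
    ultimately have "(I \<delta> powr (1 / s)) powr s \<le> (C / (c * R)) powr s"
      using s by (intro powr_mono2) auto
    then show ?thesis using Ip s by (simp add: powr_powr)
  qed simp
  have "(\<integral>\<^sup>+w. ennreal (g w) \<partial>MH) \<le> ennreal ((C / (c * R)) powr s)"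
    unfolding sup SI by (intro SUP_least ennreal_leI I_le) simp
  also have "\<dots> < \<infinity>" by simp
  finally have "(\<integral>\<^sup>+w. ennreal (g w) \<partial>MH) < \<infinity>" .
  moreover have "(cmod (monomial a w) * cmod (hartogs_symbol m n \<eta> w)) powr (p / (p - 1)) = g w" for w
    using Sy0[of w] by (simp add: g_def sym s_def)
  ultimately show "(\<integral>\<^sup>+w. ennreal ((cmod (monomial a w) * cmod (hartogs_symbol m n \<eta> w)) powr (p / (p - 1))) \<partial>MH) < \<infinity>"
    by simp
qed

section \<open>Divergence of the extremal monomial\<close>

lemma jj_1_exponent:
  assumes "jj a = 1"
  shows "real m * of_int (ee a) + real n * real a = 1 - real m - real n"
  using real_jj[of a] assms by (simp add: algebra_simps)

text \<open>Equality can fail: at w1 = 0 with a = 0 the left side contains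
  \<open>0 powr 0 = 0\<close>, whereas the monomial contains \<open>0 ^ 0 = 1\<close>.\<close>

lemma monomial_powr_ge:
  assumes w: "w \<in> H" and s: "s > 0"
  shows "cmod (fst w) powr (real a * s) * cmod (snd w) powr (of_int (ee a) * s) \<le> cmod (monomial a w) powr s"
proof -
  have w2: "cmod (snd w) > 0" using snd_nonzero[OF w] by simp
  have "cmod (fst w) powr (real a * s) \<le> (cmod (fst w) ^ a) powr s"
  proof (cases "fst w = 0")
    case False
    then show ?thesis by (simp add: powr_powr flip: powr_realpow)
  qed simp
  moreover have "cmod (snd w) powr (of_int (ee a) * s) = (cmod (snd w) powi ee a) powr s"
    using w2 powr_real_of_int'[of "cmod (snd w)" "ee a"] by (simp add: powr_powr[symmetric])
  ultimately show ?thesis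
    unfolding cmod_monomial using w2 by (simp add: powr_mult mult_right_mono)
qed

text \<open>The condition on r is r \<ge> M with the denominator cleared. By
  \<open>jj_1_exponent\<close> it says that |w2| carries an exponent of at most -2 after integration
  over the slices.\<close>

lemma monomial_not_integrable:
  assumes a: "jj a = 1" and r: "r > 0" "r * (real m + real n - 1) \<ge> 2 * (real m + real n)"
  shows "\<not> integrable MH (\<lambda>w. cmod (monomial a w) powr r)"
proof
  assume int: "integrable MH (\<lambda>w. cmod (monomial a w) powr r)"
  have "real m * (of_int (ee a) * r + real n * (real a * r + 2) / real m) = r * (real m * of_int (ee a) + real n * real a) + 2 * real n"
    using m_pos by (simp add: field_simps)
  also have "\<dots> \<le> real m * (-2)"
    unfolding jj_1_exponent[OF a] using r by (simp add: algebra_simps)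
  finally have "of_int (ee a) * r + real n * (real a * r + 2) / real m \<le> -2"
    using m_pos by (simp only: mult_le_cancel_left_pos of_nat_0_less_iff)
  from nn_integral_monomial_infinite[OF _ this]
  have "\<infinity> = (\<integral>\<^sup>+w. ennreal (cmod (fst w) powr (real a * r) * cmod (snd w) powr (of_int (ee a) * r))
     * indicator {w. om w < 1/2 \<and> cmod (snd w) < 1/2} w \<partial>MH)"
    using r by simp
  also have "\<dots> \<le> (\<integral>\<^sup>+w. ennreal (cmod (monomial a w) powr r) \<partial>MH)"
    by (intro nn_integral_mono) (auto simp: indicator_def intro!: ennreal_leI monomial_powr_ge r)
  also have "\<dots> < \<infinity>"
    using int by (simp add: integrable_iff_bounded)
  finally show False by simp
qed

text \<open>With s = p/(p-1), the hypothesis \<open>le\<close> is the failure of the dual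
  integrability condition: p (m + n + 1 + m n \<eta>) is at most 2m + 2n.\<close>

lemma monomial_symbol_infinite:
  assumes a: "jj a = 1" and s: "s > 0" and \<eta>: "\<eta> \<ge> 0"
    and le: "s * (real m * real n * \<eta> + 1 - real m - real n) + 2 * (real m + real n) \<le> 0"
  shows "(\<integral>\<^sup>+w. ennreal ((cmod (monomial a w) * cmod (hartogs_symbol m n \<eta> w)) powr s) \<partial>MH) = \<infinity>"
proof -
  \<comment> \<open>Where \<open>om w < 1/2\<close> and |w2| < 1/2, each of the two boundary weights
    of the symbol is at least (1/2)^\<eta>; their product to the power s gives K.\<close>
  define K where "K = (1/4) powr (\<eta> * s)"
  have K: "K > 0" by (simp add: K_def)
  have "real m * ((of_int (ee a) + real n * \<eta>) * s + real n * (real a * s + 2) / real m)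
    = s * (real m * of_int (ee a) + real n * real a) + s * (real m * real n * \<eta>) + 2 * real n"
    using m_pos by (simp add: field_simps)
  also have "\<dots> \<le> real m * (-2)"
    unfolding jj_1_exponent[OF a] using le by (simp add: algebra_simps)
  finally have "(of_int (ee a) + real n * \<eta>) * s + real n * (real a * s + 2) / real m \<le> -2"
    using m_pos by (simp only: mult_le_cancel_left_pos of_nat_0_less_iff)
  from nn_integral_monomial_infinite[OF _ this]
  have "\<infinity> = ennreal K * (\<integral>\<^sup>+w. ennreal (cmod (fst w) powr (real a * s) * cmod (snd w) powr ((of_int (ee a) + real n * \<eta>) * s))
     * indicator {w. om w < 1/2 \<and> cmod (snd w) < 1/2} w \<partial>MH)"
    using s K by (simp add: ennreal_mult_top)
  also have "\<dots> = (\<integral>\<^sup>+w. ennreal K * (ennreal (cmod (fst w) powr (real a * s) * cmod (snd w) powr ((of_int (ee a) + real n * \<eta>) * s))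
     * indicator {w. om w < 1/2 \<and> cmod (snd w) < 1/2} w) \<partial>MH)"
    by (rule nn_integral_cmult[symmetric], rule measurable_MH) measurable
  also have "\<dots> \<le> (\<integral>\<^sup>+w. ennreal ((cmod (monomial a w) * cmod (hartogs_symbol m n \<eta> w)) powr s) \<partial>MH)"
  proof (intro nn_integral_mono)
    fix w assume "w \<in> space MH"
    then have w: "w \<in> H" by simp
    show "ennreal K * (ennreal (cmod (fst w) powr (real a * s) * cmod (snd w) powr ((of_int (ee a) + real n * \<eta>) * s))
     * indicator {w. om w < 1/2 \<and> cmod (snd w) < 1/2} w) \<le> ennreal ((cmod (monomial a w) * cmod (hartogs_symbol m n \<eta> w)) powr s)"
    proof (cases "om w < 1/2 \<and> cmod (snd w) < 1/2")
      case True
      have w2: "cmod (snd w) > 0" using snd_nonzero[OF w] by simp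
      have "(cmod (snd w))\<^sup>2 \<le> (1/2)\<^sup>2" using True by (intro power_mono) auto
      then have "1 - (cmod (snd w))\<^sup>2 \<ge> 1/2" by (simp add: power2_eq_square)
      then have 1: "(1/2) powr \<eta> \<le> (1 - (cmod (snd w))\<^sup>2) powr \<eta>" using \<eta> by (intro powr_mono2) auto
      have 2: "(1/2) powr \<eta> \<le> (1 - om w) powr \<eta>" using True \<eta> by (intro powr_mono2) auto
      have "cmod (snd w) powr (real n * \<eta>) * (1/2) powr \<eta> * (1/2) powr \<eta> \<le> cmod (hartogs_symbol m n \<eta> w)"
        unfolding cmod_symbol[OF w] by (intro mult_mono 1 2 mult_nonneg_nonneg) auto
      then have "(cmod (snd w) powr (real n * \<eta>) * (1/2) powr \<eta> * (1/2) powr \<eta>) powr s \<le> cmod (hartogs_symbol m n \<eta> w) powr s"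
        using s by (intro powr_mono2) auto
      moreover have "(cmod (snd w) powr (real n * \<eta>) * (1/2) powr \<eta> * (1/2) powr \<eta>) powr s = K * cmod (snd w) powr (real n * \<eta> * s)"
      proof -
        have "(1/2) powr \<eta> * (1/2) powr \<eta> = (1/4 :: real) powr \<eta>"
          by (simp flip: powr_mult)
        then show ?thesis by (simp add: K_def powr_mult powr_powr mult.assoc)
      qed
      ultimately have 3: "K * cmod (snd w) powr (real n * \<eta> * s) \<le> cmod (hartogs_symbol m n \<eta> w) powr s" by simp
      have "K * (cmod (fst w) powr (real a * s) * cmod (snd w) powr ((of_int (ee a) + real n * \<eta>) * s))
        = (cmod (fst w) powr (real a * s) * cmod (snd w) powr (of_int (ee a) * s)) * (K * cmod (snd w) powr (real n * \<eta> * s))"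
        by (simp add: distrib_right powr_add)
      also have "\<dots> \<le> cmod (monomial a w) powr s * cmod (hartogs_symbol m n \<eta> w) powr s"
        using K by (intro mult_mono monomial_powr_ge w s 3) auto
      also have "\<dots> = (cmod (monomial a w) * cmod (hartogs_symbol m n \<eta> w)) powr s"
        by (simp add: powr_mult)
      finally show ?thesis
        using True K by (simp add: ennreal_leI flip: ennreal_mult)
    qed simp
  qed
  finally show ?thesis by (simp add: top_unique)
qed

end

section \<open>Assembly of the exponent ranges\<close>

theorem theorem1p2:
  fixes m n :: nat and \<eta> M L :: real
    and G :: "real \<Rightarrow> real"
    and T_bounded :: "real \<Rightarrow> real \<Rightarrow> bool"
  assumes "m > 0" and "n > 0" and "gcd m n = 1" and "\<eta> \<ge> 0"
    and "M = (2 * real m + 2 * real n) / (real m + real n - 1)"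
    and "L = max ((2 * real m + 2 * real n) / (real m + real n + 1 + real m * real n * \<eta>)) 1"
    and "\<And>p. G p = (if \<eta> = 0 then 0 else p\<^sup>2 / (2 / \<eta> - p))"
    and "\<And>p r. T_bounded p r \<longleftrightarrow>
           toeplitz_bounded (hartogs_triangle (real m / real n)) (hartogs_symbol m n \<eta>) p r"
  shows "(\<forall>p\<in>{L<..<M}.
            (\<eta> \<ge> 2 * (1 / p - 1 / M) \<longrightarrow> (\<forall>r. 1 \<le> r \<and> r < M \<longrightarrow> T_bounded p r)) \<and>
            (\<eta> < 2 * (1 / p - 1 / M) \<longrightarrow> T_bounded p (p + G p) \<and> p + G p < M)) \<and>
         (\<forall>p\<in>{1<..L} \<union> {M..}. \<forall>r\<ge>p. \<not> T_bounded p r)"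
proof -
  interpret hartogs m n by standard (use assms in auto)
  have mn1: "real m + real n - 1 > 0" using assms(1,2) by simp
  have M0: "M > 1" using assms(1,2) mn1 unfolding assms(5) by (simp add: field_simps)
  have L1: "L \<ge> 1" unfolding assms(6) by simp
  \<comment> \<open>Multiplied by m, this is q (m + n - 1) < 2m + 2n, the definition of M.\<close>
  have qM: "- kap * q + 2 * real n / real m > -2" if "q < M" for q
  proof -
    have "q * (real m + real n - 1) < 2 * real m + 2 * real n"
      using that mn1 unfolding assms(5) by (simp add: field_simps)
    moreover have "real m * (- kap * q + 2 * real n / real m) = - (real m + real n - 1) * q + 2 * real n"
    proof -
      have "real m * (- kap * q + 2 * real n / real m) = - (real m * kap) * q + 2 * real n"
        using m_pos by (simp add: algebra_simps)
      moreover have "real m * kap = real m + real n - 1" using m_pos by (simp add: kap_def)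
      ultimately show ?thesis by (simp only:)
    qed
    ultimately have "real m * (-2) < real m * (- kap * q + 2 * real n / real m)"
      by (simp add: algebra_simps)
    then show ?thesis using m_pos by (simp only: mult_less_cancel_left_pos of_nat_0_less_iff)
  qed
  \<comment> \<open>Multiplied by m (p - 1), this is p (m + n + 1 + m n \<eta>) > 2m + 2n, the first
    entry of the maximum L.\<close>
  have pL: "(real n * \<eta> - kap) * (p / (p - 1)) + 2 * real n / real m > -2" if "p > L" for p
  proof -
    have p1: "p > 1" using that L1 by simp
    define D where "D = real m + real n + 1 + real m * real n * \<eta>"
    have D: "D > 0" using assms(1,2,4) by (simp add: D_def add_pos_nonneg)
    have "(2 * real m + 2 * real n) / D < p" using that unfolding assms(6) D_def by simp
    then have "2 * real m + 2 * real n < p * D" using D by (simp add: field_simps)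
    then have "0 < (real m * real n * \<eta> - (real m + real n - 1)) * p + (2 * real m + 2 * real n) * (p - 1)"
      by (simp add: D_def algebra_simps)
    then have "0 < ((real m * real n * \<eta> - (real m + real n - 1)) * p + (2 * real m + 2 * real n) * (p - 1)) / (p - 1)"
      using p1 by simp
    also have "\<dots> = (real m * real n * \<eta> - (real m + real n - 1)) * (p / (p - 1)) + (2 * real m + 2 * real n)"
      using p1 by (simp add: add_divide_distrib)
    also have "\<dots> = real m * ((real n * \<eta> - kap) * (p / (p - 1)) + 2 * real n / real m + 2)"
    proof -
      have eq: "real m * ((real n * \<eta> - kap) * t + 2 * real n / real m + 2) = (real m * real n * \<eta> - real m * kap) * t + 2 * real n + 2 * real m" for t
        using m_pos by (simp add: algebra_simps)
      have mk: "real m * kap = real m + real n - 1" using m_pos by (simp add: kap_def)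
      show ?thesis unfolding eq mk by (simp only: add_ac)
    qed
    finally show ?thesis using m_pos by (simp add: zero_less_mult_iff)
  qed
  show ?thesis
  proof (intro conjI ballI impI allI)
    fix p r assume p: "p \<in> {L<..<M}" and \<eta>: "\<eta> \<ge> 2 * (1 / p - 1 / M)" and r: "1 \<le> r \<and> r < M"
    have p1: "p > 1" using p L1 by simp
    \<comment> \<open>Raising the target to max(p, r) secures p \<le> q while q stays below M. The
      gain then needed, 2 (1/p - 1/q), is below 2 (1/p - 1/M) and so at most \<eta>.\<close>
    define q where "q = max p r"
    have q: "p \<le> q" "r \<le> q" "q < M" using p r by (auto simp: q_def)
    have q0: "q > 0" using p1 q by simp
    have "1 / q \<ge> 1 / M" "1 / p \<ge> 1 / q" using q p1 q0 by (auto intro!: divide_left_mono)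
    moreover have "x = y - 2 * (y - x) / 2" for x y :: real by (simp add: field_simps)
    ultimately show "T_bounded p r"
      unfolding assms(8) using \<eta> r q p
      by (intro toeplitz_bounded_symbol[where q=q and \<eta>'="2 * (1 / p - 1 / q)"] p1 qM pL) (assumption | simp | linarith)+
  next
    fix p assume p: "p \<in> {L<..<M}" and \<eta>: "\<eta> < 2 * (1 / p - 1 / M)"
    have p1: "p > 1" using p L1 by simp
    \<comment> \<open>G is made so that the full gain \<eta> leads from p to p + G; the hypothesis
      keeps the reciprocal 1/p - \<eta>/2 above 1/M, hence positive.\<close>
    have inv: "1 / (p + G p) = 1 / p - \<eta> / 2" "p \<le> p + G p"
    proof -
      have "1 / p - \<eta> / 2 > 1 / M" using \<eta> by simp
      moreover have "1 / M > 0" using M0 by simp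
      ultimately have pos: "1 / p - \<eta> / 2 > 0" by linarith
      have "1 / (p + G p) = 1 / p - \<eta> / 2 \<and> p \<le> p + G p"
      proof (cases "\<eta> = 0")
        case True
        then show ?thesis by (simp add: assms(7))
      next
        case False
        then have e: "\<eta> > 0" using assms(4) by simp
        have pe: "p * \<eta> < 2" using pos p1 by (simp add: field_simps)
        then have d: "2 / \<eta> - p > 0" using e by (simp add: field_simps)
        have "p + G p = p * (2 / \<eta>) / (2 / \<eta> - p)"
        proof -
          have "p + p\<^sup>2 / x = p * (x + p) / x" if "x > 0" for x
            using that by (simp add: field_simps power2_eq_square)
          from this[OF d] show ?thesis using False by (simp add: assms(7))
        qed
        then have "1 / (p + G p) = (2 / \<eta> - p) / (p * (2 / \<eta>))" by simp
        also have "\<dots> = 1 / p - \<eta> / 2" using p1 e by (simp add: field_simps)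
        finally show ?thesis using d False by (simp add: assms(7))
      qed
      then show "1 / (p + G p) = 1 / p - \<eta> / 2" "p \<le> p + G p" by auto
    qed
    have q0: "p + G p > 0" using inv p1 by simp
    have "1 / M < 1 / (p + G p)" using \<eta> inv by simp
    then show qlt: "p + G p < M"
      using q0 M0 by (simp add: field_simps)
    show "T_bounded p (p + G p)"
      unfolding assms(8) using inv p p1 assms(4)
      by (intro toeplitz_bounded_symbol[where q="p + G p" and \<eta>'=\<eta>] p1 qM[OF qlt] pL) auto
  next
    fix p r assume p: "p \<in> {1<..L} \<union> {M..}" and r: "r \<ge> p"
    show "\<not> T_bounded p r"
    proof
      assume "T_bounded p r"
      then have bdd: "toeplitz_bounded H (hartogs_symbol m n \<eta>) p r" by (simp add: assms(8))
      have p1: "p > 1" using p M0 by auto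
      obtain a where a: "a < m" "jj a = 1" using exists_jj_1[OF assms(3)] by blast
      have r0: "r > 0" using p1 r by simp
      note nec = necessity[OF a p1 r0 assms(4) bdd]
      \<comment> \<open>r-integrability of the monomial fails from M on. As r \<ge> p, this excludes
        p \<ge> M and leaves p \<le> L.\<close>
      have "r < M"
      proof (rule ccontr)
        assume "\<not> r < M"
        then have "r * (real m + real n - 1) \<ge> 2 * (real m + real n)"
          using mn1 unfolding assms(5) by (simp add: field_simps)
        with monomial_not_integrable[OF a(2) r0] nec(1) show False by blast
      qed
      with p r have "1 < p" "p \<le> L" by auto
      define D where "D = real m + real n + 1 + real m * real n * \<eta>"
      have D: "D > 0" using assms(1,2,4) by (simp add: D_def add_pos_nonneg)
      \<comment> \<open>p > 1 excludes the entry 1 of the maximum L.\<close>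
      have "p \<le> (2 * real m + 2 * real n) / D"
        using \<open>1 < p\<close> \<open>p \<le> L\<close> unfolding assms(6) D_def by auto
      then have "p * D \<le> 2 * real m + 2 * real n" using D by (simp add: field_simps)
      then have "p * (real m * real n * \<eta> + 1 - real m - real n) + 2 * (real m + real n) * (p - 1) \<le> 0"
        by (simp add: D_def algebra_simps)
      then have "(p * (real m * real n * \<eta> + 1 - real m - real n) + 2 * (real m + real n) * (p - 1)) / (p - 1) \<le> 0"
        using p1 by (simp add: divide_le_0_iff)
      also have "(p * (real m * real n * \<eta> + 1 - real m - real n) + 2 * (real m + real n) * (p - 1)) / (p - 1)
        = p / (p - 1) * (real m * real n * \<eta> + 1 - real m - real n) + 2 * (real m + real n)"
        using p1 by (simp add: add_divide_distrib)
      finally have "(\<integral>\<^sup>+w. ennreal ((cmod (monomial a w) * cmod (hartogs_symbol m n \<eta> w)) powr (p / (p - 1))) \<partial>MH) = \<infinity>"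
        using p1 assms(4) by (intro monomial_symbol_infinite a(2)) auto
      with nec(2) show False by simp
    qed
  qed
qed

end
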